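(* Let $T_1\subseteq\mathbb{R}^2$ be a maximal lattice-free triangle of type 1 and let $T_2\subseteq\mathbb{R}^2$ be a rational maximal lattice-free triangle of type 2, and put $w:=w(T_2)$. Then for every $z>1$: (I) $$P^{T_1}(z)=\begin{cases}0 & \text{if } 1<z\le \tfrac32,\\ \tfrac34\left(\tfrac{2z-3}{z-1}\right)^2 & \text{if } \tfrac32<z<2,\\ 1 & \text{if } 2\le z<+\infty;\end{cases}$$ (II) $$P^{T_2}(z)\ge\begin{cases}0 & \text{if } 1<z\le w,\\ g_1 & \text{if } w<z\le \tfrac{w}{w-1},\\ g_1+g_2 & \text{if } \tfrac{w}{w-1}<z<+\infty,\end{cases}$$ where $g_1=\frac{(z-w)(2wz-w-z)}{w^2(z-1)^2}$ and $g_2=\frac{(w-1)^2(z-1)^2-1}{w^2(z-1)^2}$.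
   Context: A closed convex set $B\subseteq\mathbb{R}^2$ with non-empty interior is lattice-free if its interior contains no point of $\mathbb{Z}^2$, and maximal lattice-free if it is not properly contained in another lattice-free closed convex set. A type 1 triangle is a triangle with integer vertices and exactly one integer point in the relative interior of each edge. A type 2 triangle is a triangle with at least one non-integral vertex $v$, exactly one integer point in the relative interior of each of the two edges incident to $v$, and at least two integer points on the third edge. A split is a set $\{x\in\mathbb{R}^2: b\le a_1x_1+a_2x_2\le b+1\}$ with $a_1,a_2$ coprime integers and $b\in\mathbb{Z}$. For $f\in\mathbb{R}^2$ and rays $r^1,\dots,r^n\in\mathbb{R}^2\setminus\{0\}$ let $R_f^n:=\mathrm{conv}\{s\in\mathbb{R}^n_+: f+\sum_{j=1}^n r^js_j\in\mathbb{Z}^2\}$. For a lattice-free polyhedron $B$ with $f$ in its interior, let $\psi^B$ be the Minkowski functional of $B-f$, i.e. $\psi^B(r)=\min\{\lambda>0: r\in\lambda(B-f)\}$ (taken as $0$ if $r\in\lambda(B-f)$ for all $\lambda>0$); the cut associated with $B$ is $\sum_j\psi^B(r^j)s_j\ge1$. Let $\mathcal S$ be the set of all splits containing $f$ in their interior. For a set $\mathcal L$ of such polyhedra, $\mathcal L(R_f^n)$ denotes the set of $s\in\mathbb{R}^n$ with $s_j\ge0$ for all $j$ satisfying the cuts associated with all members of $\mathcal L$; $\mathcal S(R_f^n)$ is the split closure. For polyhedra $P\subseteq Q\subseteq\mathbb{R}^n_+$ with $P$ of covering type, $\alpha P:=\{x:\alpha x\in P\}$ for $\alpha\in(0,\infty)$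 and $\alpha P:=\mathbb{R}^n_+$ for $\alpha=+\infty$; the strength $t(P,Q)$ is the minimum $\alpha\ge1$ with $Q\subseteq\alpha P$. For a maximal lattice-free triangle $B$ with vertices $v^1,v^2,v^3$ and $f\in\mathrm{int}(B)$, take $n=3$ and the corner rays $r^j=v^j-f$, and set $\mathcal F=\mathcal S\cup\{B\}$. Define $$P^B(z):=\frac{1}{\mathrm{Area}(B)}\int_{f\in\mathrm{int}(B)}\mathbf 1\{t(\mathcal F(R_f^3),\mathcal S(R_f^3))\le z\}\,df,$$ i.e. the probability, for $f$ uniform in the interior of $B$, that the strength of adding the cut from $B$ to the split closure is at most $z$. The lattice width of $B$ is $w(B):=\min_{u\in\mathbb{Z}^2\setminus\{0\}}\left(\max_{x\in B}u^Tx-\min_{x\in B}u^Tx\right)$. *)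

theory Defs
  imports "HOL-Analysis.Analysis" "HOL-Library.Extended_Real"
begin

definition Zpts :: "(real^2) set" where
  "Zpts = {x. \<forall>i. x $ i \<in> \<int>}"

definition lattice_free :: "(real^2) set \<Rightarrow> bool" where
  "lattice_free B \<longleftrightarrow> closed B \<and> convex B \<and> interior B \<noteq> {} \<and> interior B \<inter> Zpts = {}"

definition maximal_lattice_free :: "(real^2) set \<Rightarrow> bool" where
  "maximal_lattice_free B \<longleftrightarrow> lattice_free B \<and> (\<forall>K. lattice_free K \<and> B \<subseteq> K \<longrightarrow> K = B)"

definition is_triangle :: "(3 \<Rightarrow> real^2) \<Rightarrow> bool" where
  "is_triangle v \<longleftrightarrow> \<not> collinear (range v)"

definition type1_triangle :: "(3 \<Rightarrow> real^2) \<Rightarrow> bool" where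
  "type1_triangle v \<longleftrightarrow> is_triangle v \<and> (\<forall>i. v i \<in> Zpts) \<and>
     (\<forall>i j. i \<noteq> j \<longrightarrow> card (open_segment (v i) (v j) \<inter> Zpts) = 1)"

definition type2_triangle :: "(3 \<Rightarrow> real^2) \<Rightarrow> bool" where
  "type2_triangle v \<longleftrightarrow> is_triangle v \<and>
     (\<exists>i j k. distinct [i, j, k] \<and> v i \<notin> Zpts \<and>
        card (open_segment (v i) (v j) \<inter> Zpts) = 1 \<and>
        card (open_segment (v i) (v k) \<inter> Zpts) = 1 \<and>
        (\<exists>p q. p \<noteq> q \<and> p \<in> closed_segment (v j) (v k) \<inter> Zpts \<and>
               q \<in> closed_segment (v j) (v k) \<inter> Zpts))"

definition rational_triangle :: "(3 \<Rightarrow> real^2) \<Rightarrow> bool" where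
  "rational_triangle v \<longleftrightarrow> (\<forall>k i. v k $ i \<in> \<rat>)"

definition is_split :: "(real^2) set \<Rightarrow> bool" where
  "is_split S \<longleftrightarrow> (\<exists>a1 a2 b :: int. coprime a1 a2 \<and>
      S = {x. of_int b \<le> of_int a1 * x $ 1 + of_int a2 * x $ 2 \<and>
              of_int a1 * x $ 1 + of_int a2 * x $ 2 \<le> of_int b + 1})"

definition splits_at :: "real^2 \<Rightarrow> (real^2) set set" where
  "splits_at f = {S. is_split S \<and> f \<in> interior S}"

definition Rf :: "real^2 \<Rightarrow> ('n::finite \<Rightarrow> real^2) \<Rightarrow> (real^'n) set" where
  "Rf f r = convex hull {s. (\<forall>j. 0 \<le> s $ j) \<and> f + (\<Sum>j\<in>UNIV. s $ j *\<^sub>R r j) \<in> Zpts}"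

definition gauge :: "(real^2) set \<Rightarrow> real^2 \<Rightarrow> real^2 \<Rightarrow> real" where
  "gauge B f r =
     (if (\<forall>t>0. r \<in> (\<lambda>x. t *\<^sub>R (x - f)) ` B) then 0
      else Inf {t. t > 0 \<and> r \<in> (\<lambda>x. t *\<^sub>R (x - f)) ` B})"

definition cut_closure :: "(real^2) set set \<Rightarrow> real^2 \<Rightarrow> ('n::finite \<Rightarrow> real^2) \<Rightarrow> (real^'n) set" where
  "cut_closure L f r = {s. (\<forall>j. 0 \<le> s $ j) \<and>
      (\<forall>B\<in>L. (\<Sum>j\<in>UNIV. gauge B f (r j) * s $ j) \<ge> 1)}"

definition scale_set :: "ereal \<Rightarrow> (real^'n::finite) set \<Rightarrow> (real^'n) set" where
  "scale_set \<alpha> P = (if \<alpha> = \<infinity> then {x. \<forall>j. 0 \<le> x $ j}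
                     else {x. real_of_ereal \<alpha> *\<^sub>R x \<in> P})"

definition strength :: "(real^'n::finite) set \<Rightarrow> (real^'n) set \<Rightarrow> ereal" where
  "strength P Q = Inf {\<alpha>. 1 \<le> \<alpha> \<and> Q \<subseteq> scale_set \<alpha> P}"

definition PB :: "(3 \<Rightarrow> real^2) \<Rightarrow> real \<Rightarrow> real" where
  "PB v z = measure lebesgue
      {f \<in> interior (convex hull (range v)).
         strength (cut_closure (splits_at f \<union> {convex hull (range v)}) f (\<lambda>j. v j - f))
                  (cut_closure (splits_at f) f (\<lambda>j. v j - f)) \<le> ereal z}
    / measure lebesgue (convex hull (range v))"

definition lattice_width :: "(real^2) set \<Rightarrow> real" where
  "lattice_width B = Inf ((\<lambda>u. (SUP x\<in>B. u \<bullet> x) - (INF x\<in>B. u \<bullet> x)) ` (Zpts - {0}))"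

end

theory Submission
  imports Defs "HOL-Analysis.Simplex_Content"
begin

text \<open>
  Since \<open>f\<close> sees the corners of \<open>B\<close> at gauge 1, the strength is at most \<open>z\<close> iff every point of the split
  closure has coordinate sum at least \<open>1 / z\<close>.

  In a type 1 triangle let \<open>l1, l2, l3\<close> be the barycentric coordinates of \<open>f\<close>.  The splits parallel
  to the edges give \<open>(1 - 2 * lj) * (1 - \<Sigma>s) \<le> sj\<close> whenever \<open>lj < 1/2\<close>.  Adding these up, the
  coordinate sum is at least \<open>1/2\<close> if \<open>f\<close> lies in the triangle of the midpoints of the edges, and at
  least \<open>2 * li / (1 + 2 * li)\<close> if \<open>li > 1/2\<close>; the point proportional to the positive parts of
  \<open>1 - 2 * lj\<close> attains these bounds and satisfies all other split cuts.  So the strength is 2 in the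
  middle and \<open>1 + 1 / (2 * li)\<close> in the corners, and its sublevel sets are three corner triangles.

  In a type 2 triangle, unimodular coordinates turn four boundary points into the unit square: the
  base lies on \<open>Y = 0\<close>, the apex at height \<open>h\<close>, and the chord at \<open>Y = 1\<close> has length 1.  Using just
  the split \<open>0 \<le> Y \<le> 1\<close> or just the split \<open>0 \<le> X \<le> 1\<close> bounds the strength by \<open>z\<close> outside of
  explicit triangles, whose areas add up to the claimed bound.  The lattice width is the minimum of
  \<open>h\<close> and \<open>h / (h - 1)\<close>, and the two splits exchange their roles at \<open>h = 2\<close>.
\<close>

section \<open>Splits and their gauges\<close>

text \<open>Type 1 is settled exactly because each bound on the coordinate sum is attained by a
  witness point. A witness must satisfy infinitely many split cuts; integrality makes this finite
  casework, since the edge midpoints are integer points and an integral form takes no value strictly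
  inside the strip at any vertex or midpoint. For type 2 no witnesses are built, only upper bounds
  on the strength, hence an inequality. There the sublevel set is never computed: its complement is
  covered by triangles. Turning such a cover into a lower bound needs the sublevel set to be
  measurable, since \<open>measure\<close> of a non-measurable set is 0. In both types an empty
  lattice triangle yields a dual basis, whose integral forms serve as coordinates and as split
  normals. The value 2 separates the regimes of type 2 because any integral form involving both
  coordinates varies by at least 2 over the inscribed unit square, while \<open>h\<close> and
  \<open>h / (h - 1)\<close> cannot both exceed 2.\<close>

definition split_set :: "real^2 \<Rightarrow> int \<Rightarrow> (real^2) set" where
  "split_set a b = {x. of_int b \<le> a \<bullet> x \<and> a \<bullet> x \<le> of_int b + 1}"

lemma inner_real2: "(x::real^2) \<bullet> y = x $ 1 * y $ 1 + x $ 2 * y $ 2"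
  by (simp add: inner_vec_def sum_2)

lemma Zpts_vector [simp]: "vector [of_int m, of_int n] \<in> Zpts"
  by (auto simp: Zpts_def forall_2)

lemma ZptsE:
  assumes "a \<in> Zpts"
  obtains m n where "a $ 1 = of_int m" "a $ 2 = of_int n"
  using assms by (auto simp: Zpts_def forall_2 elim!: Ints_cases)

lemma Zpts_inner: "\<lbrakk>a \<in> Zpts; b \<in> Zpts\<rbrakk> \<Longrightarrow> a \<bullet> b \<in> \<int>"
  by (auto simp: Zpts_def inner_real2)

lemma Zpts_add: "\<lbrakk>a \<in> Zpts; b \<in> Zpts\<rbrakk> \<Longrightarrow> a + b \<in> Zpts"
  by (auto simp: Zpts_def)

lemma Zpts_diff: "\<lbrakk>a \<in> Zpts; b \<in> Zpts\<rbrakk> \<Longrightarrow> a - b \<in> Zpts"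
  by (auto simp: Zpts_def)

lemma Zpts_scale: "\<lbrakk>t \<in> \<int>; b \<in> Zpts\<rbrakk> \<Longrightarrow> t *\<^sub>R b \<in> Zpts"
  by (auto simp: Zpts_def)

text \<open>An integral \<open>u\<close> with \<open>a \<bullet> u = 1\<close> is a Bezout
  certificate of coprimality; the dual bases constructed later supply it directly.\<close>

lemma is_split_split_set:
  assumes "a \<in> Zpts" "u \<in> Zpts" "a \<bullet> u = 1"
  shows "is_split (split_set a b)"
proof -
  obtain a1 a2 where a: "a $ 1 = of_int a1" "a $ 2 = of_int a2"
    using assms(1) by (rule ZptsE)
  obtain u1 u2 where u: "u $ 1 = of_int u1" "u $ 2 = of_int u2"
    using assms(2) by (rule ZptsE)
  have "real_of_int (a1 * u1 + a2 * u2) = 1"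
    using assms(3) a u by (simp add: inner_real2)
  then have "a1 * u1 + a2 * u2 = 1" by linarith
  then have "coprime a1 a2"
    by (metis coprimeI dvd_add dvd_mult2)
  then show ?thesis
    unfolding is_split_def split_set_def using a
    by (intro exI[of _ a1] exI[of _ a2] exI[of _ b]) (auto simp: inner_real2)
qed

lemma is_splitE:
  assumes "is_split S"
  obtains a b where "a \<in> Zpts" "a \<noteq> 0" "S = split_set a b"
proof -
  obtain a1 a2 b where c: "coprime a1 a2" and S:
     "S = {x. of_int b \<le> of_int a1 * x $ 1 + of_int a2 * x $ 2 \<and>
              of_int a1 * x $ 1 + of_int a2 * x $ 2 \<le> of_int b + 1}"
    using assms unfolding is_split_def by blast
  have nz: "vector [of_int a1, of_int a2] \<noteq> (0::real^2)"
  proof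
    assume *: "vector [of_int a1, of_int a2] = (0::real^2)"
    have "a1 = 0" "a2 = 0"
      using arg_cong[OF *, of "\<lambda>x. x $ 1"] arg_cong[OF *, of "\<lambda>x. x $ 2"] by auto
    then show False using c by auto
  qed
  show ?thesis
    by (rule that[OF Zpts_vector nz, of b]) (auto simp: S split_set_def inner_real2)
qed

lemma interior_split_set:
  assumes "a \<noteq> 0"
  shows "interior (split_set a b) = {x. of_int b < a \<bullet> x \<and> a \<bullet> x < of_int b + 1}"
proof -
  have "split_set a b = {x. a \<bullet> x \<le> of_int b + 1} \<inter> {x. a \<bullet> x \<ge> of_int b}"
    by (auto simp: split_set_def)
  then show ?thesis
    using assms by (auto simp: interior_halfspace_le interior_halfspace_ge)
qed

text \<open>Closed form of the gauge of a strip: one quotient for each side through which the ray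
  can leave, and the maximum picks the side that is actually met.\<close>

definition split_gauge :: "real^2 \<Rightarrow> int \<Rightarrow> real^2 \<Rightarrow> real^2 \<Rightarrow> real" where
  "split_gauge a b f r = max (a \<bullet> r / (of_int b + 1 - a \<bullet> f)) (- (a \<bullet> r) / (a \<bullet> f - of_int b))"

lemma split_gauge_nonneg:
  assumes "of_int b < a \<bullet> f" "a \<bullet> f < of_int b + 1"
  shows "0 \<le> split_gauge a b f r"
  using assms by (cases "a \<bullet> r \<ge> 0") (auto simp: split_gauge_def le_max_iff_disj divide_le_0_iff)

lemma image_scale_shift_iff:
  fixes B :: "(real^2) set"
  assumes "t > 0"
  shows "r \<in> (\<lambda>x. t *\<^sub>R (x - f)) ` B \<longleftrightarrow> f + (1/t) *\<^sub>R r \<in> B"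
proof
  assume "r \<in> (\<lambda>x. t *\<^sub>R (x - f)) ` B"
  then show "f + (1/t) *\<^sub>R r \<in> B" using assms by auto
next
  assume "f + (1/t) *\<^sub>R r \<in> B"
  then show "r \<in> (\<lambda>x. t *\<^sub>R (x - f)) ` B"
    using assms by (intro image_eqI[of _ _ "f + (1/t) *\<^sub>R r"]) auto
qed

lemma Inf_pos_atLeast:
  assumes "(0::real) < m" shows "Inf {t. t > 0 \<and> m \<le> t} = m"
proof -
  have "{t. t > 0 \<and> m \<le> t} = {m..}" using assms by auto
  then show ?thesis by simp
qed

lemma gauge_split_set:
  assumes f: "of_int b < a \<bullet> f" "a \<bullet> f < of_int b + 1"
  shows "gauge (split_set a b) f r = split_gauge a b f r"
proof -
  let ?M = "split_gauge a b f r"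
  have iff: "r \<in> (\<lambda>x. t *\<^sub>R (x - f)) ` split_set a b \<longleftrightarrow> ?M \<le> t" if "t > 0" for t
    unfolding image_scale_shift_iff[OF that] using that f
    by (simp add: split_set_def split_gauge_def inner_add_right field_simps) (argo)
  show ?thesis
  proof (cases "?M = 0")
    case True
    then show ?thesis using iff by (auto simp: gauge_def)
  next
    case False
    then have M: "?M > 0" using split_gauge_nonneg[OF f, of r] by linarith
    have "\<not> (\<forall>t>0. r \<in> (\<lambda>x. t *\<^sub>R (x - f)) ` split_set a b)"
      using iff[of "?M/2"] M by (metis half_gt_zero field_sum_of_halves less_add_same_cancel1 not_le)
    moreover have "{t. t > 0 \<and> r \<in> (\<lambda>x. t *\<^sub>R (x - f)) ` split_set a b} = {t. t > 0 \<and> ?M \<le> t}"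
      using iff by auto
    ultimately show ?thesis using Inf_pos_atLeast[OF M] by (auto simp: gauge_def)
  qed
qed

abbreviation (input) split_closure :: "(3 \<Rightarrow> real^2) \<Rightarrow> real^2 \<Rightarrow> (real^3) set" where
  "split_closure v f \<equiv> cut_closure (splits_at f) f (\<lambda>j. v j - f)"

lemma split_closureD:
  assumes "s \<in> split_closure v f" "a \<in> Zpts" "u \<in> Zpts" "a \<bullet> u = 1"
    and f: "of_int b < a \<bullet> f" "a \<bullet> f < of_int b + 1"
  shows "1 \<le> (\<Sum>j\<in>UNIV. split_gauge a b f (v j - f) * s $ j)"
proof -
  have "a \<noteq> 0" using assms(4) by auto
  then have "split_set a b \<in> splits_at f"
    using is_split_split_set[OF assms(2-4)] f by (auto simp: splits_at_def interior_split_set)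
  then show ?thesis
    using assms(1) gauge_split_set[OF f] by (auto simp: cut_closure_def)
qed

text \<open>The family tested here contains all splits and also the strips of nonprimitive integral
  forms, for which the witness estimates hold just as well.\<close>

lemma split_closureI:
  assumes "\<And>j. 0 \<le> s $ j"
    and "\<And>a b. \<lbrakk>a \<in> Zpts; of_int b < a \<bullet> f; a \<bullet> f < of_int b + 1\<rbrakk>
           \<Longrightarrow> 1 \<le> (\<Sum>j\<in>UNIV. split_gauge a b f (v j - f) * s $ j)"
  shows "s \<in> split_closure v f"
proof -
  have "1 \<le> (\<Sum>j\<in>UNIV. gauge S f (v j - f) * s $ j)" if S: "S \<in> splits_at f" for S
  proof -
    have "is_split S" "f \<in> interior S" using S by (auto simp: splits_at_def)
    then obtain a b where ab: "a \<in> Zpts" "a \<noteq> 0" "S = split_set a b"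
      by (auto elim: is_splitE)
    have f: "of_int b < a \<bullet> f" "a \<bullet> f < of_int b + 1"
      using \<open>f \<in> interior S\<close> ab interior_split_set by auto
    show ?thesis using assms(2)[OF ab(1) f] gauge_split_set[OF f] ab(3) by simp
  qed
  then show ?thesis using assms(1) by (auto simp: cut_closure_def)
qed

section \<open>Barycentric coordinates and the strength\<close>

definition cross :: "real^2 \<Rightarrow> real^2 \<Rightarrow> real" where
  "cross u v = u $ 1 * v $ 2 - u $ 2 * v $ 1"

text \<open>Cramer's rule: the signed area of the triangle with vertex \<open>i\<close> replaced by
  \<open>x\<close>, divided by that of the whole triangle.\<close>

definition bary :: "(3 \<Rightarrow> real^2) \<Rightarrow> 3 \<Rightarrow> real^2 \<Rightarrow> real" where
  "bary v i x = (if i = 1 then cross (v 2 - x) (v 3 - x) else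
                if i = 2 then cross (v 3 - x) (v 1 - x) else cross (v 1 - x) (v 2 - x))
               / cross (v 2 - v 1) (v 3 - v 1)"

abbreviation (input) tri :: "(3 \<Rightarrow> real^2) \<Rightarrow> (real^2) set" where
  "tri v \<equiv> convex hull (range v)"

lemma range_3: "range (v :: 3 \<Rightarrow> 'a) = {v 1, v 2, v 3}"
  by (simp add: UNIV_3)

lemma cross_eq_0_iff:
  assumes W: "W \<noteq> 0"
  shows "(\<exists>c. U = c *\<^sub>R W) \<longleftrightarrow> cross W U = 0"
proof
  assume c: "cross W U = 0"
  have "W $ 1 \<noteq> 0 \<or> W $ 2 \<noteq> 0"
    using W by (auto simp: vec_eq_iff forall_2)
  then show "\<exists>c. U = c *\<^sub>R W"
  proof
    assume *: "W $ 1 \<noteq> 0"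
    have "U = (U $ 1 / W $ 1) *\<^sub>R W"
      using c * by (simp add: vec_eq_iff forall_2 cross_def field_simps)
    then show ?thesis ..
  next
    assume *: "W $ 2 \<noteq> 0"
    have "U = (U $ 2 / W $ 2) *\<^sub>R W"
      using c * by (simp add: vec_eq_iff forall_2 cross_def field_simps)
    then show ?thesis ..
  qed
qed (auto simp: cross_def)

lemma collinear_iff_cross:
  fixes A B C :: "real^2"
  shows "collinear {A, B, C} \<longleftrightarrow> cross (B - A) (C - A) = 0"
proof -
  have "collinear {A, B, C} \<longleftrightarrow> collinear {0, B - A, C - A}"
    using collinear_3[of B A C] by (simp add: insert_commute)
  also have "\<dots> \<longleftrightarrow> cross (B - A) (C - A) = 0"
  proof (cases "B - A = 0")
    case True then show ?thesis by (simp add: cross_def)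
  next
    case False
    from cross_eq_0_iff[OF False] show ?thesis using False by (auto simp: collinear_lemma cross_def)
  qed
  finally show ?thesis .
qed

lemma is_triangle_cross: "is_triangle v \<longleftrightarrow> cross (v 2 - v 1) (v 3 - v 1) \<noteq> 0"
  by (simp add: is_triangle_def range_3 collinear_iff_cross)

lemma sum_bary: "is_triangle v \<Longrightarrow> (\<Sum>i\<in>UNIV. bary v i x) = 1"
  unfolding is_triangle_cross
  by (simp add: sum_3 bary_def add_divide_distrib [symmetric]) (simp add: cross_def algebra_simps)

lemma bary_combination:
  assumes "is_triangle v"
  shows "(\<Sum>i\<in>UNIV. bary v i x *\<^sub>R v i) = x"
proof -
  define D where "D = cross (v 2 - v 1) (v 3 - v 1)"
  have D: "D \<noteq> 0" using assms by (simp add: D_def is_triangle_cross)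
  have "D * (\<Sum>i\<in>UNIV. bary v i x *\<^sub>R v i) $ k = D * x $ k" for k
    unfolding bary_def D_def[symmetric] using D
    by (cases k rule: exhaust_2[THEN disjE]; simp add: sum_3 distrib_left)
       (simp_all add: D_def cross_def algebra_simps)
  then show ?thesis using D by (simp add: vec_eq_iff)
qed

lemma bary_vertex: "is_triangle v \<Longrightarrow> bary v i (v j) = (if i = j then 1 else 0)"
  using exhaust_3[of i] exhaust_3[of j] unfolding is_triangle_cross
  by (auto simp: bary_def cross_def algebra_simps)

lemma bary_affine:
  obtains n c where "\<And>x. bary v i x = n \<bullet> x + c"
proof -
  define D where "D = cross (v 2 - v 1) (v 3 - v 1)"
  have *: "\<exists>n c. \<forall>x. cross (p - x) (q - x) / D = n \<bullet> x + c" for p q :: "real^2"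
    by (rule exI[of _ "(1/D) *\<^sub>R vector [p $ 2 - q $ 2, q $ 1 - p $ 1]"], rule exI[of _ "cross p q / D"])
       (auto simp: cross_def inner_real2 field_simps diff_divide_distrib add_divide_distrib)
  have "\<exists>n c. \<forall>x. bary v i x = n \<bullet> x + c"
    using *[of "v 2" "v 3"] *[of "v 3" "v 1"] *[of "v 1" "v 2"]
    unfolding bary_def D_def by (cases "i = 1"; cases "i = 2"; simp)
  then show ?thesis using that by blast
qed

lemma bary_sum:
  assumes "(\<Sum>k\<in>K. t k) = 1"
  shows "bary v i (\<Sum>k\<in>K. t k *\<^sub>R p k) = (\<Sum>k\<in>K. t k * bary v i (p k))"
proof -
  obtain n c where n: "\<And>x. bary v i x = n \<bullet> x + c" using bary_affine by blast
  have "(\<Sum>k\<in>K. t k * bary v i (p k)) = (\<Sum>k\<in>K. t k * (n \<bullet> p k)) + (\<Sum>k\<in>K. t k * c)"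
    by (simp add: n distrib_left sum.distrib)
  also have "(\<Sum>k\<in>K. t k * c) = c"
    using assms by (simp add: sum_distrib_right[symmetric])
  finally show ?thesis by (simp add: n inner_sum_right)
qed

lemma bary_add_diff: "bary v i (p + s *\<^sub>R (q - p') + t *\<^sub>R (r - r')) =
   bary v i p + s * (bary v i q - bary v i p') + t * (bary v i r - bary v i r')"
proof -
  obtain n c where n: "\<And>x. bary v i x = n \<bullet> x + c" using bary_affine by blast
  show ?thesis by (simp add: n inner_add_right inner_diff_right)
qed

lemma bary_add_diff1: "bary v i (p + s *\<^sub>R (q - p')) = bary v i p + s * (bary v i q - bary v i p')"
  using bary_add_diff[of v i p s q p' 0 0 0] by simp

lemma bary_unique:
  assumes "is_triangle v" "(\<Sum>k\<in>UNIV. t k) = 1"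
  shows "bary v i (\<Sum>k\<in>UNIV. t k *\<^sub>R v k) = t i"
  by (simp add: bary_sum[OF assms(2)] bary_vertex[OF assms(1)] if_distrib cong: if_cong)

lemma tri_eq:
  assumes "is_triangle v"
  shows "tri v = {x. \<forall>i. 0 \<le> bary v i x}"
proof (intro set_eqI iffI)
  fix x assume "x \<in> tri v"
  then obtain t1 t2 t3 where t: "0 \<le> t1" "0 \<le> t2" "0 \<le> t3" "t1 + t2 + t3 = 1"
    "x = t1 *\<^sub>R v 1 + t2 *\<^sub>R v 2 + t3 *\<^sub>R v 3"
    by (auto simp: range_3 convex_hull_3)
  define t where "t = (\<lambda>k::3. if k = 1 then t1 else if k = 2 then t2 else t3)"
  have "bary v i x = t i" for i
    using bary_unique[OF assms, of t i] t by (simp add: sum_3 t_def)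
  then show "x \<in> {x. \<forall>i. 0 \<le> bary v i x}" using t by (auto simp: t_def)
next
  fix x assume "x \<in> {x. \<forall>i. 0 \<le> bary v i x}"
  then show "x \<in> tri v"
    using sum_bary[OF assms, of x] bary_combination[OF assms, of x]
    unfolding range_3 convex_hull_3 sum_3
    by (intro CollectI exI[of _ "bary v 1 x"] exI[of _ "bary v 2 x"] exI[of _ "bary v 3 x"]) auto
qed

lemma interior_tri_eq:
  assumes "is_triangle v"
  shows "interior (tri v) = {x. \<forall>i. 0 < bary v i x}"
proof -
  have nc: "\<not> collinear {v 1, v 2, v 3}" using assms by (simp add: is_triangle_def range_3)
  have int: "interior (convex hull {v 1, v 2, v 3}) = {x. \<exists>t1 t2 t3. 0 < t1 \<and> 0 < t2 \<and> 0 < t3 \<and>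
      t1 + t2 + t3 = 1 \<and> t1 *\<^sub>R v 1 + t2 *\<^sub>R v 2 + t3 *\<^sub>R v 3 = x}"
    by (rule interior_convex_hull_3_minimal[OF nc]) simp
  show ?thesis
  proof (intro set_eqI iffI)
    fix x assume "x \<in> interior (tri v)"
    then obtain t1 t2 t3 where t: "0 < t1" "0 < t2" "0 < t3" "t1 + t2 + t3 = 1"
      "x = t1 *\<^sub>R v 1 + t2 *\<^sub>R v 2 + t3 *\<^sub>R v 3"
      unfolding range_3 int by auto
    define t where "t = (\<lambda>k::3. if k = 1 then t1 else if k = 2 then t2 else t3)"
    have "bary v i x = t i" for i
      using bary_unique[OF assms, of t i] t by (simp add: sum_3 t_def)
    then show "x \<in> {x. \<forall>i. 0 < bary v i x}" using t by (auto simp: t_def)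
  next
    fix x assume "x \<in> {x. \<forall>i. 0 < bary v i x}"
    then show "x \<in> interior (tri v)"
      using sum_bary[OF assms, of x] bary_combination[OF assms, of x]
      unfolding range_3 sum_3 int
      by (intro CollectI exI[of _ "bary v 1 x"] exI[of _ "bary v 2 x"] exI[of _ "bary v 3 x"]) auto
  qed
qed

lemma distinct3_sum:
  assumes "distinct [i, j, k :: 3]"
  shows "(\<Sum>l\<in>UNIV. g l) = g i + g j + (g k :: 'a :: comm_monoid_add)"
proof -
  have "UNIV = {i, j, k}"
    using assms by (intro card_subset_eq[symmetric]) auto
  then have "sum g UNIV = sum g {i, j, k}" by simp
  then show ?thesis using assms by (simp add: add.assoc)
qed

lemma distinct3_all:
  assumes "distinct [i, j, k :: 3]"
  shows "(\<forall>l. P l) \<longleftrightarrow> P i \<and> P j \<and> P k"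
proof -
  have "UNIV = {i, j, k}"
    using assms by (intro card_subset_eq[symmetric]) auto
  then show ?thesis by (metis UNIV_I insertE singletonD)
qed

lemma bary_eqD:
  assumes "is_triangle v" "distinct [i, j, k]"
  shows "bary v i x + bary v j x + bary v k x = 1"
    "x = v i + bary v j x *\<^sub>R (v j - v i) + bary v k x *\<^sub>R (v k - v i)"
proof -
  show s: "bary v i x + bary v j x + bary v k x = 1"
    using sum_bary[OF assms(1), of x] by (simp add: distinct3_sum[OF assms(2)])
  have i: "bary v i x = 1 - bary v j x - bary v k x" using s by simp
  have "v i + bary v j x *\<^sub>R (v j - v i) + bary v k x *\<^sub>R (v k - v i)
        = bary v i x *\<^sub>R v i + bary v j x *\<^sub>R v j + bary v k x *\<^sub>R v k"
    unfolding i by (simp add: algebra_simps)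
  also have "\<dots> = x"
    using bary_combination[OF assms(1), of x] by (simp add: distinct3_sum[OF assms(2)])
  finally show "x = v i + bary v j x *\<^sub>R (v j - v i) + bary v k x *\<^sub>R (v k - v i)" ..
qed

lemma inner_combination:
  assumes "is_triangle v" "distinct [i, j, k]"
  shows "n \<bullet> x = bary v i x * (n \<bullet> v i) + bary v j x * (n \<bullet> v j) + bary v k x * (n \<bullet> v k)"
proof -
  have "n \<bullet> x = n \<bullet> (\<Sum>i\<in>UNIV. bary v i x *\<^sub>R v i)" by (simp add: bary_combination[OF assms(1)])
  then show ?thesis by (simp add: distinct3_sum[OF assms(2)] inner_add_right)
qed

text \<open>A corner of \<open>B\<close> is seen from \<open>f\<close> at gauge exactly 1, so the cut of \<open>B\<close> reads \<open>\<Sum>j. s j \<ge> 1\<close>.\<close>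

lemma gauge_tri_vertex:
  assumes tri: "is_triangle v" and f: "f \<in> interior (tri v)"
  shows "gauge (tri v) f (v j - f) = 1"
proof -
  have iff: "v j - f \<in> (\<lambda>x. t *\<^sub>R (x - f)) ` tri v \<longleftrightarrow> 1 \<le> t" if t: "t > 0" for t
  proof -
    have l: "bary v i f > 0" for i using f by (auto simp: interior_tri_eq[OF tri])
    have "v j - f \<in> (\<lambda>x. t *\<^sub>R (x - f)) ` tri v \<longleftrightarrow>
          (\<forall>i. 0 \<le> bary v i f + (1/t) * ((if i = j then 1 else 0) - bary v i f))"
      unfolding image_scale_shift_iff[OF t] tri_eq[OF tri] mem_Collect_eq
      bary_add_diff1 bary_vertex[OF tri] ..
    also have "\<dots> \<longleftrightarrow> 1 \<le> t"
    proof
      assume a: "\<forall>i. 0 \<le> bary v i f + (1/t) * ((if i = j then 1 else 0) - bary v i f)"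
      \<comment> \<open>A coordinate other than \<open>j\<close> vanishes at \<open>v j\<close>, so
        it is the one that turns negative beyond the vertex.\<close>
      obtain i where "i \<noteq> j" using that[of 1] that[of 2] by (cases "j = 1") auto
      then have "0 \<le> bary v i f * (1 - 1/t)" using a[rule_format, of i] by (simp add: algebra_simps)
      then show "1 \<le> t" using l[of i] t by (simp add: zero_le_mult_iff field_simps)
    next
      assume "1 \<le> t"
      then have "1/t \<le> 1" "0 \<le> 1/t" by auto
      show "\<forall>i. 0 \<le> bary v i f + (1/t) * ((if i = j then 1 else 0) - bary v i f)"
      proof
        fix i
        have "0 \<le> bary v i f * (1 - 1/t)" using l[of i] \<open>1/t \<le> 1\<close> by simp
        moreover have "0 \<le> (1/t) * (if i = j then 1 else 0 :: real)" using \<open>0 \<le> 1/t\<close> by auto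
        ultimately show "0 \<le> bary v i f + (1/t) * ((if i = j then 1 else 0) - bary v i f)"
          by (simp add: algebra_simps)
      qed
    qed
    finally show ?thesis .
  qed
  have "\<not> (\<forall>t>0. v j - f \<in> (\<lambda>x. t *\<^sub>R (x - f)) ` tri v)"
    using iff[of "1/2"] by (auto intro: exI[of _ "1/2"])
  moreover have "{t. t > 0 \<and> v j - f \<in> (\<lambda>x. t *\<^sub>R (x - f)) ` tri v} = {t. t > 0 \<and> 1 \<le> t}"
    using iff by auto
  ultimately show ?thesis using Inf_pos_atLeast[of 1] by (auto simp: gauge_def)
qed

text \<open>The split closure is stable under factors at least 1, so after scaling by
  \<open>z\<close> only the cut of the triangle remains to be checked.\<close>

lemma strength_le_iff:
  assumes tri: "is_triangle v" and f: "f \<in> interior (tri v)" and z: "z > 1"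
  shows "strength (cut_closure (splits_at f \<union> {tri v}) f (\<lambda>j. v j - f)) (split_closure v f) \<le> ereal z
    \<longleftrightarrow> (\<forall>s\<in>split_closure v f. 1 \<le> z * (\<Sum>j\<in>UNIV. s $ j))" (is "strength ?P ?Q \<le> _ \<longleftrightarrow> ?R")
proof -
  have P: "s \<in> ?P \<longleftrightarrow> s \<in> ?Q \<and> 1 \<le> (\<Sum>j\<in>UNIV. s $ j)" for s
    by (auto simp: cut_closure_def gauge_tri_vertex[OF tri f])
  have scale: "\<alpha> *\<^sub>R s \<in> ?Q" if "s \<in> ?Q" "\<alpha> \<ge> 1" for s \<alpha>
  proof -
    have "1 \<le> (\<Sum>j\<in>UNIV. gauge B f (v j - f) * (\<alpha> *\<^sub>R s) $ j)" if "B \<in> splits_at f" for B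
    proof -
      have 1: "1 \<le> (\<Sum>j\<in>UNIV. gauge B f (v j - f) * s $ j)"
        using \<open>s \<in> ?Q\<close> that by (auto simp: cut_closure_def)
      have "(\<Sum>j\<in>UNIV. gauge B f (v j - f) * (\<alpha> *\<^sub>R s) $ j) = \<alpha> * (\<Sum>j\<in>UNIV. gauge B f (v j - f) * s $ j)"
        by (simp add: sum_distrib_left mult_ac)
      then show ?thesis using mult_mono[OF \<open>\<alpha> \<ge> 1\<close> 1] \<open>\<alpha> \<ge> 1\<close> by simp
    qed
    then show ?thesis using that by (auto simp: cut_closure_def)
  qed
  show ?thesis
  proof
    assume R: ?R
    have "z *\<^sub>R s \<in> ?P" if "s \<in> ?Q" for s
      using R z scale that unfolding P by (auto simp: sum_distrib_left)
    then have "?Q \<subseteq> scale_set (ereal z) ?P"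
      by (auto simp: scale_set_def)
    then show "strength ?P ?Q \<le> ereal z"
      unfolding strength_def using z by (intro Inf_lower) (auto simp: one_ereal_def)
  next
    assume str: "strength ?P ?Q \<le> ereal z"
    show ?R
    proof
      fix s assume s: "s \<in> ?Q"
      let ?S = "\<Sum>j\<in>UNIV. s $ j"
      have S: "0 \<le> ?S" using s by (auto simp: cut_closure_def intro!: sum_nonneg)
      show "1 \<le> z * ?S"
      proof (rule ccontr)
        assume n: "\<not> 1 \<le> z * ?S"
        \<comment> \<open>The infimum is not known to be attained, so the inclusion is available
          only for some factor below a \<open>z' > z\<close>. Any such \<open>z'\<close> with
          \<open>z' * ?S < 1\<close> serves; the denominator \<open>?S + 1\<close> avoids a case
          distinction on \<open>?S = 0\<close>.\<close>
        define z' where "z' = z + (1 - z * ?S) / (?S + 1)"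
        have "z' > z" using n S by (simp add: z'_def)
        have "z' * ?S < 1"
        proof -
          have "z' * ?S = z * ?S + (1 - z * ?S) * (?S / (?S + 1))"
            using S by (simp add: z'_def field_simps)
          also have "\<dots> < z * ?S + (1 - z * ?S) * 1"
            using n S by (intro add_strict_left_mono mult_strict_left_mono) auto
          finally show ?thesis by simp
        qed
        have "Inf {\<alpha>. 1 \<le> \<alpha> \<and> ?Q \<subseteq> scale_set \<alpha> ?P} < ereal z'"
          using str \<open>z' > z\<close> unfolding strength_def
          by (meson ereal_less_le less_ereal.simps(1) order_le_less_trans less_le_trans)
        then obtain \<alpha> where \<alpha>: "1 \<le> \<alpha>" "?Q \<subseteq> scale_set \<alpha> ?P" "\<alpha> < ereal z'"
          unfolding Inf_less_iff by auto
        then obtain r where r: "\<alpha> = ereal r" "1 \<le> r" "r < z'"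
          by (cases \<alpha>) (auto simp: one_ereal_def)
        have "r *\<^sub>R s \<in> ?P" using \<alpha>(2) s r by (auto simp: scale_set_def)
        then have "1 \<le> r * ?S" unfolding P by (simp add: sum_distrib_left)
        also have "\<dots> \<le> z' * ?S" using r S by (intro mult_right_mono) auto
        finally show False using \<open>z' * ?S < 1\<close> by simp
      qed
    qed
  qed
qed

section \<open>Measurability of the sublevel sets of the strength\<close>

lemma borel_imp_lebesgue: "S \<in> sets borel \<Longrightarrow> S \<in> sets lebesgue" for S :: "'a::euclidean_space set"
  by (metis lborelD sets_completionI_sets)

text \<open>A split matters only for \<open>f\<close> in its interior, which is precisely where both
  denominators of its gauge are positive and the gauge depends continuously on \<open>f\<close>.
  Hence violation is an open condition, and membership in the split closure is closed jointly in
  \<open>s\<close> and \<open>f\<close>.\<close>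

lemma open_split_violation:
  assumes "is_split S"
  shows "open {(s :: real^3, f). f \<in> interior S \<and> (\<Sum>j\<in>UNIV. gauge S f (v j - f) * s $ j) < 1}"
proof -
  obtain a b where ab: "a \<in> Zpts" "a \<noteq> 0" "S = split_set a b"
    using assms by (rule is_splitE)
  define h where "h = (\<lambda>p::(real^3) \<times> (real^2). \<Sum>j\<in>UNIV. split_gauge a b (snd p) (v j - snd p) * fst p $ j)"
  have int: "f \<in> interior S \<longleftrightarrow> of_int b < a \<bullet> f \<and> a \<bullet> f < of_int b + 1" for f
    by (simp add: ab interior_split_set)
  have "continuous_on (UNIV \<times> interior S) h"
    unfolding h_def split_gauge_def
    by (intro continuous_intros) (auto simp: int)
  then have "open ((UNIV \<times> interior S) \<inter> h -` {..<1})"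
    by (intro continuous_open_preimage open_Times) auto
  moreover have "{(s :: real^3, f). f \<in> interior S \<and> (\<Sum>j\<in>UNIV. gauge S f (v j - f) * s $ j) < 1}
      = (UNIV \<times> interior S) \<inter> h -` {..<1}"
    by (auto simp: h_def ab(3) interior_split_set[OF ab(2)] gauge_split_set)
  ultimately show ?thesis by simp
qed

text \<open>The set of \<open>f\<close> whose split closure contains a point of coordinate sum at most \<open>r\<close> is closed,
  being a projection along a compact set; hence the sublevel sets of the strength are Borel.\<close>

lemma sets_split_bound:
  "{f \<in> interior (tri v). \<forall>s\<in>split_closure v f. 1 \<le> z * (\<Sum>j\<in>UNIV. s $ j)} \<in> sets lebesgue"
  if z: "z > 0"
proof -
  define W where "W = (\<lambda>r. {(s, f). (\<forall>j. 0 \<le> s $ j) \<and> (\<Sum>j\<in>UNIV. s $ j) \<le> r} \<inter>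
     (\<Inter>S\<in>Collect is_split. - {(s :: real^3, f). f \<in> interior S \<and> (\<Sum>j\<in>UNIV. gauge S f (v j - f) * s $ j) < 1}))"
  define E where "E = (\<lambda>r. {f. \<exists>s. s \<in> cbox 0 (\<chi> j. r) \<and> (s, f) \<in> W r})"
  have W: "closed (W r)" for r
    unfolding W_def
  proof (intro closed_Int closed_INT ballI)
    have "closed {p::(real^3)\<times>(real^2). (\<forall>j. 0 \<le> fst p $ j) \<and> (\<Sum>j\<in>UNIV. fst p $ j) \<le> r}"
      by (intro closed_Collect_conj closed_Collect_all closed_Collect_le continuous_intros)
    then show "closed {(s::real^3, f::real^2). (\<forall>j. 0 \<le> s $ j) \<and> (\<Sum>j\<in>UNIV. s $ j) \<le> r}"
      by (simp add: case_prod_unfold)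
  qed (use open_split_violation in \<open>auto simp: closed_def\<close>)
  have E: "closed (E r)" for r
    unfolding E_def by (rule closed_compact_projection) (auto simp: W)
  have memW: "(s, f) \<in> W r \<longleftrightarrow> s \<in> split_closure v f \<and> (\<Sum>j\<in>UNIV. s $ j) \<le> r" for s f r
    by (auto simp: W_def cut_closure_def splits_at_def not_less)
  have memE: "f \<in> E r \<longleftrightarrow> (\<exists>s\<in>split_closure v f. (\<Sum>j\<in>UNIV. s $ j) \<le> r)" for f r
  proof
    assume "\<exists>s\<in>split_closure v f. (\<Sum>j\<in>UNIV. s $ j) \<le> r"
    then obtain s where s: "s \<in> split_closure v f" "(\<Sum>j\<in>UNIV. s $ j) \<le> r" by blast
    have "s $ i \<le> (\<Sum>j\<in>UNIV. s $ j)" for i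
      using s(1) by (intro member_le_sum) (auto simp: cut_closure_def)
    then have "s $ i \<le> r" for i using s(2) order_trans by blast
    then have "s \<in> cbox 0 (\<chi> j. r)"
      using s(1) by (auto simp: mem_box_cart cut_closure_def)
    then show "f \<in> E r" using s memW by (auto simp: E_def)
  qed (auto simp: E_def memW)
  have "{f \<in> interior (tri v). \<forall>s\<in>split_closure v f. 1 \<le> z * (\<Sum>j\<in>UNIV. s $ j)}
     = interior (tri v) - (\<Union>n. E (1/z - 1 / real (Suc n)))"
  proof -
    \<comment> \<open>A sum strictly below \<open>1 / z\<close> is at most
      \<open>1 / z - 1 / real (Suc n)\<close> for some \<open>n\<close>; this turns failure of the
      bound into a countable union of closed sets.\<close>
    have "(\<exists>n. \<sigma> \<le> 1/z - 1 / real (Suc n)) \<longleftrightarrow> \<not> 1 \<le> z * \<sigma>" for \<sigma>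
    proof
      assume "\<exists>n. \<sigma> \<le> 1/z - 1 / real (Suc n)"
      then obtain n where "\<sigma> \<le> 1/z - 1 / real (Suc n)" ..
      moreover have "1 / real (Suc n) > 0" by simp
      ultimately have "\<sigma> < 1/z" by linarith
      then show "\<not> 1 \<le> z * \<sigma>" using z by (simp add: field_simps)
    next
      assume "\<not> 1 \<le> z * \<sigma>"
      then have "0 < 1/z - \<sigma>" using z by (simp add: field_simps)
      then obtain n where "1 / real (Suc n) < 1/z - \<sigma>"
        using reals_Archimedean[of "1/z - \<sigma>"] unfolding inverse_eq_divide by blast
      then show "\<exists>n. \<sigma> \<le> 1/z - 1 / real (Suc n)" by (intro exI[of _ n]) linarith
    qed
    then show ?thesis using memE by blast
  qed
  also have "\<dots> \<in> sets borel"
    using E by (intro sets.Diff sets.countable_UN) (auto intro: borel_closed)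
  finally show ?thesis by (rule borel_imp_lebesgue)
qed

section \<open>Areas of corner triangles and of the whole triangle\<close>

lemma sub_triangle_area:
  fixes A B C :: "real^2"
  shows "measure lebesgue (convex hull {A, A + s *\<^sub>R (B - A), A + t *\<^sub>R (C - A)})
       = \<bar>s * t\<bar> * measure lebesgue (convex hull {A, B, C})"
proof -
  have *: "measure lebesgue (convex hull {A, B, C}) = \<bar>cross (B - A) (C - A)\<bar> / 2" for A B C :: "real^2"
  proof -
    have "compact (convex hull {A, B, C})" by (intro finite_imp_compact_convex_hull) auto
    then have "measure lebesgue (convex hull {A, B, C}) = measure lborel (convex hull {A, B, C})"
      by (intro measure_completion) (simp add: borel_compact)
    then show ?thesis by (simp add: content_triangle cross_def algebra_simps abs_minus_commute)
  qed
  have "cross (s *\<^sub>R (B - A)) (t *\<^sub>R (C - A)) = (s * t) * cross (B - A) (C - A)"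
    by (simp add: cross_def algebra_simps)
  then show ?thesis by (simp add: * abs_mult)
qed

lemma sub_triangle_mem:
  assumes "f = A + \<mu> *\<^sub>R (B - A) + \<nu> *\<^sub>R (C - A)" "\<mu> = \<alpha> * s" "\<nu> = \<beta> * t"
    "0 \<le> \<alpha>" "0 \<le> \<beta>" "\<alpha> + \<beta> \<le> 1"
  shows "f \<in> convex hull {A, A + s *\<^sub>R (B - A), A + t *\<^sub>R (C - A)}"
  unfolding convex_hull_3_alt using assms
  by (intro CollectI exI[of _ \<alpha>] exI[of _ \<beta>]) auto

lemma sub_triangle_memE:
  assumes "f \<in> convex hull {A, A + s *\<^sub>R (B - A), A + t *\<^sub>R (C - A)}"
  obtains \<alpha> \<beta> where "f = A + (\<alpha> * s) *\<^sub>R (B - A) + (\<beta> * t) *\<^sub>R (C - A)"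
    "0 \<le> \<alpha>" "0 \<le> \<beta>" "\<alpha> + \<beta> \<le> 1"
  using assms unfolding convex_hull_3_alt by auto

lemma convex_hull_3_lmeasurable: "convex hull {A, B, C :: real^2} \<in> lmeasurable"
  by (intro lmeasurable_compact finite_imp_compact_convex_hull) auto

lemma tri_perm:
  assumes "distinct [i, j, k :: 3]"
  shows "range v = {v i, v j, v k}"
proof -
  have "UNIV = {i, j, k}"
    using assms by (intro card_subset_eq[symmetric]) auto
  then show ?thesis by (metis image_insert image_empty)
qed

lemma measure_interior_tri: "measure lebesgue (interior (tri v)) = measure lebesgue (tri v)"
  by (intro measure_interior negligible_convex_frontier)
     (auto simp: range_3 finite_imp_bounded_convex_hull)

lemma tri_lmeasurable: "tri v \<in> lmeasurable"
  by (simp add: range_3 convex_hull_3_lmeasurable)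

lemma tri_measure_pos:
  assumes "is_triangle v"
  shows "measure lebesgue (tri v) > 0"
proof -
  define f where "f = (1/3) *\<^sub>R v 1 + (1/3) *\<^sub>R v 2 + (1/3) *\<^sub>R v 3"
  have "bary v i f = 1/3" for i
    using bary_unique[OF assms, of "\<lambda>_. 1/3" i] by (simp add: f_def sum_3)
  then have "0 < bary v i f" for i by (metis zero_less_divide_1_iff zero_less_numeral)
  then have "f \<in> interior (tri v)" by (simp add: interior_tri_eq[OF assms])
  then have "\<not> negligible (tri v)"
    using negligible_subset interior_subset open_not_negligible open_interior by blast
  then show ?thesis
    using tri_lmeasurable[of v] by (metis measure_nonneg negligible_iff_measure order_le_less)
qed

text \<open>Reducing the basis coefficients of an integer point modulo 1, and reflecting the parallelogram
  in its centre when needed, moves the point into the triangle with vertices \<open>0, u, g\<close>.\<close>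

lemma empty_triangle_dual_basis:
  assumes u: "u \<in> Zpts" and g: "g \<in> Zpts" and D: "cross u g \<noteq> 0"
    and empty: "\<And>\<alpha> \<beta>. \<lbrakk>0 \<le> \<alpha>; 0 \<le> \<beta>; \<alpha> + \<beta> \<le> 1; \<alpha> *\<^sub>R u + \<beta> *\<^sub>R g \<in> Zpts\<rbrakk>
       \<Longrightarrow> (\<alpha> = 0 \<or> \<alpha> = 1) \<and> (\<beta> = 0 \<or> \<beta> = 1)"
  obtains a b where "a \<in> Zpts" "b \<in> Zpts" "a \<bullet> u = 1" "a \<bullet> g = 0" "b \<bullet> u = 0" "b \<bullet> g = 1"
    "\<And>r. r = (a \<bullet> r) *\<^sub>R u + (b \<bullet> r) *\<^sub>R g"
proof -
  \<comment> \<open>The rows of the inverse of the matrix with columns \<open>u\<close> and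
    \<open>g\<close>.\<close>
  define a :: "real^2" where "a = (1 / cross u g) *\<^sub>R vector [g $ 2, - g $ 1]"
  define b :: "real^2" where "b = (1 / cross u g) *\<^sub>R vector [- u $ 2, u $ 1]"
  have a: "a \<bullet> r = cross r g / cross u g" and b: "b \<bullet> r = cross u r / cross u g" for r
    by (simp_all add: a_def b_def inner_real2 cross_def divide_inverse algebra_simps)
  have dual: "a \<bullet> u = 1" "a \<bullet> g = 0" "b \<bullet> u = 0" "b \<bullet> g = 1"
    using D by (simp_all add: a b) (simp_all add: cross_def)
  have rep: "r = (a \<bullet> r) *\<^sub>R u + (b \<bullet> r) *\<^sub>R g" for r
  proof -
    have "cross u g * r $ k = cross u g * ((a \<bullet> r) *\<^sub>R u + (b \<bullet> r) *\<^sub>R g) $ k" for k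
      using D exhaust_2[of k] by (auto simp: a b distrib_left) (auto simp: cross_def algebra_simps)
    then show ?thesis using D by (simp add: vec_eq_iff)
  qed
  have int: "a \<bullet> r \<in> \<int> \<and> b \<bullet> r \<in> \<int>" if r: "r \<in> Zpts" for r
  proof -
    let ?\<alpha> = "frac (a \<bullet> r)" and ?\<beta> = "frac (b \<bullet> r)"
    have eq: "?\<alpha> *\<^sub>R u + ?\<beta> *\<^sub>R g = r - (of_int \<lfloor>a \<bullet> r\<rfloor> *\<^sub>R u + of_int \<lfloor>b \<bullet> r\<rfloor> *\<^sub>R g)"
      using rep[of r] by (simp add: frac_def scaleR_diff_left add_diff_add)
    have Z: "?\<alpha> *\<^sub>R u + ?\<beta> *\<^sub>R g \<in> Zpts"
      unfolding eq using r u g by (intro Zpts_diff Zpts_add Zpts_scale) auto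
    have "(1 - ?\<alpha>) *\<^sub>R u + (1 - ?\<beta>) *\<^sub>R g = u + g - (?\<alpha> *\<^sub>R u + ?\<beta> *\<^sub>R g)"
      by (simp add: algebra_simps)
    then have Z': "(1 - ?\<alpha>) *\<^sub>R u + (1 - ?\<beta>) *\<^sub>R g \<in> Zpts"
      using Z u g by (simp add: Zpts_diff Zpts_add)
    have lt: "0 \<le> ?\<alpha>" "?\<alpha> < 1" "0 \<le> ?\<beta>" "?\<beta> < 1" by (auto simp: frac_lt_1)
    have "?\<alpha> = 0 \<and> ?\<beta> = 0"
    proof (cases "?\<alpha> + ?\<beta> \<le> 1")
      case True
      then show ?thesis using empty[OF lt(1,3) True Z] lt by auto
    next
      case False
      then have "(1 - ?\<alpha> = 0 \<or> 1 - ?\<alpha> = 1) \<and> (1 - ?\<beta> = 0 \<or> 1 - ?\<beta> = 1)"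
        using lt by (intro empty Z') auto
      then show ?thesis using lt by auto
    qed
    then show ?thesis by (simp add: frac_eq_0_iff)
  qed
  \<comment> \<open>Integral values on the standard basis vectors make the forms themselves
    integral.\<close>
  have "axis k (1::real) \<in> Zpts" for k by (auto simp: Zpts_def axis_def)
  then have "a \<in> Zpts" "b \<in> Zpts"
    using int[of "axis _ 1"] by (auto simp: Zpts_def inner_axis)
  then show ?thesis using that dual rep by blast
qed

section \<open>Split cuts on type 1 triangles\<close>

text \<open>The gauge of a split in the direction of a point depends only on the values of its linear form
  at \<open>f\<close> and at this point, here \<open>u\<close> and \<open>A\<close>.\<close>

definition line_gauge :: "int \<Rightarrow> real \<Rightarrow> real \<Rightarrow> real" where
  "line_gauge b u A = max ((A - u) / (of_int b + 1 - u)) (- (A - u) / (u - of_int b))"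

lemma split_gauge_eq: "split_gauge a b f (p - f) = line_gauge b (a \<bullet> f) (a \<bullet> p)"
  by (simp add: split_gauge_def line_gauge_def inner_diff_right)

text \<open>For a point beyond a side of the strip, gauge minus 1 is the excess of the form over
  that side divided by the gap between \<open>f\<close> and that side. Subtracting 1 absorbs the
  coordinate sum of a witness into the left-hand side of its cut.\<close>

lemma line_gauge_ge:
  assumes "of_int b < u" "u < of_int b + 1"
  shows "(A - of_int b - 1) / (of_int b + 1 - u) \<le> line_gauge b u A - 1"
    "(of_int b - A) / (u - of_int b) \<le> line_gauge b u A - 1"
proof -
  have "(A - of_int b - 1) / (of_int b + 1 - u) = (A - u) / (of_int b + 1 - u) - 1"
    "(of_int b - A) / (u - of_int b) = - (A - u) / (u - of_int b) - 1"
    using assms by (simp_all add: field_simps)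
  then show "(A - of_int b - 1) / (of_int b + 1 - u) \<le> line_gauge b u A - 1"
    "(of_int b - A) / (u - of_int b) \<le> line_gauge b u A - 1"
    by (simp_all add: line_gauge_def)
qed

text \<open>Reversing the form turns the strip starting at \<open>b\<close> into the one starting at
  \<open>- b - 1\<close>; this symmetry halves the sign cases below.\<close>

lemma line_gauge_uminus: "line_gauge (- b - 1) (- u) (- A) = line_gauge b u A"
  by (simp add: line_gauge_def max.commute algebra_simps minus_divide_left)

text \<open>For the linear form with values \<open>0, 2 * p, 2 * q\<close> at the vertices, and \<open>f\<close> near the first one,
  the following two lemmas distinguish on which sides of the split the other two vertices lie.\<close>

lemma corner_opposite_sides:
  fixes x y p q b :: real
  assumes x: "0 < x" and y: "0 < y" and xy: "x + y < 1" and b: "0 \<le> b"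
    and u: "b < p * x + q * y" "p * x + q * y < b + 1"
    and p: "b + 1 \<le> p" and q: "2 * q \<le> b"
  shows "1 \<le> (2 * p - b - 1) / (b + 1 - (p * x + q * y)) * (1 - x) + (b - 2 * q) / (p * x + q * y - b) * (1 - y)"
proof -
  define h where "h = b + 1 - (p * x + q * y)"
  \<comment> \<open>The surplus of the first numerator over \<open>h\<close>. Multiplying the goal
    by \<open>h * (1 - h)\<close> leaves the inequality in \<open>N\<close> proved below.\<close>
  define N where "N = (p - b - 1) * (2 - x) + q * y"
  have h: "0 < h" "h < 1" using u by (auto simp: h_def)
  have N: "(2 * p - b - 1) * (1 - x) = h + N" by (simp add: h_def N_def algebra_simps)
  have "0 \<le> N * (1 - h) + (b - 2 * q) * (1 - y) * h"
  proof (cases "N \<ge> 0")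
    case True
    then show ?thesis using h q x y xy by (intro add_nonneg_nonneg mult_nonneg_nonneg) auto
  next
    case False
    \<comment> \<open>Here the first term falls short. Then \<open>q\<close> is negative, which
      forces \<open>1 - x \<le> h\<close> and makes the second term large enough to
      compensate.\<close>
    have Nq: "q * y \<le> N" using p x xy y by (auto simp: N_def)
    then have "q * y < 0" using False by linarith
    then have q0: "q < 0" using y by (simp add: mult_less_0_iff)
    have "(2 - x) * h = (2 - x) * (b + 1) * (1 - x) - 2 * q * y * (1 - x) - x * N"
      by (simp add: h_def N_def algebra_simps)
    moreover have "0 \<le> - q * (y * (1 - x))"
      using q0 x y xy by (intro mult_nonneg_nonneg) auto
    moreover have "x * N \<le> 0" using x False by (simp add: mult_le_0_iff)
    ultimately have "(2 - x) * ((b + 1) * (1 - x)) \<le> (2 - x) * h" by (simp add: algebra_simps)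
    then have "(b + 1) * (1 - x) \<le> h" using x y xy by (subst (asm) mult_le_cancel_left_pos) auto
    moreover have "0 \<le> b * (1 - x)" using b x y xy by auto
    ultimately have hX: "1 - x \<le> h" by (simp add: algebra_simps)
    have "q * y * x \<le> q * y * (1 - h)"
      using hX \<open>q * y < 0\<close> by (intro mult_left_mono_neg) auto
    also have "\<dots> \<le> N * (1 - h)" using Nq h by (intro mult_right_mono) auto
    finally have 1: "q * y * x \<le> N * (1 - h)" .
    have "- q * (y * x) \<le> - q * ((1 - x) * (1 - y))"
      using q0 x y xy by (intro mult_left_mono mult_mono) auto
    also have "\<dots> = (- q * (1 - y)) * (1 - x)" by simp
    also have "\<dots> \<le> (b - 2 * q) * (1 - y) * h"
      using q0 b hX x y xy h by (intro mult_mono mult_nonneg_nonneg) auto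
    finally show ?thesis using 1 by (simp add: mult.assoc)
  qed
  then have "h * (1 - h) \<le> ((2 * p - b - 1) * (1 - x)) * (1 - h) + ((b - 2 * q) * (1 - y)) * h"
    unfolding N by (simp add: algebra_simps)
  then have "1 \<le> ((2 * p - b - 1) * (1 - x)) / h + ((b - 2 * q) * (1 - y)) / (1 - h)"
    using h by (simp add: field_simps)
  then show ?thesis by (simp add: h_def algebra_simps)
qed

lemma corner_same_side:
  fixes x y p q b :: real
  assumes x: "0 < x" and y: "0 < y" and xy: "x + y < 1" and b: "0 \<le> b"
    and u: "p * x + q * y < b + 1"
    and p: "b + 1 \<le> p" and q: "b + 1 \<le> 2 * q"
  shows "1 \<le> (2 * p - b - 1) / (b + 1 - (p * x + q * y)) * (1 - x) + (2 * q - b - 1) / (b + 1 - (p * x + q * y)) * (1 - y)"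
proof -
  define h where "h = b + 1 - (p * x + q * y)"
  have h: "0 < h" using u by (auto simp: h_def)
  have "(b + 1) * (2 - x) \<le> p * (2 - x)" using p x y xy by (intro mult_right_mono) auto
  moreover have "(b + 1) * (2 - y) \<le> 2 * q * (2 - y)" using q x y xy by (intro mult_right_mono) auto
  moreover have "0 \<le> b * y" using b y by simp
  ultimately have "h \<le> (2 * p - b - 1) * (1 - x) + (2 * q - b - 1) * (1 - y)"
    using y by (simp add: h_def algebra_simps)
  then have "1 \<le> ((2 * p - b - 1) * (1 - x) + (2 * q - b - 1) * (1 - y)) / h" using h by simp
  then show ?thesis by (simp add: h_def add_divide_distrib)
qed

text \<open>The form is 0 at the corner and \<open>p\<close>, \<open>q\<close> at the midpoints of
  its two edges, and \<open>f\<close> lies in the small triangle spanned by these three points. For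
  its value there to exceed \<open>b \<ge> 0\<close>, one midpoint value must exceed
  \<open>b\<close>, hence reach \<open>b + 1\<close> by integrality. By symmetry it is
  \<open>p\<close>; the other vertex is then on either side of the strip.\<close>

lemma corner_split_nonneg:
  fixes x y :: real and p q b :: int
  assumes x: "0 < x" and y: "0 < y" and xy: "x + y < 1" and b: "0 \<le> b"
    and u: "of_int b < of_int p * x + of_int q * y" "of_int p * x + of_int q * y < of_int b + 1"
  shows "1 \<le> (line_gauge b (of_int p * x + of_int q * y) (2 * of_int p) - 1) * (1 - x)
           + (line_gauge b (of_int p * x + of_int q * y) (2 * of_int q) - 1) * (1 - y)"
proof -
  have *: "1 \<le> (line_gauge b (of_int p * x + of_int q * y) (2 * of_int p) - 1) * (1 - x)
           + (line_gauge b (of_int p * x + of_int q * y) (2 * of_int q) - 1) * (1 - y)"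
    if x: "0 < x" and y: "0 < y" and xy: "x + y < 1"
      and u: "of_int b < of_int p * x + of_int q * y" "of_int p * x + of_int q * y < of_int b + 1"
      and p: "b + 1 \<le> p" for x y p q
  proof -
    let ?u = "of_int p * x + of_int q * y"
    have p': "real_of_int b + 1 \<le> of_int p" using p by linarith
    have b': "0 \<le> real_of_int b" using b by simp
    note ge = line_gauge_ge[OF u]
    show ?thesis
    proof (cases "2 * q \<le> b")
      case True
      then have q': "2 * real_of_int q \<le> of_int b" by linarith
      show ?thesis
        by (rule order_trans[OF corner_opposite_sides[OF x y xy b' u p' q']])
           (use ge[of "2 * of_int p"] ge[of "2 * of_int q"] x y xy in \<open>intro add_mono mult_right_mono; simp\<close>)
    next
      case False
      then have q': "real_of_int b + 1 \<le> 2 * of_int q" by linarith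
      show ?thesis
        by (rule order_trans[OF corner_same_side[OF x y xy b' u(2) p' q']])
           (use ge[of "2 * of_int p"] ge[of "2 * of_int q"] x y xy in \<open>intro add_mono mult_right_mono; simp\<close>)
    qed
  qed
  have "b + 1 \<le> p \<or> b + 1 \<le> q"
  proof (rule ccontr)
    assume "\<not> ?thesis"
    then have "real_of_int p \<le> of_int b" "real_of_int q \<le> of_int b" by auto
    then have "of_int p * x + of_int q * y \<le> of_int b * x + of_int b * y"
      using x y by (intro add_mono mult_right_mono) auto
    also have "\<dots> = of_int b * (x + y)" by (simp add: algebra_simps)
    also have "\<dots> \<le> of_int b * 1" using b xy by (intro mult_left_mono) auto
    finally show False using u by simp
  qed
  then show ?thesis
  proof
    assume "b + 1 \<le> p" then show ?thesis using *[OF x y xy u] by simp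
  next
    assume "b + 1 \<le> q" then show ?thesis using *[of y x q p] x y xy u by (simp add: add.commute)
  qed
qed

text \<open>Translation removes the value \<open>m\<close> at the corner; if the strip then lies on
  the negative side, reversing the form brings it to the nonnegative one.\<close>

lemma corner_split:
  fixes x y :: real and m p q b :: int
  assumes xy: "0 < x" "0 < y" "x + y < 1"
    and u: "u = of_int m + of_int p * x + of_int q * y" "of_int b < u" "u < of_int b + 1"
  shows "1 \<le> (line_gauge b u (of_int m + 2 * of_int p) - 1) * (1 - x)
           + (line_gauge b u (of_int m + 2 * of_int q) - 1) * (1 - y)"
proof -
  have shift: "line_gauge b u (of_int m + A) = line_gauge (b - m) (u - of_int m) A" for A
    by (simp add: line_gauge_def algebra_simps)
  have u': "u - of_int m = of_int p * x + of_int q * y" using u by simp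
  show ?thesis
  proof (cases "0 \<le> b - m")
    case True
    then show ?thesis
      using corner_split_nonneg[OF xy True, of p q] u unfolding shift u' by simp
  next
    case False
    have neg: "line_gauge b u (of_int m + 2 * of_int r)
      = line_gauge (- (b - m) - 1) (of_int (- p) * x + of_int (- q) * y) (2 * of_int (- r))" for r
      using line_gauge_uminus[of "b - m" "u - of_int m" "2 * of_int r"] unfolding shift u' by simp
    show ?thesis
      using corner_split_nonneg[OF xy, of "- (b - m) - 1" "- p" "- q"] False u unfolding neg by simp
  qed
qed

text \<open>The mixed case of \<open>center_one_high\<close> with denominators cleared: of the two
  midpoints next to the high vertex one is \<open>m \<ge> 0\<close> above the upper side of the
  strip, the other \<open>n\<close> below it. If the left bracket \<open>D\<close> is positive, then
  \<open>D \<le> h\<close> and \<open>1 - h\<close> is at most the right bracket, so the products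
  compare factor by factor.\<close>

lemma center_core:
  fixes w1 w2 w3 m n K h :: real
  assumes w: "0 < w1" "0 < w2" "0 < w3" "w1 + w2 + w3 = 1"
    and m: "0 \<le> m" and n: "1 \<le> n" and K: "m + n \<le> K"
    and h: "h = w2 * (1 + K) - w1 * m + w3 * n" "0 < h" "h < 1"
  shows "((w2 + w3) * n - (w1 + w2) * m) * (1 - h) \<le> (w1 * (K + m + n) + w3 * (K - m - n)) * h"
proof -
  define D where "D = (w2 + w3) * n - (w1 + w2) * m"
  have "w1 * (m + n) \<le> w1 * K" using w K by (intro mult_left_mono) auto
  moreover have "0 \<le> w3 * (K - m - n)" using w K by auto
  ultimately have B: "2 * (w1 * (m + n)) \<le> w1 * (K + m + n) + w3 * (K - m - n)"
    by (simp add: algebra_simps)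
  have B0: "0 \<le> 2 * (w1 * (m + n))" using w m n by auto
  show ?thesis
  proof (cases "D \<le> 0")
    case True
    then have "D * (1 - h) \<le> 0" using h by (simp add: mult_le_0_iff)
    moreover have "0 \<le> (w1 * (K + m + n) + w3 * (K - m - n)) * h"
      using B B0 h by (intro mult_nonneg_nonneg) auto
    ultimately show ?thesis unfolding D_def by linarith
  next
    case False
    have "w2 * (1 + (m + n)) \<le> w2 * (1 + K)" using w K by (intro mult_left_mono) auto
    then have hD: "D + w2 + 2 * (w2 * m) \<le> h" by (simp add: h D_def algebra_simps)
    have pos: "0 \<le> w2 * m" "0 \<le> w1 * m" "0 \<le> w1 * n" using w m n by auto
    have "n = w1 * n + w2 * n + w3 * n" using w(4) by (metis distrib_right mult_1)
    \<comment> \<open>This is where \<open>1 \<le> n\<close> enters, that is, integrality: a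
      midpoint not reaching the upper side is at least one unit below it.\<close>
    then have "1 - h \<le> 2 * (w1 * (m + n))"
      using hD n pos w unfolding D_def distrib_left distrib_right by linarith
    then have 1: "1 - h \<le> w1 * (K + m + n) + w3 * (K - m - n)" using B by simp
    have "D * (1 - h) \<le> h * (1 - h)" using hD w pos h by (intro mult_right_mono) auto
    also have "\<dots> \<le> (w1 * (K + m + n) + w3 * (K - m - n)) * h"
      using 1 h by (subst mult.commute) (intro mult_right_mono, auto)
    finally show ?thesis unfolding D_def .
  qed
qed

text \<open>Here \<open>M1, M2, M3\<close> are the values of the linear form of the split at the midpoints of the edges,
  so that its values at the vertices are \<open>M2 + M3 - M1\<close> etc.; \<open>w1, w2, w3\<close> are the barycentric
  coordinates of \<open>f\<close> in the triangle of midpoints.\<close>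

lemma center_one_high:
  fixes w1 w2 w3 :: real and M1 M2 M3 b :: int
  assumes w: "0 < w1" "0 < w2" "0 < w3" "w1 + w2 + w3 = 1"
    and u: "u = w1 * of_int M1 + w2 * of_int M2 + w3 * of_int M3" "of_int b < u" "u < of_int b + 1"
    and A: "M2 + M3 - M1 \<le> b" "M1 + M2 - M3 \<le> b"
  shows "1 \<le> w1 * (line_gauge b u (of_int (M2 + M3 - M1)) - 1)
           + w2 * (line_gauge b u (of_int (M1 + M3 - M2)) - 1)
           + w3 * (line_gauge b u (of_int (M1 + M2 - M3)) - 1)"
proof -
  define h where "h = of_int b + 1 - u"
  define m1 m3 K where "m1 = real_of_int (M1 - b - 1)" and "m3 = real_of_int (M3 - b - 1)"
    and "K = real_of_int (b - M2)"
  note mk = m1_def m3_def K_def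
  have h: "0 < h" "h < 1" using u by (auto simp: h_def)
  have wb: "w1 * of_int b + w2 * of_int b + w3 * of_int b = of_int b"
    using w(4) by (metis distrib_right mult_1)
  have h_eq: "h = w2 * (1 + K) - w1 * m1 - w3 * m3"
    using wb w(4) by (simp add: h_def u mk algebra_simps)
  have K: "m1 - m3 \<le> K" "m3 - m1 \<le> K"
    using A by (simp_all add: mk algebra_simps)
  \<comment> \<open>Otherwise all three midpoints are on or below the lower side, the one between
    the two low vertices being there anyway, and so is \<open>f\<close>.\<close>
  have "0 \<le> m1 \<or> 0 \<le> m3"
  proof (rule ccontr)
    assume "\<not> ?thesis"
    then have M: "M1 \<le> b" "M3 \<le> b" "M2 \<le> b" using A by (auto simp: mk)
    have "u \<le> w1 * of_int b + w2 * of_int b + w3 * of_int b"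
      unfolding u using w M by (intro add_mono mult_left_mono) auto
    then show False using wb u by linarith
  qed
  moreover have "m1 \<le> -1" if "m1 < 0" using that by (simp add: mk)
  moreover have "m3 \<le> -1" if "m3 < 0" using that by (simp add: mk)
  moreover have core: "0 \<le> ((w1 + w2) * m1 + (w2 + w3) * m3) * (1 - h) + (w1 * (K + m1 - m3) + w3 * (K - m1 + m3)) * h"
    if m: "0 \<le> m1 \<and> 0 \<le> m3"
  proof -
    have "0 \<le> w1 * (K + m1 - m3)" "0 \<le> w3 * (K - m1 + m3)"
      by (rule mult_nonneg_nonneg; use w K in linarith)+
    then show ?thesis using m w h by simp
  qed
  moreover have "0 \<le> ((w1 + w2) * m1 + (w2 + w3) * m3) * (1 - h) + (w1 * (K + m1 - m3) + w3 * (K - m1 + m3)) * h"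
    if "0 \<le> m1" "m3 \<le> -1"
  proof -
    have "((w2 + w3) * (- m3) - (w1 + w2) * m1) * (1 - h) \<le> (w1 * (K + m1 + - m3) + w3 * (K - m1 - - m3)) * h"
      using that K h by (intro center_core[OF w]) (auto simp: h_eq)
    then show ?thesis by (simp add: algebra_simps)
  qed
  moreover have "0 \<le> ((w1 + w2) * m1 + (w2 + w3) * m3) * (1 - h) + (w1 * (K + m1 - m3) + w3 * (K - m1 + m3)) * h"
    if "0 \<le> m3" "m1 \<le> -1"
  proof -
    have "((w2 + w1) * (- m1) - (w3 + w2) * m3) * (1 - h) \<le> (w3 * (K + m3 + - m1) + w1 * (K - m3 - - m1)) * h"
      using that K h w by (intro center_core) (auto simp: h_eq)
    then show ?thesis by (simp add: algebra_simps)
  qed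
  ultimately have "0 \<le> ((w1 + w2) * m1 + (w2 + w3) * m3) * (1 - h) + (w1 * (K + m1 - m3) + w3 * (K - m1 + m3)) * h"
    by (meson not_le)
  \<comment> \<open>By this identity, the inequality just obtained is what remains of the cut after
    multiplication by \<open>h * (1 - h)\<close>.\<close>
  moreover have "w2 * (m1 + m3 + K + 1) = h + ((w1 + w2) * m1 + (w2 + w3) * m3)"
    by (simp add: h_eq algebra_simps)
  ultimately have "h * (1 - h) \<le> w2 * (m1 + m3 + K + 1) * (1 - h) + (w1 * (K + m1 - m3) + w3 * (K - m1 + m3)) * h"
    by (simp only: distrib_right[of h])
  then have "1 \<le> w2 * (m1 + m3 + K + 1) / h + (w1 * (K + m1 - m3) + w3 * (K - m1 + m3)) / (1 - h)"
    using h by (simp add: field_simps)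
  also have "\<dots> = w1 * ((of_int b - of_int (M2 + M3 - M1)) / (u - of_int b))
     + w2 * ((of_int (M1 + M3 - M2) - of_int b - 1) / (of_int b + 1 - u))
     + w3 * ((of_int b - of_int (M1 + M2 - M3)) / (u - of_int b))"
    by (simp add: h_def mk divide_inverse algebra_simps)
  also have "\<dots> \<le> w1 * (line_gauge b u (of_int (M2 + M3 - M1)) - 1)
           + w2 * (line_gauge b u (of_int (M1 + M3 - M2)) - 1)
           + w3 * (line_gauge b u (of_int (M1 + M2 - M3)) - 1)"
    using w by (intro add_mono mult_left_mono line_gauge_ge u) auto
  finally show ?thesis .
qed

text \<open>Vertex values are integers and so avoid the open strip; hence two of the three vertices
  are on the same side. Permuting the vertices covers two low ones, reversing the form two high
  ones.\<close>

lemma center_split: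
  fixes w1 w2 w3 :: real and M1 M2 M3 b :: int
  assumes w: "0 < w1" "0 < w2" "0 < w3" "w1 + w2 + w3 = 1"
    and u: "u = w1 * of_int M1 + w2 * of_int M2 + w3 * of_int M3" "of_int b < u" "u < of_int b + 1"
  shows "1 \<le> w1 * (line_gauge b u (of_int (M2 + M3 - M1)) - 1)
           + w2 * (line_gauge b u (of_int (M1 + M3 - M2)) - 1)
           + w3 * (line_gauge b u (of_int (M1 + M2 - M3)) - 1)"
proof -
  have two_low: "1 \<le> w1 * (line_gauge b u (of_int (M2 + M3 - M1)) - 1)
           + w2 * (line_gauge b u (of_int (M1 + M3 - M2)) - 1)
           + w3 * (line_gauge b u (of_int (M1 + M2 - M3)) - 1)"
    if u: "u = w1 * of_int M1 + w2 * of_int M2 + w3 * of_int M3" "of_int b < u" "u < of_int b + 1"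
      and low: "(M2 + M3 - M1 \<le> b \<and> M1 + M2 - M3 \<le> b) \<or> (M2 + M3 - M1 \<le> b \<and> M1 + M3 - M2 \<le> b)
        \<or> (M1 + M3 - M2 \<le> b \<and> M1 + M2 - M3 \<le> b)" for M1 M2 M3 b :: int and u
    using low
  proof (elim disjE conjE)
    assume "M2 + M3 - M1 \<le> b" "M1 + M2 - M3 \<le> b"
    then show ?thesis using center_one_high[OF w u] by simp
  next
    assume "M2 + M3 - M1 \<le> b" "M1 + M3 - M2 \<le> b"
    then show ?thesis using center_one_high[of w1 w3 w2 u M1 M3 M2 b] w u by (simp add: algebra_simps)
  next
    assume "M1 + M3 - M2 \<le> b" "M1 + M2 - M3 \<le> b"
    then show ?thesis using center_one_high[of w2 w1 w3 u M2 M1 M3 b] w u by (simp add: algebra_simps)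
  qed
  show ?thesis
  proof (cases "(M2 + M3 - M1 \<le> b \<and> M1 + M2 - M3 \<le> b) \<or> (M2 + M3 - M1 \<le> b \<and> M1 + M3 - M2 \<le> b)
        \<or> (M1 + M3 - M2 \<le> b \<and> M1 + M2 - M3 \<le> b)")
    case True
    then show ?thesis by (rule two_low[OF u])
  next
    case False
    have neg: "line_gauge b u (of_int r) = line_gauge (- b - 1) (- u) (of_int (- r))" for r
      using line_gauge_uminus[of b u "of_int r"] by simp
    have "1 \<le> w1 * (line_gauge (- b - 1) (- u) (of_int (- M2 + - M3 - - M1)) - 1)
           + w2 * (line_gauge (- b - 1) (- u) (of_int (- M1 + - M3 - - M2)) - 1)
           + w3 * (line_gauge (- b - 1) (- u) (of_int (- M1 + - M2 - - M3)) - 1)"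
      using False u by (intro two_low) (auto simp: algebra_simps)
    then show ?thesis unfolding neg by (simp add: algebra_simps)
  qed
qed

section \<open>The strength on type 1 triangles\<close>

text \<open>The reflection of the edge in its midpoint preserves integer points, so a unique one
  must be fixed.\<close>

lemma type1_midpoint:
  assumes "v i \<in> Zpts" "v j \<in> Zpts" "card (open_segment (v i) (v j) \<inter> Zpts) = 1"
  shows "open_segment (v i) (v j) \<inter> Zpts = {(1/2) *\<^sub>R (v i + v j)}"
proof -
  obtain m where m: "open_segment (v i) (v j) \<inter> Zpts = {m}"
    using assms(3) by (rule card_1_singletonE)
  then have "m \<in> open_segment (v i) (v j)" "m \<in> Zpts" by blast+
  then obtain u where ne: "v i \<noteq> v j" and u: "0 < u" "u < 1" "m = (1 - u) *\<^sub>R v i + u *\<^sub>R v j"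
    by (auto simp: in_segment)
  have "v i + v j - m = (1 - (1 - u)) *\<^sub>R v i + (1 - u) *\<^sub>R v j"
    by (simp add: u algebra_simps)
  then have "v i + v j - m \<in> open_segment (v i) (v j)"
    unfolding in_segment using u ne by (intro conjI exI[of _ "1 - u"]) auto
  moreover have "v i + v j - m \<in> Zpts"
    using assms \<open>m \<in> Zpts\<close> by (intro Zpts_diff Zpts_add)
  ultimately have "v i + v j - m = m" using m by blast
  then have "v i + v j = 2 *\<^sub>R m" by (metis diff_add_cancel scaleR_2)
  then have "m = (1/2) *\<^sub>R (v i + v j)" by simp
  then show ?thesis using m by simp
qed

lemma ex_distinct3: "\<exists>j k. distinct [i, j, k :: 3]"
proof -
  have "i = 1 \<or> i = 2 \<or> i = 3" using exhaust_3[of i] by blast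
  then show ?thesis
    by (elim disjE) (rule exI[of _ 2], rule exI[of _ 3], simp, rule exI[of _ 1], rule exI[of _ 3], simp,
        rule exI[of _ 1], rule exI[of _ 2], simp)
qed

text \<open>The half-edges at a corner span an empty lattice triangle: any further integer point in
  it would be interior to the big triangle or a second one on an edge. The form \<open>a\<close> is
  constant along the edge from \<open>v i\<close> to \<open>v k\<close>, and \<open>e\<close>
  certifies that it defines a split.\<close>

lemma type1_basis:
  assumes t1: "type1_triangle v" and free: "interior (tri v) \<inter> Zpts = {}" and d: "distinct [i, j, k]"
  obtains a e g where "a \<in> Zpts" "e \<in> Zpts" "g \<in> Zpts" "v j = v i + 2 *\<^sub>R e" "v k = v i + 2 *\<^sub>R g"
    "a \<bullet> e = 1" "a \<bullet> g = 0"
proof -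
  have tri: "is_triangle v" and Z: "\<And>i. v i \<in> Zpts"
    and c: "\<And>i j. i \<noteq> j \<Longrightarrow> card (open_segment (v i) (v j) \<inter> Zpts) = 1"
    using t1 by (auto simp: type1_triangle_def)
  define e g where "e = (1/2) *\<^sub>R (v j - v i)" and "g = (1/2) *\<^sub>R (v k - v i)"
  have half: "(1/2) *\<^sub>R (v l - v i) \<in> Zpts" if "i \<noteq> l" for l
  proof -
    have "(1/2) *\<^sub>R (v i + v l) \<in> Zpts" using type1_midpoint[of v i l] Z c[OF that] by blast
    then have "(1/2) *\<^sub>R (v i + v l) - v i \<in> Zpts" using Z by (intro Zpts_diff)
    moreover have "(1/2) *\<^sub>R (v i + v l) - v i = (1/2) *\<^sub>R (v l - v i)"
      by (simp add: vec_eq_iff field_simps)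
    ultimately show ?thesis by simp
  qed
  have eg: "e \<in> Zpts" "g \<in> Zpts" using half d by (auto simp: e_def g_def)
  have vj: "v j = v i + 2 *\<^sub>R e" and vk: "v k = v i + 2 *\<^sub>R g" by (auto simp: e_def g_def)
  have "cross e g \<noteq> 0"
  proof
    assume "cross e g = 0"
    then have "cross (v j - v i) (v k - v i) = 0" by (simp add: cross_def e_def g_def)
    then show False using tri tri_perm[OF d, of v] by (simp add: is_triangle_def collinear_iff_cross)
  qed
  moreover have "(\<alpha> = 0 \<or> \<alpha> = 1) \<and> (\<beta> = 0 \<or> \<beta> = 1)"
    if ab: "0 \<le> \<alpha>" "0 \<le> \<beta>" "\<alpha> + \<beta> \<le> 1" and Zx: "\<alpha> *\<^sub>R e + \<beta> *\<^sub>R g \<in> Zpts" for \<alpha> \<beta>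
  proof -
    define x where "x = v i + (\<alpha>/2) *\<^sub>R (v j - v i) + (\<beta>/2) *\<^sub>R (v k - v i)"
    have "x = v i + (\<alpha> *\<^sub>R e + \<beta> *\<^sub>R g)" by (simp add: x_def e_def g_def)
    then have xZ: "x \<in> Zpts" using Zpts_add[OF Z[of i] Zx] by simp
    have bary: "bary v i x = 1 - \<alpha>/2 - \<beta>/2" "bary v j x = \<alpha>/2" "bary v k x = \<beta>/2"
      using d by (auto simp: x_def bary_add_diff bary_vertex[OF tri])
    have edge: "t = 1/2" if "v i + t *\<^sub>R (v l - v i) \<in> Zpts" "i \<noteq> l" "0 < t" "t < 1" for t l
    proof -
      have "v i \<noteq> v l" using bary_vertex[OF tri, of l i] bary_vertex[OF tri, of l l] that(2) by auto
      then have "v i + t *\<^sub>R (v l - v i) \<in> open_segment (v i) (v l)"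
        unfolding in_segment using that by (auto simp: algebra_simps)
      then have "v i + t *\<^sub>R (v l - v i) = (1/2) *\<^sub>R (v i + v l)"
        using type1_midpoint[of v i l] Z c[OF that(2)] that(1) by blast
      also have "(1/2) *\<^sub>R (v i + v l) = v i + (1/2) *\<^sub>R (v l - v i)"
        by (simp add: vec_eq_iff field_simps)
      finally have "bary v l (v i + t *\<^sub>R (v l - v i)) = bary v l (v i + (1/2) *\<^sub>R (v l - v i))"
        by (rule arg_cong)
      then show ?thesis using that(2) by (simp add: bary_add_diff1 bary_vertex[OF tri])
    qed
    have "\<not> (0 < \<alpha> \<and> 0 < \<beta>)"
    proof
      assume "0 < \<alpha> \<and> 0 < \<beta>"
      then have "\<forall>l. 0 < bary v l x" unfolding distinct3_all[OF d] using bary ab by auto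
      then show False using free xZ by (auto simp: interior_tri_eq[OF tri])
    qed
    then consider "\<alpha> = 0" "\<beta> = 0" | "\<alpha> = 0" "0 < \<beta>" | "\<beta> = 0" "0 < \<alpha>" using ab by linarith
    then show ?thesis
    proof cases
      case 2
      then have "\<beta>/2 = 1/2" using edge[of "\<beta>/2" k] xZ d ab by (simp add: x_def)
      then show ?thesis using 2 by simp
    next
      case 3
      then have "\<alpha>/2 = 1/2" using edge[of "\<alpha>/2" j] xZ d ab by (simp add: x_def)
      then show ?thesis using 3 by simp
    qed simp
  qed
  ultimately show ?thesis
    by (rule empty_triangle_dual_basis[OF eg]) (use that eg vj vk in blast)+
qed

text \<open>This is the cut of the strip between the edge opposite \<open>v j\<close> and the
  midline parallel to it. With \<open>x = 2 * bary v j f\<close> its gauge is 1 at both ends of that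
  edge and \<open>1 + 1 / (1 - x)\<close> at \<open>v j\<close>.\<close>

lemma type1_cut:
  assumes t1: "type1_triangle v" and free: "interior (tri v) \<inter> Zpts = {}"
    and f: "f \<in> interior (tri v)" and s: "s \<in> split_closure v f" and l: "bary v j f < 1/2"
  shows "(1 - 2 * bary v j f) * (1 - (\<Sum>l\<in>UNIV. s $ l)) \<le> s $ j"
proof -
  have tri: "is_triangle v" and Z: "\<And>i. v i \<in> Zpts" using t1 by (auto simp: type1_triangle_def)
  obtain i k where "distinct [j, i, k]" using ex_distinct3 by blast
  then have d: "distinct [i, j, k]" by auto
  obtain a e g where a: "a \<in> Zpts" "e \<in> Zpts" "v j = v i + 2 *\<^sub>R e" "v k = v i + 2 *\<^sub>R g"
    "a \<bullet> e = 1" "a \<bullet> g = 0"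
    using type1_basis[OF t1 free d] by metis
  obtain m where m: "a \<bullet> v i = of_int m" using Zpts_inner[OF a(1) Z[of i]] by (auto elim: Ints_cases)
  define x where "x = 2 * bary v j f"
  have av: "a \<bullet> v j = of_int m + 2" "a \<bullet> v k = of_int m" using a m by (simp_all add: inner_add_right)
  have "a \<bullet> f = (bary v i f + bary v j f + bary v k f) * of_int m + 2 * bary v j f"
    by (simp add: inner_combination[OF tri d, of a f] av m algebra_simps)
  then have af: "a \<bullet> f = of_int m + x" by (simp add: bary_eqD(1)[OF tri d] x_def)
  have x: "0 < x" "x < 1" using f l by (auto simp: x_def interior_tri_eq[OF tri])
  have "1 \<le> (\<Sum>l\<in>UNIV. split_gauge a m f (v l - f) * s $ l)"
    using af x by (intro split_closureD[OF s a(1,2,5)]) auto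
  also have "\<dots> = s $ i + (2 - x) / (1 - x) * s $ j + s $ k"
  proof -
    have "line_gauge m (of_int m + x) (of_int m) = 1"
      using x by (simp add: line_gauge_def) (simp add: max_def field_simps)
    moreover have "(x - 2) / x \<le> 0" "0 \<le> (2 - x) / (1 - x)" using x by (auto simp: divide_le_0_iff)
    then have "line_gauge m (of_int m + x) (of_int m + 2) = (2 - x) / (1 - x)"
      by (simp add: line_gauge_def)
    ultimately show ?thesis by (simp add: distinct3_sum[OF d] split_gauge_eq af av m)
  qed
  also have "(2 - x) / (1 - x) * s $ j = s $ j + s $ j / (1 - x)"
    using x by (simp add: field_simps)
  finally have "1 - (\<Sum>l\<in>UNIV. s $ l) \<le> s $ j / (1 - x)"
    by (simp add: distinct3_sum[OF d])
  then show ?thesis using x by (simp add: x_def field_simps)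
qed

text \<open>The witness solves the three inequalities of \<open>type1_cut\<close> as equations; its
  coordinate sum is 1/2.\<close>

lemma type1_center_witness:
  assumes t1: "type1_triangle v" and free: "interior (tri v) \<inter> Zpts = {}"
    and f: "f \<in> interior (tri v)" and l: "\<And>l. bary v l f < 1/2"
  shows "(\<chi> l. (1 - 2 * bary v l f) / 2) \<in> split_closure v f"
proof (rule split_closureI)
  fix j show "0 \<le> (\<chi> l. (1 - 2 * bary v l f) / 2) $ j" using l[of j] by simp
next
  fix n b assume n: "n \<in> Zpts" and b: "of_int b < n \<bullet> f" "n \<bullet> f < of_int b + 1"
  have tri: "is_triangle v" and Z: "\<And>i. v i \<in> Zpts" using t1 by (auto simp: type1_triangle_def)
  have d: "distinct [1, 2, 3 :: 3]" by simp
  obtain a e g where a: "e \<in> Zpts" "g \<in> Zpts" "v 2 = v 1 + 2 *\<^sub>R e" "v 3 = v 1 + 2 *\<^sub>R g"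
    using type1_basis[OF t1 free d] by metis
  obtain m p q where mpq: "n \<bullet> v 1 = of_int m" "n \<bullet> e = of_int p" "n \<bullet> g = of_int q"
    using Zpts_inner[OF n Z[of 1]] Zpts_inner[OF n a(1)] Zpts_inner[OF n a(2)] by (metis Ints_cases)
  have nv: "n \<bullet> v 1 = of_int m" "n \<bullet> v 2 = of_int (m + 2 * p)" "n \<bullet> v 3 = of_int (m + 2 * q)"
    using mpq by (simp_all add: a inner_add_right)
  define w where "w = (\<lambda>l. 1 - 2 * bary v l f)"
  have lam1: "bary v 1 f = 1 - bary v 2 f - bary v 3 f" using bary_eqD(1)[OF tri d, of f] by simp
  have w: "0 < w 1" "0 < w 2" "0 < w 3" "w 1 + w 2 + w 3 = 1" using l[of 1] l[of 2] l[of 3] lam1 by (auto simp: w_def)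
  \<comment> \<open>The three integers are the values of the form at the midpoints opposite
    \<open>v 1\<close>, \<open>v 2\<close>, \<open>v 3\<close>.\<close>
  have u: "n \<bullet> f = w 1 * of_int (m + p + q) + w 2 * of_int (m + q) + w 3 * of_int (m + p)"
    by (simp add: inner_combination[OF tri d, of n f] nv w_def lam1 algebra_simps)
  have "1 \<le> w 1 * (line_gauge b (n \<bullet> f) (of_int m) - 1)
     + w 2 * (line_gauge b (n \<bullet> f) (of_int (m + 2 * p)) - 1)
     + w 3 * (line_gauge b (n \<bullet> f) (of_int (m + 2 * q)) - 1)"
    using center_split[OF w u b] by (simp add: algebra_simps)
  then have "2 \<le> w 1 * line_gauge b (n \<bullet> f) (of_int m)
     + w 2 * line_gauge b (n \<bullet> f) (of_int (m + 2 * p))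
     + w 3 * line_gauge b (n \<bullet> f) (of_int (m + 2 * q))"
    using w(4) by (simp add: algebra_simps)
  also have "\<dots> = 2 * (\<Sum>j\<in>UNIV. split_gauge n b f (v j - f) * (\<chi> l. (1 - 2 * bary v l f) / 2) $ j)"
    unfolding distinct3_sum[OF d] split_gauge_eq nv w_def[symmetric] by (simp add: w_def field_simps)
  finally show "1 \<le> (\<Sum>j\<in>UNIV. split_gauge n b f (v j - f) * (\<chi> l. (1 - 2 * bary v l f) / 2) $ j)"
    by simp
qed

text \<open>The witness is 0 at \<open>i\<close> and gives equality in \<open>type1_cut\<close> at
  the other two indices, where 1 minus the coordinate sum is
  \<open>1 / (1 + 2 * bary v i f)\<close>.\<close>

lemma type1_corner_witness:
  assumes t1: "type1_triangle v" and free: "interior (tri v) \<inter> Zpts = {}"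
    and f: "f \<in> interior (tri v)" and l: "1/2 < bary v i f"
  shows "(\<chi> l. if l = i then 0 else (1 - 2 * bary v l f) / (1 + 2 * bary v i f)) \<in> split_closure v f"
    (is "?s \<in> _")
proof -
  have tri: "is_triangle v" and Z: "\<And>i. v i \<in> Zpts" using t1 by (auto simp: type1_triangle_def)
  obtain j k where d: "distinct [i, j, k]" using ex_distinct3 by blast
  have pos: "0 < bary v l f" for l using f by (auto simp: interior_tri_eq[OF tri])
  have sum: "bary v i f + bary v j f + bary v k f = 1" by (rule bary_eqD[OF tri d])
  have ljk: "bary v j f < 1/2" "bary v k f < 1/2" using sum pos[of j] pos[of k] l by linarith+
  show ?thesis
  proof (rule split_closureI)
    have "\<forall>l. 0 \<le> ?s $ l" unfolding distinct3_all[OF d] using ljk pos[of i] d by auto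
    then show "0 \<le> ?s $ l" for l by blast
  next
    fix n b assume n: "n \<in> Zpts" and b: "of_int b < n \<bullet> f" "n \<bullet> f < of_int b + 1"
    obtain a e g where a: "e \<in> Zpts" "g \<in> Zpts" "v j = v i + 2 *\<^sub>R e" "v k = v i + 2 *\<^sub>R g"
      using type1_basis[OF t1 free d] by metis
    obtain m p q where mpq: "n \<bullet> v i = of_int m" "n \<bullet> e = of_int p" "n \<bullet> g = of_int q"
      using Zpts_inner[OF n Z[of i]] Zpts_inner[OF n a(1)] Zpts_inner[OF n a(2)] by (metis Ints_cases)
    have nv: "n \<bullet> v j = of_int m + 2 * of_int p" "n \<bullet> v k = of_int m + 2 * of_int q"
      using mpq by (simp_all add: a inner_add_right)
    have li: "bary v i f = 1 - bary v j f - bary v k f" using sum by simp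
    have u: "n \<bullet> f = of_int m + of_int p * (2 * bary v j f) + of_int q * (2 * bary v k f)"
      by (simp add: inner_combination[OF tri d, of n f] nv mpq li algebra_simps)
    have "1 \<le> (line_gauge b (n \<bullet> f) (of_int m + 2 * of_int p) - 1) * (1 - 2 * bary v j f)
         + (line_gauge b (n \<bullet> f) (of_int m + 2 * of_int q) - 1) * (1 - 2 * bary v k f)"
      using pos[of j] pos[of k] l li by (intro corner_split[OF _ _ _ u b]) auto
    then have "1 + 2 * bary v i f \<le> line_gauge b (n \<bullet> f) (n \<bullet> v j) * (1 - 2 * bary v j f)
         + line_gauge b (n \<bullet> f) (n \<bullet> v k) * (1 - 2 * bary v k f)"
      unfolding nv li by (simp add: algebra_simps)
    then have "1 \<le> (line_gauge b (n \<bullet> f) (n \<bullet> v j) * (1 - 2 * bary v j f)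
         + line_gauge b (n \<bullet> f) (n \<bullet> v k) * (1 - 2 * bary v k f)) / (1 + 2 * bary v i f)"
      using pos[of i] by simp
    also have "\<dots> = (\<Sum>l\<in>UNIV. split_gauge n b f (v l - f) * ?s $ l)"
      unfolding distinct3_sum[OF d] split_gauge_eq using d by (auto simp: add_divide_distrib)
    finally show "1 \<le> (\<Sum>l\<in>UNIV. split_gauge n b f (v l - f) * ?s $ l)" .
  qed
qed

text \<open>A coordinate equal to 1/2 puts \<open>f\<close> on the boundary of a strip of
  \<open>type1_cut\<close>; such \<open>f\<close> form a null set and are left out.\<close>

lemma type1_bound_iff:
  assumes t1: "type1_triangle v" and free: "interior (tri v) \<inter> Zpts = {}"
    and f: "f \<in> interior (tri v)" and ne: "\<And>l. bary v l f \<noteq> 1/2" and z: "z > 1"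
  shows "(\<forall>s\<in>split_closure v f. 1 \<le> z * (\<Sum>l\<in>UNIV. s $ l)) \<longleftrightarrow> 2 \<le> z \<or> (\<exists>i. 1 / (2 * (z - 1)) \<le> bary v i f)"
    (is "?L \<longleftrightarrow> _")
proof (cases "\<exists>i. 1/2 < bary v i f")
  case True
  have tri: "is_triangle v" using t1 by (auto simp: type1_triangle_def)
  obtain i where i: "1/2 < bary v i f" using True ..
  obtain j k where d: "distinct [i, j, k]" using ex_distinct3 by blast
  have pos: "0 < bary v l f" for l using f by (auto simp: interior_tri_eq[OF tri])
  have sum: "bary v i f + bary v j f + bary v k f = 1" by (rule bary_eqD[OF tri d])
  have ljk: "bary v j f < 1/2" "bary v k f < 1/2" using sum pos[of j] pos[of k] i by linarith+
  have "?L \<longleftrightarrow> 1 \<le> z * (2 * bary v i f / (1 + 2 * bary v i f))"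
  proof
    assume ?L
    from this[rule_format, OF type1_corner_witness[OF t1 free f i]]
    have "1 \<le> z * ((1 - 2 * bary v j f) / (1 + 2 * bary v i f) + (1 - 2 * bary v k f) / (1 + 2 * bary v i f))"
      using d by (auto simp: distinct3_sum[OF d])
    also have "(1 - 2 * bary v j f) / (1 + 2 * bary v i f) + (1 - 2 * bary v k f) / (1 + 2 * bary v i f)
       = 2 * bary v i f / (1 + 2 * bary v i f)"
      using sum by (simp add: add_divide_distrib[symmetric])
    finally show "1 \<le> z * (2 * bary v i f / (1 + 2 * bary v i f))" .
  next
    assume R: "1 \<le> z * (2 * bary v i f / (1 + 2 * bary v i f))"
    show ?L
    proof
      fix s assume s: "s \<in> split_closure v f"
      let ?S = "\<Sum>l\<in>UNIV. s $ l"
      have "(1 - 2 * bary v j f) * (1 - ?S) + (1 - 2 * bary v k f) * (1 - ?S) \<le> s $ j + s $ k"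
        by (intro add_mono type1_cut[OF t1 free f s] ljk)
      also have "\<dots> \<le> ?S" using s by (simp add: distinct3_sum[OF d] cut_closure_def)
      also have "(1 - 2 * bary v j f) * (1 - ?S) + (1 - 2 * bary v k f) * (1 - ?S) = 2 * bary v i f * (1 - ?S)"
        by (subst sum[THEN eq_diff_eq[THEN iffD2], THEN eq_diff_eq[THEN iffD2]]) (simp add: algebra_simps)
      finally have "2 * bary v i f / (1 + 2 * bary v i f) \<le> ?S"
        using pos[of i] by (simp add: field_simps)
      then have "z * (2 * bary v i f / (1 + 2 * bary v i f)) \<le> z * ?S" using z by (intro mult_left_mono) auto
      then show "1 \<le> z * ?S" using R by linarith
    qed
  qed
  also have "\<dots> \<longleftrightarrow> 1 / (2 * (z - 1)) \<le> bary v i f"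
    using pos[of i] z by (simp add: field_simps)
  also have "\<dots> \<longleftrightarrow> 2 \<le> z \<or> (\<exists>i. 1 / (2 * (z - 1)) \<le> bary v i f)"
  proof -
    \<comment> \<open>The threshold passes 1/2 exactly at \<open>z = 2\<close>; below that only the
      coordinate \<open>i\<close>, the one above 1/2, can reach it.\<close>
    have "1 / (2 * (z - 1)) \<le> 1/2" if "2 \<le> z" using that by (simp add: field_simps)
    moreover have "1/2 < 1 / (2 * (z - 1))" if "\<not> 2 \<le> z" using that z by (simp add: field_simps)
    moreover have "(\<exists>i. 1 / (2 * (z - 1)) \<le> bary v i f) \<longleftrightarrow> 1 / (2 * (z - 1)) \<le> bary v i f \<or>
        1 / (2 * (z - 1)) \<le> bary v j f \<or> 1 / (2 * (z - 1)) \<le> bary v k f"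
      using distinct3_all[OF d, of "\<lambda>l. \<not> 1 / (2 * (z - 1)) \<le> bary v l f"] by blast
    ultimately show ?thesis using i ljk by argo
  qed
  finally show ?thesis .
next
  case False
  have tri: "is_triangle v" using t1 by (auto simp: type1_triangle_def)
  have lt: "bary v l f < 1/2" for l using False ne[of l] by (metis linorder_less_linear)
  have d: "distinct [1, 2, 3 :: 3]" by simp
  have sum: "bary v 1 f + bary v 2 f + bary v 3 f = 1" by (rule bary_eqD[OF tri d])
  have "?L \<longleftrightarrow> 2 \<le> z"
  proof
    assume ?L
    from this[rule_format, OF type1_center_witness[OF t1 free f lt]]
    have "1 \<le> z * (\<Sum>l\<in>UNIV. (1 - 2 * bary v l f) / 2)" by simp
    also have "(\<Sum>l\<in>UNIV. (1 - 2 * bary v l f) / 2) = 1/2"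
      using sum by (simp add: distinct3_sum[OF d] field_simps)
    finally show "2 \<le> z" by simp
  next
    assume z2: "2 \<le> z"
    show ?L
    proof
      fix s assume s: "s \<in> split_closure v f"
      let ?S = "\<Sum>l\<in>UNIV. s $ l"
      have "(1 - 2 * bary v 1 f) * (1 - ?S) + (1 - 2 * bary v 2 f) * (1 - ?S) + (1 - 2 * bary v 3 f) * (1 - ?S)
         \<le> s $ 1 + s $ 2 + s $ 3"
        by (intro add_mono type1_cut[OF t1 free f s] lt)
      also have "\<dots> = ?S" by (simp add: sum_3)
      also have "(1 - 2 * bary v 1 f) * (1 - ?S) + (1 - 2 * bary v 2 f) * (1 - ?S) + (1 - 2 * bary v 3 f) * (1 - ?S)
         = (3 - 2 * (bary v 1 f + bary v 2 f + bary v 3 f)) * (1 - ?S)" by (simp add: algebra_simps)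
      finally have "1 \<le> 2 * ?S" unfolding sum by simp
      moreover have "2 * ?S \<le> z * ?S"
        using z2 s by (intro mult_right_mono sum_nonneg) (auto simp: cut_closure_def)
      ultimately show "1 \<le> z * ?S" by linarith
    qed
  qed
  moreover have "\<not> 1 / (2 * (z - 1)) \<le> bary v i f" if "\<not> 2 \<le> z" for i
  proof -
    have "1/2 < 1 / (2 * (z - 1))" using that z by (simp add: field_simps)
    then show ?thesis using lt[of i] by linarith
  qed
  ultimately show ?thesis by blast
qed

section \<open>Areas of the sublevel sets for type 1\<close>

lemma negligible_bary:
  assumes "is_triangle v" shows "negligible {x. bary v i x = t}"
proof -
  obtain n c where n: "\<And>x. bary v i x = n \<bullet> x + c" using bary_affine by blast
  obtain j k where d: "distinct [i, j, k]" using ex_distinct3 by blast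
  have "n \<noteq> 0"
  proof
    assume "n = 0"
    then have "bary v i (v i) = bary v i (v j)" by (simp add: n)
    then show False using d by (simp add: bary_vertex[OF assms])
  qed
  moreover have "{x. bary v i x = t} = {x. n \<bullet> x = t - c}" by (auto simp: n)
  ultimately show ?thesis by (simp add: negligible_hyperplane)
qed

lemma PB_eq:
  assumes "is_triangle v" "z > 1"
  shows "PB v z = measure lebesgue {f \<in> interior (tri v). \<forall>s\<in>split_closure v f. 1 \<le> z * (\<Sum>j\<in>UNIV. s $ j)}
     / measure lebesgue (tri v)"
  unfolding PB_def using strength_le_iff[OF assms(1) _ assms(2)]
  by (intro arg_cong2[where f = "(/)"] arg_cong2[where f = measure] Collect_cong refl) blast

lemma corner_eq:
  assumes tri: "is_triangle v" and d: "distinct [i, j, k]" and \<theta>: "0 \<le> \<theta>" "\<theta> < 1"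
  shows "{x \<in> tri v. \<theta> \<le> bary v i x} =
     convex hull {v i, v i + (1 - \<theta>) *\<^sub>R (v j - v i), v i + (1 - \<theta>) *\<^sub>R (v k - v i)}"
proof (intro set_eqI iffI)
  fix x assume "x \<in> {x \<in> tri v. \<theta> \<le> bary v i x}"
  then have x: "0 \<le> bary v j x" "0 \<le> bary v k x" "\<theta> \<le> bary v i x" by (auto simp: tri_eq[OF tri])
  show "x \<in> convex hull {v i, v i + (1 - \<theta>) *\<^sub>R (v j - v i), v i + (1 - \<theta>) *\<^sub>R (v k - v i)}"
    by (rule sub_triangle_mem[OF bary_eqD(2)[OF tri d], of x "bary v j x / (1 - \<theta>)" _ "bary v k x / (1 - \<theta>)"])
       (use x \<theta> bary_eqD(1)[OF tri d, of x] in \<open>auto simp: add_divide_distrib[symmetric]\<close>)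
next
  fix x assume "x \<in> convex hull {v i, v i + (1 - \<theta>) *\<^sub>R (v j - v i), v i + (1 - \<theta>) *\<^sub>R (v k - v i)}"
  then obtain \<alpha> \<beta> where x: "x = v i + (\<alpha> * (1 - \<theta>)) *\<^sub>R (v j - v i) + (\<beta> * (1 - \<theta>)) *\<^sub>R (v k - v i)"
    and ab: "0 \<le> \<alpha>" "0 \<le> \<beta>" "\<alpha> + \<beta> \<le> 1" by (rule sub_triangle_memE)
  have bary: "bary v i x = 1 - (\<alpha> + \<beta>) * (1 - \<theta>)" "bary v j x = \<alpha> * (1 - \<theta>)" "bary v k x = \<beta> * (1 - \<theta>)"
    using d unfolding x bary_add_diff by (auto simp: bary_vertex[OF tri]) (simp add: algebra_simps)
  have "(\<alpha> + \<beta>) * (1 - \<theta>) \<le> 1 * (1 - \<theta>)" using ab \<theta> by (intro mult_right_mono) auto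
  then have i: "\<theta> \<le> bary v i x" by (simp add: bary)
  have "\<forall>l. 0 \<le> bary v l x" unfolding distinct3_all[OF d] using ab \<theta> i by (auto simp: bary(2,3))
  then show "x \<in> {x \<in> tri v. \<theta> \<le> bary v i x}" using i by (auto simp: tri_eq[OF tri])
qed

lemma corner_measure:
  assumes tri: "is_triangle v" and \<theta>: "0 \<le> \<theta>" "\<theta> < 1"
  shows "{x \<in> tri v. \<theta> \<le> bary v i x} \<in> lmeasurable"
    "measure lebesgue {x \<in> tri v. \<theta> \<le> bary v i x} = (1 - \<theta>)^2 * measure lebesgue (tri v)"
proof -
  obtain j k where d: "distinct [i, j, k]" using ex_distinct3 by blast
  show "{x \<in> tri v. \<theta> \<le> bary v i x} \<in> lmeasurable"
    by (simp add: corner_eq[OF tri d \<theta>] convex_hull_3_lmeasurable)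
  show "measure lebesgue {x \<in> tri v. \<theta> \<le> bary v i x} = (1 - \<theta>)^2 * measure lebesgue (tri v)"
    unfolding corner_eq[OF tri d \<theta>] sub_triangle_area tri_perm[OF d, of v, symmetric] by (simp add: power2_eq_square)
qed

theorem type1_PB:
  assumes t1: "type1_triangle v" and free: "interior (tri v) \<inter> Zpts = {}" and z: "z > 1"
  shows "PB v z = (if z \<le> 3/2 then 0 else if z < 2 then 3/4 * ((2*z - 3) / (z - 1))^2 else 1)"
proof -
  have tri: "is_triangle v" using t1 by (auto simp: type1_triangle_def)
  define G where "G = {f \<in> interior (tri v). \<forall>s\<in>split_closure v f. 1 \<le> z * (\<Sum>j\<in>UNIV. s $ j)}"
  \<comment> \<open>The exceptional null set: the midlines, and the frontier because the corners
    below are cut from the closed triangle whereas \<open>G\<close> lies in its interior.\<close>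
  define N where "N = (\<Union>l\<in>UNIV. {x. bary v l x = 1/2}) \<union> frontier (tri v)"
  define \<theta> where "\<theta> = 1 / (2 * (z - 1))"
  have "negligible (\<Union>l. {x. bary v l x = 1/2})"
    by (rule negligible_Union) (blast intro: negligible_bary[OF tri] | simp)+
  then have negN: "negligible N"
    unfolding N_def by (intro negligible_Un negligible_convex_frontier convex_convex_hull)
  have intN: "x \<in> interior (tri v)" if "x \<in> tri v" "x \<notin> N" for x
    using that closure_subset by (auto simp: N_def frontier_def)
  have iff: "x \<in> G \<longleftrightarrow> 2 \<le> z \<or> (\<exists>i. \<theta> \<le> bary v i x)" if "x \<in> interior (tri v)" "x \<notin> N" for x
    using type1_bound_iff[OF t1 free that(1) _ z] that by (auto simp: G_def \<theta>_def N_def)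
  have G_sub: "G \<subseteq> interior (tri v)" by (auto simp: G_def)
  have pos: "measure lebesgue (tri v) > 0" by (rule tri_measure_pos[OF tri])
  have PB: "PB v z = measure lebesgue G / measure lebesgue (tri v)"
    using PB_eq[OF tri z] by (simp add: G_def)
  consider "z \<le> 3/2" | "3/2 < z" "z < 2" | "2 \<le> z" by linarith
  then show ?thesis
  proof cases
    case 1
    then have \<theta>: "1 \<le> \<theta>" using z by (simp add: \<theta>_def field_simps)
    have "bary v i x < 1" if "x \<in> interior (tri v)" for i x
    proof -
      obtain j k where d: "distinct [i, j, k]" using ex_distinct3 by blast
      have "0 < bary v j x" "0 < bary v k x" using that by (auto simp: interior_tri_eq[OF tri])
      then show ?thesis using bary_eqD(1)[OF tri d, of x] by linarith
    qed
    then have "\<not> \<theta> \<le> bary v i x" if "x \<in> interior (tri v)" for i x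
      using \<theta> that by (meson less_le_trans not_le)
    moreover have "\<not> 2 \<le> z" using 1 by simp
    ultimately have "G \<subseteq> N" using iff G_sub by blast
    then have "measure lebesgue G = 0"
      using negN negligible_subset negligible_imp_measure0 by blast
    then show ?thesis using 1 by (simp add: PB)
  next
    case 2
    then have \<theta>: "1/2 < \<theta>" "\<theta> < 1" using z by (simp_all add: \<theta>_def field_simps)
    define C where "C = (\<lambda>i. {x \<in> tri v. \<theta> \<le> bary v i x})"
    have C: "C i \<in> lmeasurable" "measure lebesgue (C i) = (1 - \<theta>)^2 * measure lebesgue (tri v)" for i
      unfolding C_def using corner_measure[OF tri, of \<theta> i] \<theta> by auto
    \<comment> \<open>Two barycentric coordinates above 1/2 would exceed the total 1.\<close>
    have "C i \<inter> C j = {}" if ne: "i \<noteq> j" for i j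
    proof -
      obtain k where d: "distinct [i, j, k]"
      proof -
        obtain j' k' where "distinct [i, j', k']" using ex_distinct3 by blast
        then have d': "distinct [i, j', k']" .
        then have "j = i \<or> j = j' \<or> j = k'" using distinct3_all[OF d', of "\<lambda>l. l = i \<or> l = j' \<or> l = k'"] by blast
        then show ?thesis using that[of j'] that[of k'] ne d' by auto
      qed
      show ?thesis
      proof (rule ccontr)
        assume "C i \<inter> C j \<noteq> {}"
        then obtain x where x: "\<theta> \<le> bary v i x" "\<theta> \<le> bary v j x" "0 \<le> bary v k x"
          by (auto simp: C_def tri_eq[OF tri])
        then show False using bary_eqD(1)[OF tri d, of x] \<theta> by linarith
      qed
    qed
    then have dis: "disjoint_family C" by (auto simp: disjoint_family_on_def)
    have fin: "emeasure lebesgue (C i) \<noteq> \<infinity>" for i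
      unfolding infinity_ennreal_def by (rule fmeasurableD2[OF C(1)])
    have "measure lebesgue (\<Union>i\<in>UNIV. C i) = (\<Sum>i\<in>UNIV. measure lebesgue (C i))"
      by (rule measure_finite_Union[OF _ _ dis fin]) (use fmeasurableD[OF C(1)] in auto)
    then have mC: "measure lebesgue (\<Union>i. C i) = 3 * (1 - \<theta>)^2 * measure lebesgue (tri v)"
      by (simp add: C)
    have "(\<Union>i. C i) - G \<union> (G - (\<Union>i. C i)) \<subseteq> N"
    proof
      fix x assume x: "x \<in> (\<Union>i. C i) - G \<union> (G - (\<Union>i. C i))"
      show "x \<in> N"
      proof (rule ccontr)
        assume n: "x \<notin> N"
        have "x \<in> tri v" using x G_sub interior_subset by (auto simp: C_def)
        then have "x \<in> G \<longleftrightarrow> x \<in> (\<Union>i. C i)" using iff[OF intN[OF _ n] n] 2 by (auto simp: C_def)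
        then show False using x by blast
      qed
    qed
    moreover have "(\<Union>i. C i) \<in> lmeasurable"
      by (rule fmeasurable.finite_UN) (use C in auto)
    ultimately have "measure lebesgue G = measure lebesgue (\<Union>i. C i)"
      by (intro measure_negligible_symdiff negligible_subset[OF negN])
    then have "PB v z = 3 * (1 - \<theta>)^2" using pos by (simp add: PB mC)
    also have "1 - \<theta> = (1/2) * ((2*z - 3) / (z - 1))" using z by (simp add: \<theta>_def field_simps)
    also have "3 * \<dots>^2 = 3/4 * ((2*z - 3) / (z - 1))^2"
      unfolding power_mult_distrib by (simp add: power2_eq_square)
    finally show ?thesis using 2 by simp
  next
    case 3
    have "interior (tri v) - G \<union> (G - interior (tri v)) \<subseteq> N" using iff 3 G_sub by blast
    then have "measure lebesgue G = measure lebesgue (interior (tri v))"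
      by (intro measure_negligible_symdiff negligible_subset[OF negN] lmeasurable_interior)
         (auto simp: range_3 finite_imp_bounded_convex_hull)
    then show ?thesis using 3 pos by (simp add: PB measure_interior_tri)
  qed
qed

section \<open>Type 2 triangles\<close>

lemma primitive_direction:
  assumes "u0 \<in> Zpts" "u0 \<noteq> 0"
  obtains u r where "u \<in> Zpts" "1 \<le> r" "u0 = r *\<^sub>R u" "\<And>t. t *\<^sub>R u \<in> Zpts \<Longrightarrow> t \<in> \<int>"
proof -
  obtain m n where mn: "u0 $ 1 = of_int m" "u0 $ 2 = of_int n" using assms(1) by (rule ZptsE)
  have nz: "m \<noteq> 0 \<or> n \<noteq> 0" using assms(2) mn by (auto simp: vec_eq_iff forall_2)
  define r where "r = gcd m n"
  have "0 < r" unfolding r_def gcd_pos_int by (rule nz)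
  then have r: "1 \<le> r" by simp
  obtain m' n' where m': "m = m' * r" "n = n' * r" "coprime m' n'"
    using gcd_coprime_exists[of m n] r unfolding r_def by (metis not_one_le_zero)
  define u :: "real^2" where "u = vector [of_int m', of_int n']"
  have "t \<in> \<int>" if "t *\<^sub>R u \<in> Zpts" for t
  proof -
    \<comment> \<open>Bezout coefficients recover \<open>t\<close> as an integer combination of the
      coordinates of \<open>t *\<^sub>R u\<close>.\<close>
    obtain a b where "a * m' + b * n' = 1" using bezout_int[of m' n'] m'(3) by auto
    then have "real_of_int a * of_int m' + of_int b * of_int n' = 1" by (metis of_int_1 of_int_add of_int_mult)
    then have "t = of_int a * (t * of_int m') + of_int b * (t * of_int n')"
      by (metis (no_types, opaque_lifting) distrib_left mult.left_commute mult.right_neutral)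
    moreover have "t * of_int m' \<in> \<int>" "t * of_int n' \<in> \<int>"
      using that by (auto simp: Zpts_def u_def forall_2)
    ultimately show ?thesis by (metis Ints_add Ints_mult Ints_of_int)
  qed
  moreover have "u0 = of_int r *\<^sub>R u" using mn m' by (simp add: vec_eq_iff forall_2 u_def)
  moreover have "u \<in> Zpts" by (simp add: u_def)
  ultimately show ?thesis using that[of u "of_int r"] r by auto
qed

lemma open_segment_bary:
  assumes tri: "is_triangle v" and d: "distinct [i, j, k]"
  shows "x \<in> open_segment (v i) (v j) \<longleftrightarrow> bary v k x = 0 \<and> 0 < bary v i x \<and> 0 < bary v j x"
proof
  assume "x \<in> open_segment (v i) (v j)"
  then obtain t where t: "0 < t" "t < 1" "x = v i + t *\<^sub>R (v j - v i)"
    by (auto simp: in_segment algebra_simps)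
  then show "bary v k x = 0 \<and> 0 < bary v i x \<and> 0 < bary v j x"
    using d by (auto simp: bary_add_diff1 bary_vertex[OF tri])
next
  assume a: "bary v k x = 0 \<and> 0 < bary v i x \<and> 0 < bary v j x"
  have ne: "v i \<noteq> v j" using bary_vertex[OF tri, of i i] bary_vertex[OF tri, of i j] d by auto
  have "x = v i + bary v j x *\<^sub>R (v j - v i)" using bary_eqD(2)[OF tri d, of x] a by simp
  also have "\<dots> = (1 - bary v j x) *\<^sub>R v i + bary v j x *\<^sub>R v j" by (simp add: algebra_simps)
  finally have "x = (1 - bary v j x) *\<^sub>R v i + bary v j x *\<^sub>R v j" .
  then show "x \<in> open_segment (v i) (v j)"
    unfolding in_segment using ne a bary_eqD(1)[OF tri d, of x] by (intro conjI exI[of _ "bary v j x"]) auto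
qed

text \<open>The triangle \<open>p\<close>, \<open>p + u\<close>, \<open>y\<close> has no other
  integer points: \<open>p\<close> and \<open>p + u\<close> are consecutive on the base, and a point
  strictly between the base and \<open>y\<close> would be interior to the big triangle or lie on the
  open edge of \<open>y\<close>. Only one edge is mentioned, so that the lemma applies to both edges
  at \<open>v i\<close>.\<close>

lemma type2_dual_basis:
  assumes tri: "is_triangle v" and free: "interior (tri v) \<inter> Zpts = {}" and d: "distinct [i, j, k]"
    and p: "p \<in> Zpts" "bary v i p = 0" "0 \<le> bary v j p" "0 \<le> bary v k p"
    and u: "u \<in> Zpts" "u \<noteq> 0" "\<And>t. t *\<^sub>R u \<in> Zpts \<Longrightarrow> t \<in> \<int>"
    and q: "bary v i (p + u) = 0" "0 \<le> bary v j (p + u)" "0 \<le> bary v k (p + u)"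
    and y: "open_segment (v i) (v j) \<inter> Zpts = {y}"
  obtains a b where "a \<in> Zpts" "b \<in> Zpts" "a \<bullet> u = 1" "a \<bullet> (y - p) = 0" "b \<bullet> u = 0" "b \<bullet> (y - p) = 1"
    "\<And>r. r = (a \<bullet> r) *\<^sub>R u + (b \<bullet> r) *\<^sub>R (y - p)"
proof -
  have yZ: "y \<in> Zpts" and ys: "y \<in> open_segment (v i) (v j)" using y by auto
  have yl: "bary v k y = 0" "0 < bary v i y" "0 < bary v j y"
    using ys unfolding open_segment_bary[OF tri d] by auto
  have "cross u (y - p) \<noteq> 0"
  proof
    assume "cross u (y - p) = 0"
    then obtain t where "y - p = t *\<^sub>R u" using cross_eq_0_iff[OF u(2)] by blast
    then have "y = p + t *\<^sub>R ((p + u) - p)" by (simp add: algebra_simps)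
    then have "bary v i y = 0" using bary_add_diff1[of v i p t "p + u" p] p q by simp
    then show False using yl by simp
  qed
  moreover have "(\<alpha> = 0 \<or> \<alpha> = 1) \<and> (\<beta> = 0 \<or> \<beta> = 1)"
    if ab: "0 \<le> \<alpha>" "0 \<le> \<beta>" "\<alpha> + \<beta> \<le> 1" and Zx: "\<alpha> *\<^sub>R u + \<beta> *\<^sub>R (y - p) \<in> Zpts" for \<alpha> \<beta>
  proof -
    define x where "x = p + \<alpha> *\<^sub>R ((p + u) - p) + \<beta> *\<^sub>R (y - p)"
    have "x = p + (\<alpha> *\<^sub>R u + \<beta> *\<^sub>R (y - p))" by (simp add: x_def)
    then have xZ: "x \<in> Zpts" using Zpts_add[OF p(1) Zx] by simp
    have bary: "bary v l x = (1 - \<alpha> - \<beta>) * bary v l p + \<alpha> * bary v l (p + u) + \<beta> * bary v l y" for l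
      by (simp only: x_def bary_add_diff) (simp add: algebra_simps)
    consider "\<beta> = 0" | "\<beta> = 1" | "0 < \<beta>" "\<beta> < 1" using ab by linarith
    then show ?thesis
    proof cases
      case 1
      then have "\<alpha> \<in> \<int>" using u(3)[of \<alpha>] Zx by simp
      then show ?thesis using 1 ab by (auto elim!: Ints_cases)
    next
      case 2
      then show ?thesis using ab by simp
    next
      case 3
      have i: "bary v i x = \<beta> * bary v i y" by (simp add: bary p q)
      have xi: "0 < bary v i x" using 3 yl by (simp add: i)
      have "0 \<le> (1 - \<alpha> - \<beta>) * bary v j p + \<alpha> * bary v j (p + u)" using ab p q by simp
      moreover have "0 < \<beta> * bary v j y" using 3 yl by simp
      ultimately have xj: "0 < bary v j x" unfolding bary by linarith
      have xk: "0 \<le> bary v k x" using ab p q by (simp add: bary yl)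
      have "\<not> 0 < bary v k x"
      proof
        assume "0 < bary v k x"
        then have "\<forall>l. 0 < bary v l x" unfolding distinct3_all[OF d] using xi xj by auto
        then show False using free xZ by (auto simp: interior_tri_eq[OF tri])
      qed
      then have "x \<in> open_segment (v i) (v j)" using xk xi xj by (simp add: open_segment_bary[OF tri d])
      then have "x = y" using xZ y by blast
      then show ?thesis using i 3 yl by simp
    qed
  qed
  ultimately show ?thesis
    by (rule empty_triangle_dual_basis[OF u(1) Zpts_diff[OF yZ p(1)]]) (use that in blast)+
qed

text \<open>The base of a type 2 triangle lies on a lattice line, and the two integer points on the other
  edges are consecutive points of the next lattice line; \<open>a \<bullet> (x - p)\<close> and \<open>b \<bullet> (x - p)\<close> are the
  coordinates in which these four points form the unit square.\<close>

lemma type2_square: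
  assumes t2: "type2_triangle v" and free: "interior (tri v) \<inter> Zpts = {}"
  obtains i j k p u g a b where "distinct [i, j, k]" "p \<in> Zpts" "u \<in> Zpts" "g \<in> Zpts" "a \<in> Zpts" "b \<in> Zpts"
    "a \<bullet> u = 1" "a \<bullet> g = 0" "b \<bullet> u = 0" "b \<bullet> g = 1" "\<forall>r. r = (a \<bullet> r) *\<^sub>R u + (b \<bullet> r) *\<^sub>R g"
    "bary v i p = 0" "0 \<le> bary v j p" "0 \<le> bary v k p"
    "bary v i (p + u) = 0" "0 \<le> bary v j (p + u)" "0 \<le> bary v k (p + u)" "bary v k p < bary v k (p + u)"
    "bary v k (p + g) = 0" "0 < bary v i (p + g)" "0 < bary v j (p + g)"
    "bary v j (p + u + g) = 0" "0 < bary v i (p + u + g)" "0 < bary v k (p + u + g)"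
proof -
  have tri: "is_triangle v" using t2 by (simp add: type2_triangle_def)
  obtain i j k p0 q0 where d: "distinct [i, j, k]"
    and cj: "card (open_segment (v i) (v j) \<inter> Zpts) = 1" and ck: "card (open_segment (v i) (v k) \<inter> Zpts) = 1"
    and pq0: "p0 \<noteq> q0" "p0 \<in> closed_segment (v j) (v k) \<inter> Zpts" "q0 \<in> closed_segment (v j) (v k) \<inter> Zpts"
    using t2 unfolding type2_triangle_def by blast
  have base: "bary v i x = 0 \<and> 0 \<le> bary v j x \<and> 0 \<le> bary v k x \<and> bary v j x = 1 - bary v k x
     \<and> x = v j + bary v k x *\<^sub>R (v k - v j)"
    if "x \<in> closed_segment (v j) (v k)" for x
  proof -
    obtain t where t: "0 \<le> t" "t \<le> 1" "x = v j + t *\<^sub>R (v k - v j)"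
      using \<open>x \<in> _\<close> by (auto simp: in_segment algebra_simps)
    have "bary v i x = 0 \<and> bary v j x = 1 - t \<and> bary v k x = t"
      using d by (auto simp: t bary_add_diff1 bary_vertex[OF tri])
    then show ?thesis using t by simp
  qed
  have "bary v k p0 \<noteq> bary v k q0" using base[of p0] base[of q0] pq0 by (metis IntD1)
  then obtain p q where pq: "p \<in> closed_segment (v j) (v k)" "q \<in> closed_segment (v j) (v k)"
      "p \<in> Zpts" "q \<in> Zpts" "bary v k p < bary v k q"
    using pq0 by (metis IntD1 IntD2 linorder_less_linear)
  have "q - p \<noteq> 0" using pq(5) by auto
  then obtain u r where u: "u \<in> Zpts" "1 \<le> r" "q - p = r *\<^sub>R u" "\<And>t. t *\<^sub>R u \<in> Zpts \<Longrightarrow> t \<in> \<int>"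
    using primitive_direction[OF Zpts_diff[OF pq(4,3)]] by metis
  have u0: "u \<noteq> 0" using u(3) \<open>q - p \<noteq> 0\<close> by auto
  \<comment> \<open>Since \<open>r \<ge> 1\<close>, the point \<open>p + u\<close> lies between
    \<open>p\<close> and \<open>q\<close> and thus stays on the base.\<close>
  have pu: "p + u = p + (1/r) *\<^sub>R (q - p)" using u by simp
  have lpu: "bary v l (p + u) = bary v l p + (1/r) * (bary v l q - bary v l p)" for l
    unfolding pu bary_add_diff1 ..
  have r: "0 < 1/r" "1/r \<le> 1" using u(2) by auto
  have lk: "bary v k p < bary v k (p + u)" using pq(5) r by (simp add: lpu)
  have conv: "0 \<le> x + (1/r) * (y - x)" if "0 \<le> x" "0 \<le> y" for x y :: real
  proof -
    have "0 \<le> (1 - 1/r) * x" "0 \<le> (1/r) * y" using that r by auto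
    moreover have "x + t * (y - x) = (1 - t) * x + t * y" for t by (simp add: algebra_simps)
    ultimately show ?thesis by (metis add_nonneg_nonneg)
  qed
  have P: "bary v i p = 0" "0 \<le> bary v j p" "0 \<le> bary v k p" using base[OF pq(1)] by auto
  have Q0: "bary v i q = 0" "0 \<le> bary v j q" "0 \<le> bary v k q" using base[OF pq(2)] by auto
  have "bary v i (p + u) = 0" by (simp add: lpu P Q0)
  moreover have "0 \<le> bary v j (p + u)" unfolding lpu by (intro conv P Q0)
  moreover have "0 \<le> bary v k (p + u)" unfolding lpu by (intro conv P Q0)
  ultimately have Q: "bary v i (p + u) = 0" "0 \<le> bary v j (p + u)" "0 \<le> bary v k (p + u)" by auto
  obtain y where y: "open_segment (v i) (v j) \<inter> Zpts = {y}" using cj by (rule card_1_singletonE)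
  obtain x where x: "open_segment (v i) (v k) \<inter> Zpts = {x}" using ck by (rule card_1_singletonE)
  have yl: "bary v k y = 0" "0 < bary v i y" "0 < bary v j y" and yZ: "y \<in> Zpts"
    using y open_segment_bary[OF tri d, of y] by auto
  have d': "distinct [i, k, j]" using d by auto
  have xl: "bary v j x = 0" "0 < bary v i x" "0 < bary v k x" and xZ: "x \<in> Zpts"
    using x open_segment_bary[OF tri d', of x] by auto
  define g where "g = y - p"
  have gZ: "g \<in> Zpts" using yZ pq(3) by (simp add: g_def Zpts_diff)
  obtain a b where ab: "a \<in> Zpts" "b \<in> Zpts" "a \<bullet> u = 1" "a \<bullet> g = 0" "b \<bullet> u = 0" "b \<bullet> g = 1"
    and rep: "\<And>r. r = (a \<bullet> r) *\<^sub>R u + (b \<bullet> r) *\<^sub>R g"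
    using type2_dual_basis[OF tri free d pq(3) P u(1) u0 u(4) Q y] unfolding g_def by metis
  \<comment> \<open>The integer point of the other edge has its own form \<open>b'\<close> vanishing
    on \<open>u\<close>. Evaluating it at \<open>x - p\<close> gives \<open>s * n = 1\<close>, so
    \<open>x\<close> and \<open>y\<close> are on the same lattice line.\<close>
  obtain b' where b': "b' \<in> Zpts" "b' \<bullet> u = 0" "b' \<bullet> (x - p) = 1"
    using type2_dual_basis[OF tri free d' pq(3) P(1,3,2) u(1) u0 u(4) Q(1,3,2) x] by metis
  obtain t s where ts: "a \<bullet> (x - p) = of_int t" "b \<bullet> (x - p) = of_int s"
    using Zpts_inner[OF ab(1) Zpts_diff[OF xZ pq(3)]] Zpts_inner[OF ab(2) Zpts_diff[OF xZ pq(3)]]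
    by (auto elim!: Ints_cases)
  have xp: "x - p = of_int t *\<^sub>R u + of_int s *\<^sub>R g" using rep[of "x - p"] unfolding ts .
  then have x_eq: "x = p + of_int t *\<^sub>R ((p + u) - p) + of_int s *\<^sub>R (y - p)"
    by (simp add: g_def algebra_simps)
  have lx: "bary v l x = bary v l p + of_int t * (bary v l (p + u) - bary v l p) + of_int s * (bary v l y - bary v l p)" for l
    by (subst x_eq) (rule bary_add_diff)
  have "0 < of_int s * bary v i y" using lx[of i] xl P Q by simp
  then have "0 < s" using yl by (simp add: zero_less_mult_iff)
  obtain n where n: "b' \<bullet> g = of_int n" using Zpts_inner[OF b'(1) gZ] by (auto elim: Ints_cases)
  have "b' \<bullet> (x - p) = of_int s * of_int n" unfolding xp by (simp add: inner_add_right b' n)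
  then have "s * n = 1" using b'(3) by (metis of_int_1 of_int_eq_iff of_int_mult)
  then have s1: "s = 1" using \<open>0 < s\<close> by (simp add: zmult_eq_1_iff)
  have xk: "bary v k x = of_int t * (bary v k (p + u) - bary v k p)" using lx[of k] s1 yl by simp
  then have t0: "0 < t" using xl lk by (simp add: zero_less_mult_iff)
  have t1: "t = 1"
  proof (rule ccontr)
    assume "t \<noteq> 1"
    then have t2: "2 \<le> t" using t0 by simp
    \<comment> \<open>For \<open>t \<ge> 2\<close> the integer point \<open>y + u\<close> would lie
      strictly between \<open>y\<close> and \<open>x\<close>, hence in the interior.\<close>
    have "y + (1 / of_int t) *\<^sub>R (x - y) = y + u"
      using t2 s1 by (simp add: x_eq algebra_simps)
    then have Z: "y + (1 / of_int t) *\<^sub>R (x - y) \<in> Zpts" using yZ u(1) by (simp add: Zpts_add)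
    have l: "bary v l (y + (1 / of_int t) *\<^sub>R (x - y)) = (1 - 1 / of_int t) * bary v l y + (1 / of_int t) * bary v l x" for l
      by (simp only: bary_add_diff1) (simp add: algebra_simps)
    have "0 < 1 - 1 / real_of_int t" "0 < 1 / real_of_int t" using t2 by auto
    then have "\<forall>l. 0 < bary v l (y + (1 / of_int t) *\<^sub>R (x - y))"
      unfolding distinct3_all[OF d] l using yl xl by (auto intro: add_pos_pos mult_pos_pos)
    then show False using free Z by (auto simp: interior_tri_eq[OF tri])
  qed
  have yg: "p + g = y" by (simp add: g_def)
  have xg: "p + u + g = x" using xp s1 t1 by (simp add: algebra_simps)
  show ?thesis
    by (rule that[OF d pq(3) u(1) gZ ab allI[OF rep] P Q lk]) (use yl xl in \<open>simp_all add: yg xg\<close>)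
qed

text \<open>\<open>c\<close> and \<open>d\<close> are the overhangs of the base beyond
  \<open>p\<close> and \<open>p + u\<close>, and \<open>h\<close> is the height of the apex, which
  lies on the line through \<open>v j\<close> and \<open>p + g\<close>. The last equation says that
  the chord at height 1, of length \<open>(1 + c + d) * (h - 1) / h\<close>, has length 1.\<close>

lemma type2_coordinates:
  assumes t2: "type2_triangle v" and free: "interior (tri v) \<inter> Zpts = {}"
  obtains i j k p u g a b c d h where "distinct [i, j, k]" "p \<in> Zpts" "u \<in> Zpts" "g \<in> Zpts" "a \<in> Zpts" "b \<in> Zpts"
    "a \<bullet> u = 1" "a \<bullet> g = 0" "b \<bullet> u = 0" "b \<bullet> g = 1" "\<forall>r. r = (a \<bullet> r) *\<^sub>R u + (b \<bullet> r) *\<^sub>R g"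
    "p \<in> tri v" "p + u \<in> tri v" "p + g \<in> tri v" "p + u + g \<in> tri v"
    "a \<bullet> v i = a \<bullet> p + c * (h - 1)" "a \<bullet> v j = a \<bullet> p - c" "a \<bullet> v k = a \<bullet> p + 1 + d"
    "b \<bullet> v i = b \<bullet> p + h" "b \<bullet> v j = b \<bullet> p" "b \<bullet> v k = b \<bullet> p"
    "0 \<le> c" "0 \<le> d" "1 < h" "(c + d) * (h - 1) = 1"
proof -
  have tri: "is_triangle v" using t2 by (simp add: type2_triangle_def)
  obtain i j k p u g a b where D: "distinct [i, j, k]"
    and Z: "p \<in> Zpts" "u \<in> Zpts" "g \<in> Zpts" "a \<in> Zpts" "b \<in> Zpts"
    and dual: "a \<bullet> u = 1" "a \<bullet> g = 0" "b \<bullet> u = 0" "b \<bullet> g = 1" and rep: "\<forall>r. r = (a \<bullet> r) *\<^sub>R u + (b \<bullet> r) *\<^sub>R g"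
    and P: "bary v i p = 0" "0 \<le> bary v j p" "0 \<le> bary v k p"
    and Q: "bary v i (p + u) = 0" "0 \<le> bary v j (p + u)" "0 \<le> bary v k (p + u)" "bary v k p < bary v k (p + u)"
    and Y: "bary v k (p + g) = 0" "0 < bary v i (p + g)" "0 < bary v j (p + g)"
    and X: "bary v j (p + u + g) = 0" "0 < bary v i (p + u + g)" "0 < bary v k (p + u + g)"
    by (rule type2_square[OF t2 free])
  have mem: "x \<in> tri v" if "0 \<le> bary v i x" "0 \<le> bary v j x" "0 \<le> bary v k x" for x
    using that distinct3_all[OF D, of "\<lambda>l. 0 \<le> bary v l x"] by (simp add: tri_eq[OF tri])
  note S = bary_eqD(1)[OF tri D]
  define V where "V = (\<lambda>n l. n \<bullet> v l - n \<bullet> p)"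
  have coord: "n \<bullet> x - n \<bullet> p = bary v i x * V n i + bary v j x * V n j + bary v k x * V n k" for n x
  proof -
    have "bary v i x * V n i + bary v j x * V n j + bary v k x * V n k
       = n \<bullet> x - (bary v i x + bary v j x + bary v k x) * (n \<bullet> p)"
      by (simp add: inner_combination[OF tri D, of n x] V_def algebra_simps)
    then show ?thesis by (simp add: S)
  qed
  \<comment> \<open>\<open>L\<close> is the length of the base in units of \<open>u\<close>; the
    coordinate step \<open>\<delta>\<close> from \<open>p\<close> to \<open>p + u\<close> will be
    its reciprocal.\<close>
  define L where "L = V a k - V a j"
  define \<delta> where "\<delta> = bary v k (p + u) - bary v k p"
  have jp: "bary v j p = 1 - bary v k p" "bary v j (p + u) = 1 - bary v k (p + u)"
    using S[of p] S[of "p + u"] P Q by auto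
  have "V b j + bary v k p * (V b k - V b j) = 0" using coord[of b p] by (simp add: P jp algebra_simps)
  moreover have "V b j + bary v k (p + u) * (V b k - V b j) = 0"
    using coord[of b "p + u"] dual by (simp add: Q jp inner_add_right algebra_simps)
  ultimately have "\<delta> * (V b k - V b j) = 0" "V b j = - bary v k p * (V b k - V b j)"
    by (simp_all add: \<delta>_def algebra_simps)
  then have bjk: "V b j = 0" "V b k = 0" using Q(4) by (auto simp: \<delta>_def)
  have aj: "V a j = - bary v k p * L" using coord[of a p] by (simp add: P jp L_def algebra_simps)
  have "V a j + bary v k (p + u) * L = 1"
    using coord[of a "p + u"] dual by (simp add: Q jp L_def inner_add_right algebra_simps)
  then have L1: "\<delta> * L = 1" by (simp add: aj \<delta>_def algebra_simps)
  have "0 < \<delta>" using Q(4) by (simp add: \<delta>_def)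
  then have Lpos: "0 < L" using L1 by (metis zero_less_mult_pos zero_less_one)
  define c d h where "c = bary v k p * L" and "d = bary v j (p + u) * L" and "h = V b i"
  have cd: "0 \<le> c" "0 \<le> d" using P Q Lpos by (auto simp: c_def d_def)
  have "V a k = L + V a j" by (simp add: L_def)
  also have "\<dots> = 1 + d"
    using L1 unfolding aj d_def jp \<delta>_def by (simp add: algebra_simps)
  finally have ak: "V a k = 1 + d" .
  have aj': "V a j = - c" by (simp add: aj c_def)
  have yj: "bary v j (p + g) = 1 - bary v i (p + g)" using S[of "p + g"] Y by simp
  have h1: "bary v i (p + g) * h = 1"
    using coord[of b "p + g"] dual by (simp add: bjk Y h_def inner_add_right)
  then have h: "1 < h"
  proof -
    have "bary v i (p + g) < 1" using yj Y by simp
    moreover have "0 < h" using h1 Y(2) by (metis zero_less_mult_pos zero_less_one)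
    ultimately have "bary v i (p + g) * h < 1 * h" by (intro mult_strict_right_mono)
    then show ?thesis using h1 by simp
  qed
  then have yi: "bary v i (p + g) = 1 / h" using h1 by (simp add: field_simps)
  have "1 / h * V a i = (1 - 1 / h) * c"
    using coord[of a "p + g"] dual by (simp add: Y yj yi aj' inner_add_right)
  then have ai: "V a i = c * (h - 1)" using h by (simp add: field_simps)
  have "bary v i (p + u + g) * h = 1"
    using coord[of b "p + u + g"] dual by (simp add: bjk X h_def inner_add_right)
  then have xi: "bary v i (p + u + g) = 1 / h" using h by (simp add: field_simps)
  then have xk: "bary v k (p + u + g) = 1 - 1 / h" using S[of "p + u + g"] X by simp
  have "1 / h * (c * (h - 1)) + (1 - 1 / h) * (1 + d) = 1"
    using coord[of a "p + u + g"] dual by (simp add: X xi xk ai ak inner_add_right)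
  moreover have "h * (1 / h * s + (1 - 1 / h) * t) = s + (h - 1) * t" for s t
    using h by (simp add: algebra_simps)
  ultimately have "c * (h - 1) + (h - 1) * (1 + d) = h" by (metis mult.right_neutral)
  then have cdh: "(c + d) * (h - 1) = 1" by (simp add: algebra_simps)
  have av: "a \<bullet> v i = a \<bullet> p + c * (h - 1)" "a \<bullet> v j = a \<bullet> p - c" "a \<bullet> v k = a \<bullet> p + 1 + d"
    using ai aj' ak unfolding V_def by linarith+
  have bv: "b \<bullet> v i = b \<bullet> p + h" "b \<bullet> v j = b \<bullet> p" "b \<bullet> v k = b \<bullet> p"
    using bjk unfolding h_def V_def by linarith+
  have sq: "p \<in> tri v" "p + u \<in> tri v" "p + g \<in> tri v" "p + u + g \<in> tri v"
    using P Q X Y by (simp_all add: mem)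
  show ?thesis
    by (rule that[OF D Z dual rep sq av bv cd h cdh])
qed

section \<open>Bounds from a single split, and tools for the lattice width\<close>

lemma line_gauge_leI:
  assumes "of_int b < u" "u < of_int b + 1"
    and "A - u \<le> z * (of_int b + 1 - u)" "u - A \<le> z * (u - of_int b)"
  shows "line_gauge b u A \<le> z"
  using assms by (simp add: line_gauge_def pos_divide_le_eq)

lemma single_split_bound:
  assumes n: "n \<in> Zpts" "w \<in> Zpts" "n \<bullet> w = 1" and b: "of_int b < n \<bullet> f" "n \<bullet> f < of_int b + 1"
    and le: "\<And>l. line_gauge b (n \<bullet> f) (n \<bullet> v l) \<le> z"
    and s: "s \<in> split_closure v f"
  shows "1 \<le> z * (\<Sum>l\<in>UNIV. s $ l)"
proof -
  have "1 \<le> (\<Sum>l\<in>UNIV. split_gauge n b f (v l - f) * s $ l)"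
    by (rule split_closureD[OF s n b])
  also have "\<dots> \<le> (\<Sum>l\<in>UNIV. z * s $ l)"
    using s le by (intro sum_mono mult_right_mono) (auto simp: split_gauge_eq cut_closure_def)
  finally show ?thesis by (simp add: sum_distrib_left)
qed

lemma tri_inner_le:
  assumes tri: "is_triangle v" and d: "distinct [i, j, k]" and x: "x \<in> tri v"
    and le: "n \<bullet> v i \<le> M" "n \<bullet> v j \<le> M" "n \<bullet> v k \<le> M"
  shows "n \<bullet> x \<le> (M :: real)"
proof -
  have pos: "0 \<le> bary v l x" for l using x by (auto simp: tri_eq[OF tri])
  have "n \<bullet> x \<le> bary v i x * M + bary v j x * M + bary v k x * M"
    unfolding inner_combination[OF tri d, of n x] using le pos by (intro add_mono mult_left_mono) auto
  also have "\<dots> = M" using bary_eqD(1)[OF tri d, of x] by (metis distrib_right mult_1)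
  finally show ?thesis .
qed

lemma vertex_in_tri: "v i \<in> tri v"
  by (simp add: hull_inc)

lemma width_ge:
  assumes "x \<in> tri v" "y \<in> tri v"
  shows "u \<bullet> x - u \<bullet> y \<le> (SUP x\<in>tri v. u \<bullet> x) - (INF x\<in>tri v. u \<bullet> x)"
proof -
  have "compact ((\<lambda>x. u \<bullet> x) ` tri v)"
    by (intro compact_continuous_image continuous_intros finite_imp_compact_convex_hull) simp
  then have "bounded ((\<lambda>x. u \<bullet> x) ` tri v)" by (rule compact_imp_bounded)
  then have "bdd_above ((\<lambda>x. u \<bullet> x) ` tri v)" "bdd_below ((\<lambda>x. u \<bullet> x) ` tri v)"
    by (rule bounded_imp_bdd_above, rule bounded_imp_bdd_below)
  then have "u \<bullet> x \<le> (SUP x\<in>tri v. u \<bullet> x)" "(INF x\<in>tri v. u \<bullet> x) \<le> u \<bullet> y"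
    using assms by (auto intro: cSUP_upper cINF_lower)
  then show ?thesis by linarith
qed

lemma width_eq:
  assumes tri: "is_triangle v" and d: "distinct [i, j, k]" and ijk: "{i', j'} \<subseteq> {i, j, k}"
    and "n \<bullet> v i \<le> n \<bullet> v i'" "n \<bullet> v j \<le> n \<bullet> v i'" "n \<bullet> v k \<le> n \<bullet> v i'"
    and "n \<bullet> v j' \<le> n \<bullet> v i" "n \<bullet> v j' \<le> n \<bullet> v j" "n \<bullet> v j' \<le> n \<bullet> v k"
  shows "(SUP x\<in>tri v. n \<bullet> x) - (INF x\<in>tri v. n \<bullet> x) = n \<bullet> v i' - n \<bullet> v j'"
proof -
  have "(SUP x\<in>tri v. n \<bullet> x) = n \<bullet> v i'"
    using tri_inner_le[OF tri d, of _ n "n \<bullet> v i'"] assms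
    by (intro cSup_eq_maximum) (auto intro: vertex_in_tri)
  moreover have "(INF x\<in>tri v. n \<bullet> x) = n \<bullet> v j'"
    using tri_inner_le[OF tri d, of _ "- n" "- (n \<bullet> v j')"] assms
    by (intro cInf_eq_minimum) (auto intro: vertex_in_tri)
  ultimately show ?thesis by simp
qed

lemma measure_interior_le:
  assumes "interior (tri v) \<subseteq> G \<union> B" "G \<subseteq> interior (tri v)" "G \<in> sets lebesgue" "B \<in> lmeasurable"
  shows "measure lebesgue (tri v) \<le> measure lebesgue G + measure lebesgue B"
proof -
  have int: "interior (tri v) \<in> lmeasurable"
    by (intro lmeasurable_interior) (auto simp: range_3 finite_imp_bounded_convex_hull)
  have G: "G \<in> lmeasurable" by (rule fmeasurableI2[OF int assms(2,3)])
  have "measure lebesgue (interior (tri v)) \<le> measure lebesgue (G \<union> B)"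
    using assms(1) int G assms(4) by (intro measure_mono_fmeasurable) auto
  also have "\<dots> \<le> measure lebesgue G + measure lebesgue B"
    using G assms(4) by (intro measure_Un_le) auto
  finally show ?thesis by (simp add: measure_interior_tri)
qed

lemma measure_Diff_Un_le:
  assumes "A \<in> lmeasurable" "B \<in> lmeasurable" "C \<in> lmeasurable" "B \<subseteq> A"
  shows "(A - B) \<union> C \<in> lmeasurable"
    "measure lebesgue ((A - B) \<union> C) \<le> measure lebesgue A - measure lebesgue B + measure lebesgue C"
proof -
  have D: "A - B \<in> lmeasurable" "measure lebesgue (A - B) = measure lebesgue A - measure lebesgue B"
    using assms by (auto intro: measurable_measure_Diff fmeasurableD)
  then show "(A - B) \<union> C \<in> lmeasurable" using assms by auto
  show "measure lebesgue ((A - B) \<union> C) \<le> measure lebesgue A - measure lebesgue B + measure lebesgue C"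
    using measure_Un_le[of "A - B" lebesgue C] D assms by auto
qed

text \<open>In the coordinates \<open>X = a \<bullet> (x - p)\<close> and \<open>Y = b \<bullet> (x - p)\<close> the vertices are
  \<open>v i = (c * (h - 1), h)\<close>, \<open>v j = (- c, 0)\<close> and \<open>v k = (1 + d, 0)\<close>, and the unit square is inscribed.\<close>

locale type2_frame =
  fixes v :: "3 \<Rightarrow> real^2" and i j k :: 3 and p u g a b :: "real^2" and c d h :: real
  assumes tri: "is_triangle v" and D: "distinct [i, j, k]"
    and Z: "p \<in> Zpts" "u \<in> Zpts" "g \<in> Zpts" "a \<in> Zpts" "b \<in> Zpts"
    and dual: "a \<bullet> u = 1" "a \<bullet> g = 0" "b \<bullet> u = 0" "b \<bullet> g = 1"
    and rep: "\<forall>r. r = (a \<bullet> r) *\<^sub>R u + (b \<bullet> r) *\<^sub>R g"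
    and square: "p \<in> tri v" "p + u \<in> tri v" "p + g \<in> tri v" "p + u + g \<in> tri v"
    and av: "a \<bullet> v i = a \<bullet> p + c * (h - 1)" "a \<bullet> v j = a \<bullet> p - c" "a \<bullet> v k = a \<bullet> p + 1 + d"
    and bv: "b \<bullet> v i = b \<bullet> p + h" "b \<bullet> v j = b \<bullet> p" "b \<bullet> v k = b \<bullet> p"
    and cd: "0 \<le> c" "0 \<le> d" and h: "1 < h" and cdh: "(c + d) * (h - 1) = 1"
begin

lemma base_length: "1 + c + d = h / (h - 1)"
  using cdh h by (simp add: field_simps)

lemma apex: "c * (h - 1) = 1 - d * (h - 1)" "0 \<le> c * (h - 1)" "0 \<le> d * (h - 1)"
  using cdh by (simp add: algebra_simps) (use cd h in \<open>simp_all add: mult_nonneg_nonneg\<close>)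

lemma width_b: "(SUP x\<in>tri v. b \<bullet> x) - (INF x\<in>tri v. b \<bullet> x) = h"
  using width_eq[OF tri D, of i j b] h by (simp add: bv)

lemma width_a: "(SUP x\<in>tri v. a \<bullet> x) - (INF x\<in>tri v. a \<bullet> x) = h / (h - 1)"
proof -
  have "c * (h - 1) \<le> 1 + d" "- c \<le> c * (h - 1)" using apex cd by linarith+
  then show ?thesis
    using width_eq[OF tri D, of k j a] cd base_length by (simp add: av)
qed

text \<open>If one coefficient of \<open>m\<close> in the dual basis vanishes, \<open>m\<close> is a
  multiple of \<open>a\<close> or \<open>b\<close>. Otherwise the diagonals of the inscribed square
  already give width at least \<open>\<bar>\<alpha>\<bar> + \<bar>\<beta>\<bar> \<ge> 2\<close>, and
  the claimed minimum is at most 2.\<close>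

lemma width_lower:
  assumes m: "m \<in> Zpts" "m \<noteq> 0"
  shows "min h (h / (h - 1)) \<le> (SUP x\<in>tri v. m \<bullet> x) - (INF x\<in>tri v. m \<bullet> x)" (is "_ \<le> ?W")
proof -
  obtain \<alpha> \<beta> where ab: "m \<bullet> u = of_int \<alpha>" "m \<bullet> g = of_int \<beta>"
    using Zpts_inner[OF m(1) Z(2)] Zpts_inner[OF m(1) Z(3)] by (auto elim!: Ints_cases)
  have m_eq: "m \<bullet> r = (a \<bullet> r) * of_int \<alpha> + (b \<bullet> r) * of_int \<beta>" for r
    by (subst rep[rule_format, of r]) (simp add: inner_add_right ab)
  have W: "m \<bullet> x - m \<bullet> y \<le> ?W" if "x \<in> tri v" "y \<in> tri v" for x y
    by (rule width_ge[OF that])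
  have min2: "min h (h / (h - 1)) \<le> 2"
  proof (cases "h \<le> 2")
    case False
    then have "h / (h - 1) \<le> 2" by (simp add: field_simps)
    then show ?thesis by simp
  qed simp
  have hpos: "0 < h / (h - 1)" using h by simp
  consider "\<alpha> = 0" "\<beta> = 0" | "\<alpha> = 0" "\<beta> \<noteq> 0" | "\<alpha> \<noteq> 0" "\<beta> = 0" | "\<alpha> \<noteq> 0" "\<beta> \<noteq> 0" by blast
  then show ?thesis
  proof cases
    case 1
    then have "m \<bullet> m = 0" by (subst m_eq) simp
    then show ?thesis using m(2) by simp
  next
    case 2
    have "m \<bullet> v i - m \<bullet> v j = h * of_int \<beta>" "m \<bullet> v j - m \<bullet> v i = h * of_int (- \<beta>)"
      using 2 by (simp_all add: m_eq bv algebra_simps)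
    then have "h * of_int \<beta> \<le> ?W" "h * of_int (- \<beta>) \<le> ?W"
      using W[OF vertex_in_tri[of v i] vertex_in_tri[of v j]] W[OF vertex_in_tri[of v j] vertex_in_tri[of v i]] by simp_all
    then have "h * of_int \<bar>\<beta>\<bar> \<le> ?W" by (cases "0 \<le> \<beta>") auto
    moreover have "h * 1 \<le> h * of_int \<bar>\<beta>\<bar>" using 2 h by (intro mult_left_mono) auto
    ultimately show ?thesis by linarith
  next
    case 3
    have "m \<bullet> v k - m \<bullet> v j = h / (h - 1) * of_int \<alpha>" "m \<bullet> v j - m \<bullet> v k = h / (h - 1) * of_int (- \<alpha>)"
      unfolding base_length[symmetric] using 3 by (simp_all add: m_eq av algebra_simps)
    then have "h / (h - 1) * of_int \<alpha> \<le> ?W" "h / (h - 1) * of_int (- \<alpha>) \<le> ?W"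
      using W[OF vertex_in_tri[of v k] vertex_in_tri[of v j]] W[OF vertex_in_tri[of v j] vertex_in_tri[of v k]] by simp_all
    then have "h / (h - 1) * of_int \<bar>\<alpha>\<bar> \<le> ?W" by (cases "0 \<le> \<alpha>") auto
    moreover have "h / (h - 1) * 1 \<le> h / (h - 1) * of_int \<bar>\<alpha>\<bar>" using 3 hpos by (intro mult_left_mono) auto
    ultimately show ?thesis by linarith
  next
    case 4
    have "of_int \<alpha> + of_int \<beta> \<le> ?W" "- (of_int \<alpha> + of_int \<beta>) \<le> ?W"
      "of_int \<alpha> - of_int \<beta> \<le> ?W" "- (of_int \<alpha> - of_int \<beta>) \<le> ?W"
      using W[OF square(4,1)] W[OF square(1,4)] W[OF square(2,3)] W[OF square(3,2)]
      by (simp_all add: inner_add_right ab)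
    then have "of_int (\<bar>\<alpha>\<bar> + \<bar>\<beta>\<bar>) \<le> ?W" by (auto simp: abs_if)
    moreover have "2 \<le> \<bar>\<alpha>\<bar> + \<bar>\<beta>\<bar>" using 4 by linarith
    then have "(2::real) \<le> of_int (\<bar>\<alpha>\<bar> + \<bar>\<beta>\<bar>)" by linarith
    ultimately show ?thesis using min2 by linarith
  qed
qed

lemma lattice_width: "lattice_width (tri v) = min h (h / (h - 1))"
  unfolding lattice_width_def
proof (intro cInf_eq_minimum)
  have "a \<noteq> 0" "b \<noteq> 0" using dual by auto
  then show "min h (h / (h - 1)) \<in> (\<lambda>u. (SUP x\<in>tri v. u \<bullet> x) - (INF x\<in>tri v. u \<bullet> x)) ` (Zpts - {0})"
    using width_a width_b Z by (cases "h \<le> h / (h - 1)") (force simp: min_def)+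
qed (use width_lower in auto)

section \<open>Points settled by the split in \<open>Y\<close> or the split in
  \<open>X\<close>\<close>

definition good :: "real \<Rightarrow> (real^2) set" where
  "good z = {f \<in> interior (tri v). \<forall>s\<in>split_closure v f. 1 \<le> z * (\<Sum>l\<in>UNIV. s $ l)}"

lemma bary_sum1: "bary v i f + bary v j f + bary v k f = 1"
  by (rule bary_eqD(1)[OF tri D])

lemma Y_eq: "b \<bullet> f - b \<bullet> p = h * bary v i f"
proof -
  have "b \<bullet> f = (bary v i f + bary v j f + bary v k f) * (b \<bullet> p) + h * bary v i f"
    by (simp add: inner_combination[OF tri D, of b f] bv algebra_simps)
  then show ?thesis by (simp add: bary_sum1)
qed

lemma X_eq: "a \<bullet> f - a \<bullet> p + c = c * h * bary v i f + h / (h - 1) * bary v k f"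
proof -
  have j: "bary v j f = 1 - bary v i f - bary v k f" using bary_sum1[of f] by simp
  show ?thesis
    unfolding base_length[symmetric] inner_combination[OF tri D, of a f] av j
    by (simp add: algebra_simps)
qed

lemma X_eq': "a \<bullet> p + 1 + d - a \<bullet> f = d * h * bary v i f + h / (h - 1) * bary v j f"
proof -
  have "a \<bullet> p + 1 + d - a \<bullet> f = (1 + c + d) * (bary v i f + bary v j f + bary v k f) - (c * h * bary v i f + h / (h - 1) * bary v k f)"
    using X_eq[of f] by (simp add: bary_sum1)
  also have "\<dots> = (1 + c + d - c * h) * bary v i f + h / (h - 1) * bary v j f"
    by (simp add: base_length[symmetric] algebra_simps)
  also have "1 + c + d - c * h = d * h" using apex(1) by (simp add: algebra_simps)
  finally show ?thesis .
qed

text \<open>With \<open>y\<close> the height of \<open>f\<close>, the split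
  \<open>0 \<le> Y \<le> 1\<close> has gauge 1 at both base vertices and
  \<open>(h - y) / (1 - y)\<close> at the apex; the hypothesis says that the latter is at most
  \<open>z\<close>.\<close>

lemma good_Y:
  assumes f: "f \<in> interior (tri v)" and z: "1 < z" and y: "h * bary v i f * (z - 1) \<le> z - h"
  shows "f \<in> good z"
proof -
  obtain m where m: "b \<bullet> p = of_int m" using Zpts_inner[OF Z(5,1)] by (auto elim: Ints_cases)
  define y where "y = h * bary v i f"
  have pos: "0 < bary v l f" for l using f by (auto simp: interior_tri_eq[OF tri])
  have y0: "0 < y" using pos[of i] h by (simp add: y_def)
  have "bary v i f < 1" using bary_sum1[of f] pos[of j] pos[of k] by linarith
  then have yh: "y < h" using h by (simp add: y_def)
  have "y * (z - 1) < 1 * (z - 1)" using y h by (simp add: y_def)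
  then have y1: "y < 1" using z by (simp add: mult_less_cancel_right)
  have bf: "b \<bullet> f = of_int m + y" using Y_eq[of f] m by (simp add: y_def)
  have zy: "h - y \<le> z * (1 - y)" using y by (simp add: y_def algebra_simps)
  have yz: "y \<le> z * y" "0 \<le> z * (1 - y)" "0 \<le> z * y" using y0 y1 z by auto
  then have yhz: "y - h \<le> z * y" "- y \<le> z * (1 - y)" using h y0 by linarith+
  have "\<forall>l. line_gauge m (b \<bullet> f) (b \<bullet> v l) \<le> z"
    unfolding distinct3_all[OF D] bv m bf
    using y0 y1 yhz zy yz by (intro conjI line_gauge_leI; simp add: algebra_simps)
  then show ?thesis
    unfolding good_def using f single_split_bound[OF Z(5,3) dual(4), of m f v z] bf y0 y1 by auto
qed

text \<open>With \<open>x\<close> the abscissa of \<open>f\<close>, the split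
  \<open>0 \<le> X \<le> 1\<close> has gauges \<open>(x + c) / x\<close> and
  \<open>(1 + d - x) / (1 - x)\<close> at the base vertices, whence the two hypotheses. The apex has
  abscissa \<open>c * (h - 1)\<close> between 0 and 1, so its gauge is at most 1.\<close>

lemma good_X:
  assumes f: "f \<in> interior (tri v)" and z: "1 < z"
    and x: "c \<le> (z - 1) * (a \<bullet> f - a \<bullet> p)" "d \<le> (z - 1) * (a \<bullet> p + 1 - a \<bullet> f)"
  shows "f \<in> good z"
proof -
  obtain m where m: "a \<bullet> p = of_int m" using Zpts_inner[OF Z(4,1)] by (auto elim: Ints_cases)
  define x where "x = a \<bullet> f - a \<bullet> p"
  have pos: "0 < bary v l f" for l using f by (auto simp: interior_tri_eq[OF tri])
  have pos': "0 < h / (h - 1) * bary v l f" for l using pos h by simp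
  \<comment> \<open>For \<open>c = 0\<close> the hypothesis gives only \<open>0 \<le> x\<close>;
    strictness then comes from \<open>f\<close> being interior.\<close>
  have x0: "0 < x"
  proof (cases "c = 0")
    case True
    then show ?thesis using X_eq[of f] pos'[of k] by (simp add: x_def)
  next
    case False
    then have "0 < (z - 1) * x" using x cd by (simp add: x_def)
    then show ?thesis using z by (simp add: zero_less_mult_iff)
  qed
  have x1: "x < 1"
  proof (cases "d = 0")
    case True
    then show ?thesis using X_eq'[of f] pos'[of j] by (simp add: x_def)
  next
    case False
    then have "0 < (z - 1) * (1 - x)" using x cd by (simp add: x_def algebra_simps)
    then show ?thesis using z by (simp add: zero_less_mult_iff)
  qed
  have af: "a \<bullet> f = of_int m + x" using m by (simp add: x_def)
  have xz: "x \<le> z * x" "1 - x \<le> z * (1 - x)" using x0 x1 z by auto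
  have cx: "x + c \<le> z * x" "1 + d - x \<le> z * (1 - x)" using x by (simp_all add: x_def algebra_simps)
  have e: "0 \<le> c * (h - 1)" "c * (h - 1) \<le> 1" using apex by auto
  have "\<forall>l. line_gauge m (a \<bullet> f) (a \<bullet> v l) \<le> z"
    unfolding distinct3_all[OF D] av m af
    using x0 x1 xz cx e cd by (intro conjI line_gauge_leI; simp)
  then show ?thesis
    unfolding good_def using f single_split_bound[OF Z(4,2) dual(1), of m f v z] af x0 x1 by auto
qed

lemma not_good:
  assumes f: "f \<in> interior (tri v)" "f \<notin> good z" and z: "1 < z"
  shows "z - h < h * bary v i f * (z - 1)"
    "c * h * bary v i f + h / (h - 1) * bary v k f < c * (z / (z - 1)) \<or>
     d * h * bary v i f + h / (h - 1) * bary v j f < d * (z / (z - 1))"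
proof -
  show "z - h < h * bary v i f * (z - 1)" using good_Y[OF f(1) z] f(2) by linarith
  have "(z - 1) * (a \<bullet> f - a \<bullet> p) < c \<or> (z - 1) * (a \<bullet> p + 1 - a \<bullet> f) < d"
    using good_X[OF f(1) z] f(2) by linarith
  moreover have "c * (z / (z - 1)) = c + c / (z - 1)" "d * (z / (z - 1)) = d + d / (z - 1)"
    using z by (simp_all add: field_simps)
  moreover have "t < r / (z - 1)" if "(z - 1) * t < r" for t r
    using that z by (simp add: field_simps)
  ultimately show "c * h * bary v i f + h / (h - 1) * bary v k f < c * (z / (z - 1)) \<or>
     d * h * bary v i f + h / (h - 1) * bary v j f < d * (z / (z - 1))"
    unfolding X_eq[symmetric] X_eq'[symmetric] by fastforce
qed

end

text \<open>The triangle where the split \<open>0 \<le> X \<le> 1\<close> is too weak near the vertex \<open>v j\<close>, from which the part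
  with \<open>X < 0\<close> that is handled by the split \<open>0 \<le> Y \<le> 1\<close> is removed.\<close>

lemma side_region:
  assumes tri: "is_triangle v" and d: "distinct [i, j, k]"
    and c: "0 \<le> c" and h: "1 < h" and \<zeta>: "1 \<le> \<zeta>" and \<tau>: "0 < \<tau>"
  obtains B where "B \<in> lmeasurable"
    "measure lebesgue B \<le> c * (h - 1) / h^2 * (\<zeta>^2 - 1 + \<tau>^2) * measure lebesgue (tri v)"
    "\<And>f. \<lbrakk>f \<in> tri v; c * h * bary v i f + h / (h - 1) * bary v k f < c * \<zeta>; 1 - \<tau> \<le> h * bary v i f\<rbrakk> \<Longrightarrow> f \<in> B"
proof -
  \<comment> \<open>The triangle cut off at \<open>v j\<close> by the line
    \<open>X + c = c * \<zeta>\<close>; the two quotients are its intercepts on the edges at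
    \<open>v j\<close>.\<close>
  define S where "S = (\<lambda>\<zeta>. convex hull {v j, v j + (\<zeta> / h) *\<^sub>R (v i - v j), v j + (c * \<zeta> * (h - 1) / h) *\<^sub>R (v k - v j)})"
  \<comment> \<open>In the frame, at the corner \<open>v j\<close>, these are \<open>p + g\<close>
    and \<open>p\<close>, so \<open>S 1\<close> is the part with \<open>X \<le> 0\<close>.\<close>
  define P Q where "P = v j + (1 / h) *\<^sub>R (v i - v j)" and "Q = v j + (c * (h - 1) / h) *\<^sub>R (v k - v j)"
  \<comment> \<open>\<open>P\<close> has height 1 while \<open>v j\<close> and \<open>Q\<close> have
    height 0, so the part of \<open>S 1\<close> above height \<open>1 - \<tau>\<close> is a copy
    shrunk by \<open>\<tau>\<close> towards \<open>P\<close>.\<close>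
  define T where "T = convex hull {P, P + \<tau> *\<^sub>R (v j - P), P + \<tau> *\<^sub>R (Q - P)}"
  have d': "distinct [j, i, k]" using d by auto
  have mS: "measure lebesgue (S \<zeta>) = c * (h - 1) / h^2 * \<zeta>^2 * measure lebesgue (tri v)" if "0 \<le> \<zeta>" for \<zeta>
  proof -
    have "measure lebesgue (S \<zeta>) = \<bar>\<zeta> / h * (c * \<zeta> * (h - 1) / h)\<bar> * measure lebesgue (tri v)"
      unfolding S_def sub_triangle_area tri_perm[OF d', of v] ..
    also have "\<bar>\<zeta> / h * (c * \<zeta> * (h - 1) / h)\<bar> = \<zeta> / h * (c * \<zeta> * (h - 1) / h)"
      using that c h by (intro abs_of_nonneg mult_nonneg_nonneg divide_nonneg_nonneg) auto
    finally show ?thesis by (simp add: power2_eq_square field_simps)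
  qed
  have "measure lebesgue T = \<bar>\<tau> * \<tau>\<bar> * measure lebesgue (convex hull {P, v j, Q})"
    unfolding T_def by (rule sub_triangle_area)
  also have "{P, v j, Q} = {v j, P, Q}" by auto
  also have "measure lebesgue (convex hull {v j, P, Q}) = measure lebesgue (S 1)"
    by (simp add: S_def P_def Q_def)
  finally have mT: "measure lebesgue T = \<tau>^2 * measure lebesgue (S 1)"
    by (simp add: power2_eq_square)
  have sub: "S 1 \<subseteq> S \<zeta>"
  proof
    fix f assume "f \<in> S 1"
    then obtain \<alpha> \<beta> where f: "f = v j + (\<alpha> * (1 / h)) *\<^sub>R (v i - v j) + (\<beta> * (c * 1 * (h - 1) / h)) *\<^sub>R (v k - v j)"
      and ab: "0 \<le> \<alpha>" "0 \<le> \<beta>" "\<alpha> + \<beta> \<le> 1"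
      unfolding S_def by (rule sub_triangle_memE)
    show "f \<in> S \<zeta>"
      unfolding S_def
      by (rule sub_triangle_mem[OF f, of "\<alpha> / \<zeta>" _ "\<beta> / \<zeta>"])
        (use ab \<zeta> in \<open>auto simp: add_divide_distrib[symmetric]\<close>)
  qed
  have lm: "S \<zeta> \<in> lmeasurable" "S 1 \<in> lmeasurable" "T \<in> lmeasurable"
    by (simp_all add: S_def T_def convex_hull_3_lmeasurable)
  show ?thesis
  proof (rule that[of "(S \<zeta> - S 1) \<union> T"])
    show "(S \<zeta> - S 1) \<union> T \<in> lmeasurable" by (rule measure_Diff_Un_le[OF lm sub])
    have "measure lebesgue ((S \<zeta> - S 1) \<union> T) \<le> measure lebesgue (S \<zeta>) - measure lebesgue (S 1) + measure lebesgue T"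
      by (rule measure_Diff_Un_le[OF lm sub])
    also have "\<dots> = c * (h - 1) / h^2 * (\<zeta>^2 - 1 + \<tau>^2) * measure lebesgue (tri v)"
      using \<zeta> by (simp add: mT mS divide_inverse algebra_simps)
    finally show "measure lebesgue ((S \<zeta> - S 1) \<union> T) \<le> c * (h - 1) / h^2 * (\<zeta>^2 - 1 + \<tau>^2) * measure lebesgue (tri v)" .
  next
    fix f assume f: "f \<in> tri v" and lt: "c * h * bary v i f + h / (h - 1) * bary v k f < c * \<zeta>"
      and up: "1 - \<tau> \<le> h * bary v i f"
    have pos: "0 \<le> bary v l f" for l using f by (auto simp: tri_eq[OF tri])
    have "0 \<le> c * h * bary v i f + h / (h - 1) * bary v k f" using pos c h by simp
    \<comment> \<open>For \<open>c = 0\<close> no point satisfies the strict inequality, so division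
      by \<open>c\<close> is safe from here on.\<close>
    then have c0: "0 < c" using lt c by (cases "c = 0") auto
    have "(c * h * bary v i f + h / (h - 1) * bary v k f) / (c * \<zeta>) \<le> 1" using lt c0 \<zeta> by simp
    moreover have "(c * h * bary v i f + h / (h - 1) * bary v k f) / (c * \<zeta>)
        = bary v i f * h / \<zeta> + bary v k f * h / (c * \<zeta> * (h - 1))"
      using c0 \<zeta> h by (simp add: field_simps)
    ultimately have "bary v i f * h / \<zeta> + bary v k f * h / (c * \<zeta> * (h - 1)) \<le> 1" by simp
    then have "f \<in> S \<zeta>"
      unfolding S_def
      by (intro sub_triangle_mem[OF bary_eqD(2)[OF tri d', of f], of "bary v i f * h / \<zeta>" _ "bary v k f * h / (c * \<zeta> * (h - 1))"])
        (use pos c0 \<zeta> h in auto)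
    moreover have "f \<in> T" if "f \<in> S 1"
    proof -
      from \<open>f \<in> S 1\<close> obtain \<alpha> \<beta> where f': "f = v j + (\<alpha> * (1 / h)) *\<^sub>R (v i - v j) + (\<beta> * (c * 1 * (h - 1) / h)) *\<^sub>R (v k - v j)"
        and ab: "0 \<le> \<alpha>" "0 \<le> \<beta>" "\<alpha> + \<beta> \<le> 1"
        unfolding S_def by (rule sub_triangle_memE)
      have "bary v i f = \<alpha> / h"
        using d unfolding f' bary_add_diff by (auto simp: bary_vertex[OF tri])
      then have \<alpha>: "1 - \<alpha> \<le> \<tau>" using up h by simp
      have "f = v j + \<alpha> *\<^sub>R (P - v j) + \<beta> *\<^sub>R (Q - v j)" by (simp add: f' P_def Q_def)
      then have "f = P + (1 - \<alpha> - \<beta>) *\<^sub>R (v j - P) + \<beta> *\<^sub>R (Q - P)" by (simp add: algebra_simps)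
      then show ?thesis
        unfolding T_def
        by (rule sub_triangle_mem[of _ _ _ _ _ _ "(1 - \<alpha> - \<beta>) / \<tau>" _ "\<beta> / \<tau>"])
          (use ab \<alpha> \<tau> in \<open>auto simp: add_divide_distrib[symmetric]\<close>)
    qed
    ultimately show "f \<in> (S \<zeta> - S 1) \<union> T" by blast
  qed
qed

text \<open>In the frame \<open>P\<close> is \<open>p + g\<close> and \<open>Q\<close> is
  \<open>p + u + g\<close>. The line \<open>X = c * \<xi>\<close> meets the ray from
  \<open>P\<close> to the apex at ratio \<open>\<xi> / (h - 1)\<close> and the ray along the chord
  at ratio \<open>c * \<xi>\<close>. The resulting triangle may stick out of the big one, which is
  harmless for a cover.\<close>

lemma top_region:
  assumes tri: "is_triangle v" and d: "distinct [i, j, k]"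
    and c: "0 \<le> c" and h: "1 < h" and \<xi>: "0 < \<xi>"
  obtains B where "B \<in> lmeasurable"
    "measure lebesgue B = c * (h - 1) / h^2 * \<xi>^2 * measure lebesgue (tri v)"
    "\<And>f. \<lbrakk>f \<in> tri v; c * h * bary v i f + h / (h - 1) * bary v k f < c * (1 + \<xi>); 1 \<le> h * bary v i f\<rbrakk> \<Longrightarrow> f \<in> B"
proof -
  define \<theta> where "\<theta> = (h - 1) / h"
  have \<theta>: "0 < \<theta>" "1 - \<theta> = 1 / h" using h by (simp_all add: \<theta>_def field_simps)
  define P Q where "P = v i + \<theta> *\<^sub>R (v j - v i)" and "Q = v i + \<theta> *\<^sub>R (v k - v i)"
  define B where "B = convex hull {P, P + (\<xi> / (h - 1)) *\<^sub>R (v i - P), P + (c * \<xi>) *\<^sub>R (Q - P)}"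
  have "measure lebesgue B = \<bar>\<xi> / (h - 1) * (c * \<xi>)\<bar> * measure lebesgue (convex hull {P, v i, Q})"
    unfolding B_def by (rule sub_triangle_area)
  also have "{P, v i, Q} = {v i, P, Q}" by auto
  also have "measure lebesgue (convex hull {v i, P, Q}) = \<bar>\<theta> * \<theta>\<bar> * measure lebesgue (tri v)"
    unfolding P_def Q_def sub_triangle_area tri_perm[OF d, of v] ..
  also have "\<bar>\<xi> / (h - 1) * (c * \<xi>)\<bar> = \<xi> / (h - 1) * (c * \<xi>)" using \<xi> c h by simp
  also have "\<bar>\<theta> * \<theta>\<bar> = (h - 1)^2 / h^2" by (simp add: \<theta>_def power2_eq_square)
  finally have mB: "measure lebesgue B = c * (h - 1) / h^2 * \<xi>^2 * measure lebesgue (tri v)"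
    using h by (simp add: power2_eq_square)
  show ?thesis
  proof (rule that[OF _ mB])
    show "B \<in> lmeasurable" by (simp add: B_def convex_hull_3_lmeasurable)
  next
    fix f assume f: "f \<in> tri v" and lt: "c * h * bary v i f + h / (h - 1) * bary v k f < c * (1 + \<xi>)"
      and up: "1 \<le> h * bary v i f"
    have pos: "0 \<le> bary v l f" for l using f by (auto simp: tri_eq[OF tri])
    define \<mu> \<nu> where "\<mu> = 1 - (1 - bary v i f) / \<theta>" and "\<nu> = bary v k f / \<theta>"
    have "1 - bary v i f \<le> \<theta>" using up h by (simp add: \<theta>_def field_simps)
    then have \<mu>: "0 \<le> \<mu>" using \<theta> by (simp add: \<mu>_def)
    have \<nu>: "0 \<le> \<nu>" using \<theta> pos by (simp add: \<nu>_def)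
    have lt': "c * (h - 1) * \<mu> + \<nu> < c * \<xi>"
    proof -
      have "(h - 1) * \<mu> = h * bary v i f - 1" "\<nu> = h / (h - 1) * bary v k f"
        using h by (simp_all add: \<mu>_def \<nu>_def \<theta>_def field_simps)
      then have "c * (h - 1) * \<mu> + \<nu> = c * (h * bary v i f - 1) + h / (h - 1) * bary v k f"
        by (simp add: mult.assoc)
      then show ?thesis using lt by (simp add: algebra_simps)
    qed
    have "0 \<le> c * (h - 1) * \<mu> + \<nu>" using c h \<mu> \<nu> by simp
    then have c0: "0 < c" using lt' c by (cases "c = 0") auto
    have "(c * (h - 1) * \<mu> + \<nu>) / (c * \<xi>) \<le> 1" using lt' c0 \<xi> by simp
    moreover have "(c * (h - 1) * \<mu> + \<nu>) / (c * \<xi>) = \<mu> * (h - 1) / \<xi> + \<nu> / (c * \<xi>)"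
      using c0 \<xi> by (simp add: field_simps)
    ultimately have le: "\<mu> * (h - 1) / \<xi> + \<nu> / (c * \<xi>) \<le> 1" by simp
    have s1: "bary v j f = 1 - bary v i f - bary v k f" using bary_eqD(1)[OF tri d, of f] by simp
    have coef: "\<theta> * (1 - \<mu> - \<nu>) = bary v j f" "\<theta> * \<nu> = bary v k f"
      using \<theta>(1) by (simp_all add: \<mu>_def \<nu>_def s1 field_simps)
    have "P + \<mu> *\<^sub>R (v i - P) + \<nu> *\<^sub>R (Q - P) = v i + (\<theta> * (1 - \<mu> - \<nu>)) *\<^sub>R (v j - v i) + (\<theta> * \<nu>) *\<^sub>R (v k - v i)"
      by (simp add: P_def Q_def algebra_simps)
    also have "\<dots> = f" unfolding coef using bary_eqD(2)[OF tri d, of f] ..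
    finally have "f = P + \<mu> *\<^sub>R (v i - P) + \<nu> *\<^sub>R (Q - P)" ..
    then show "f \<in> B"
      unfolding B_def
      by (rule sub_triangle_mem[of _ _ _ _ _ _ "\<mu> * (h - 1) / \<xi>" _ "\<nu> / (c * \<xi>)"])
        (use le \<mu> \<nu> c0 \<xi> h in auto)
  qed
qed

section \<open>Area estimates and the lower bound for type 2\<close>

context type2_frame
begin

lemma D': "distinct [i, k, j]"
  using D by auto

lemma measure_good_ge:
  assumes "0 < z" "B \<in> lmeasurable" "interior (tri v) \<subseteq> good z \<union> B"
    "measure lebesgue B \<le> t * measure lebesgue (tri v)"
  shows "(1 - t) * measure lebesgue (tri v) \<le> measure lebesgue (good z)"
proof -
  have "measure lebesgue (tri v) \<le> measure lebesgue (good z) + measure lebesgue B"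
    using sets_split_bound[OF assms(1), of v] assms
    by (intro measure_interior_le) (auto simp: good_def)
  then show ?thesis using assms(4) by (simp add: algebra_simps)
qed

text \<open>The regions at the two sides have areas proportional to \<open>c\<close> and
  \<open>d\<close>; since \<open>(c + d) * (h - 1) = 1\<close>, the total depends on
  \<open>h\<close> alone.\<close>

lemma cd_factor: "c * (h - 1) / h^2 * t + d * (h - 1) / h^2 * t = t / h^2"
proof -
  have "c * (h - 1) / h^2 * t + d * (h - 1) / h^2 * t = ((c + d) * (h - 1)) * t / h^2"
    by (simp add: divide_inverse algebra_simps)
  then show ?thesis by (simp only: cdh mult_1)
qed

lemma interior_subset_tri: "f \<in> interior (tri v) \<Longrightarrow> f \<in> tri v"
  using interior_subset by blast

lemma measure_Un_le_sum:
  assumes "A \<in> lmeasurable" "B \<in> lmeasurable"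
    "measure lebesgue A \<le> s * M" "measure lebesgue B \<le> t * M" "s + t = r"
  shows "A \<union> B \<in> lmeasurable \<and> measure lebesgue (A \<union> B) \<le> r * (M :: real)"
proof -
  have "measure lebesgue (A \<union> B) \<le> measure lebesgue A + measure lebesgue B"
    using assms by (intro measure_Un_le) auto
  also have "\<dots> \<le> s * M + t * M" using assms by linarith
  finally show ?thesis using assms by (auto simp: distrib_right[symmetric])
qed

text \<open>\<open>\<tau>\<close> is left open: 1 makes no use of the split in \<open>Y\<close>,
  while \<open>(h - 1) / (z - 1)\<close> corresponds to the exact height above which that split
  fails.\<close>

lemma good_side:
  assumes z: "1 < z" and \<tau>: "0 < \<tau>"
    and up: "\<And>f. \<lbrakk>f \<in> interior (tri v); f \<notin> good z\<rbrakk> \<Longrightarrow> 1 - \<tau> \<le> h * bary v i f"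
  shows "(1 - ((z / (z - 1))^2 - 1 + \<tau>^2) / h^2) * measure lebesgue (tri v) \<le> measure lebesgue (good z)"
proof -
  define \<zeta> where "\<zeta> = z / (z - 1)"
  have \<zeta>: "1 \<le> \<zeta>" using z by (simp add: \<zeta>_def)
  obtain B where B: "B \<in> lmeasurable"
    "measure lebesgue B \<le> c * (h - 1) / h^2 * (\<zeta>^2 - 1 + \<tau>^2) * measure lebesgue (tri v)"
    "\<And>f. \<lbrakk>f \<in> tri v; c * h * bary v i f + h / (h - 1) * bary v k f < c * \<zeta>; 1 - \<tau> \<le> h * bary v i f\<rbrakk> \<Longrightarrow> f \<in> B"
    using side_region[OF tri D cd(1) h \<zeta> \<tau>] by blast
  obtain C where C: "C \<in> lmeasurable"
    "measure lebesgue C \<le> d * (h - 1) / h^2 * (\<zeta>^2 - 1 + \<tau>^2) * measure lebesgue (tri v)"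
    "\<And>f. \<lbrakk>f \<in> tri v; d * h * bary v i f + h / (h - 1) * bary v j f < d * \<zeta>; 1 - \<tau> \<le> h * bary v i f\<rbrakk> \<Longrightarrow> f \<in> C"
    using side_region[OF tri D' cd(2) h \<zeta> \<tau>] by blast
  have "interior (tri v) \<subseteq> good z \<union> (B \<union> C)"
    using not_good(2)[OF _ _ z] up B(3) C(3) interior_subset_tri unfolding \<zeta>_def by blast
  moreover have "B \<union> C \<in> lmeasurable \<and> measure lebesgue (B \<union> C) \<le> ((\<zeta>^2 - 1 + \<tau>^2) / h^2) * measure lebesgue (tri v)"
    by (rule measure_Un_le_sum[OF B(1) C(1) B(2) C(2) cd_factor])
  ultimately show ?thesis using z unfolding \<zeta>_def by (intro measure_good_ge) auto
qed

text \<open>By the split in \<open>Y\<close> alone, every exceptional point has height above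
  \<open>(z - h) / (z - 1)\<close>; this leaves a copy of the triangle shrunk towards the
  apex.\<close>

lemma good_bottom:
  assumes z: "h < z"
  shows "(1 - (z * (h - 1) / (h * (z - 1)))^2) * measure lebesgue (tri v) \<le> measure lebesgue (good z)"
proof -
  define \<eta> where "\<eta> = (z - h) / (z - 1) / h"
  have z1: "1 < z" using z h by simp
  have \<eta>: "0 \<le> \<eta>" "\<eta> < 1" using z h by (simp_all add: \<eta>_def pos_divide_less_eq) (smt (verit) mult_less_cancel_left1)
  have up: "\<eta> \<le> bary v i f" if "f \<in> interior (tri v)" "f \<notin> good z" for f
    using not_good(1)[OF that z1] z1 h by (simp add: \<eta>_def field_simps)
  have "interior (tri v) \<subseteq> good z \<union> {x \<in> tri v. \<eta> \<le> bary v i x}"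
    using up interior_subset_tri by blast
  then have "(1 - (1 - \<eta>)^2) * measure lebesgue (tri v) \<le> measure lebesgue (good z)"
    using corner_measure[OF tri \<eta>, of i] z1 by (intro measure_good_ge) auto
  moreover have "1 - \<eta> = z * (h - 1) / (h * (z - 1))" using z1 h by (simp add: \<eta>_def field_simps)
  ultimately show ?thesis by simp
qed

text \<open>Above height 1 the split in \<open>Y\<close> is of no use and the split in
  \<open>X\<close> takes over: the cap above the chord is removed from the region of
  \<open>good_bottom\<close> and two top triangles are put back.\<close>

lemma good_bottom_top:
  assumes z: "h < z"
  shows "(1 - ((z * (h - 1) / (h * (z - 1)))^2 - ((h - 1) / h)^2 + (1 / (z - 1))^2 / h^2)) * measure lebesgue (tri v)
      \<le> measure lebesgue (good z)"
proof -
  define \<eta> \<xi> where "\<eta> = (z - h) / (z - 1) / h" and "\<xi> = 1 / (z - 1)"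
  have z1: "1 < z" using z h by simp
  have \<eta>: "0 \<le> \<eta>" "\<eta> < 1" using z h by (simp_all add: \<eta>_def pos_divide_less_eq) (smt (verit) mult_less_cancel_left1)
  have "(z - h) / (z - 1) \<le> 1" using z h by simp
  then have \<eta>h: "\<eta> \<le> 1 / h" unfolding \<eta>_def using h by (intro divide_right_mono) auto
  have h1: "0 \<le> 1 / h" "1 / h < 1" using h by auto
  have \<xi>: "0 < \<xi>" "1 + \<xi> = z / (z - 1)" using z1 by (simp_all add: \<xi>_def field_simps)
  define A where "A = (\<lambda>\<theta>. {x \<in> tri v. \<theta> \<le> bary v i x})"
  have A: "A \<eta> \<in> lmeasurable" "A (1 / h) \<in> lmeasurable" "A (1 / h) \<subseteq> A \<eta>"
    "measure lebesgue (A \<eta>) = (1 - \<eta>)^2 * measure lebesgue (tri v)"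
    "measure lebesgue (A (1 / h)) = (1 - 1 / h)^2 * measure lebesgue (tri v)"
    using corner_measure[OF tri \<eta>, of i] corner_measure[OF tri h1, of i] \<eta>h by (auto simp: A_def)
  obtain B where B: "B \<in> lmeasurable" "measure lebesgue B = c * (h - 1) / h^2 * \<xi>^2 * measure lebesgue (tri v)"
    "\<And>f. \<lbrakk>f \<in> tri v; c * h * bary v i f + h / (h - 1) * bary v k f < c * (1 + \<xi>); 1 \<le> h * bary v i f\<rbrakk> \<Longrightarrow> f \<in> B"
    using top_region[OF tri D cd(1) h \<xi>(1)] by blast
  obtain C where C: "C \<in> lmeasurable" "measure lebesgue C = d * (h - 1) / h^2 * \<xi>^2 * measure lebesgue (tri v)"
    "\<And>f. \<lbrakk>f \<in> tri v; d * h * bary v i f + h / (h - 1) * bary v j f < d * (1 + \<xi>); 1 \<le> h * bary v i f\<rbrakk> \<Longrightarrow> f \<in> C"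
    using top_region[OF tri D' cd(2) h \<xi>(1)] by blast
  have BC: "B \<union> C \<in> lmeasurable \<and> measure lebesgue (B \<union> C) \<le> \<xi>^2 / h^2 * measure lebesgue (tri v)"
    by (rule measure_Un_le_sum[OF B(1) C(1) _ _ cd_factor]) (simp_all add: B C)
  have "interior (tri v) \<subseteq> good z \<union> ((A \<eta> - A (1 / h)) \<union> (B \<union> C))"
  proof
    fix f assume f: "f \<in> interior (tri v)"
    have "f \<in> (A \<eta> - A (1 / h)) \<union> (B \<union> C)" if ng: "f \<notin> good z"
    proof (cases "1 \<le> h * bary v i f")
      case True
      then show ?thesis
        using not_good(2)[OF f ng z1] B(3) C(3) interior_subset_tri[OF f] unfolding \<xi>(2) by blast
    next
      case False
      then have "\<not> 1 / h \<le> bary v i f" using h by (simp add: field_simps)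
      moreover have "\<eta> \<le> bary v i f" using not_good(1)[OF f ng z1] z1 h by (simp add: \<eta>_def field_simps)
      ultimately show ?thesis using interior_subset_tri[OF f] by (auto simp: A_def)
    qed
    then show "f \<in> good z \<union> ((A \<eta> - A (1 / h)) \<union> (B \<union> C))" by blast
  qed
  moreover have "(A \<eta> - A (1 / h)) \<union> (B \<union> C) \<in> lmeasurable"
    using BC by (intro measure_Diff_Un_le A) auto
  moreover have "measure lebesgue ((A \<eta> - A (1 / h)) \<union> (B \<union> C))
    \<le> ((1 - \<eta>)^2 - (1 - 1 / h)^2 + \<xi>^2 / h^2) * measure lebesgue (tri v)"
    using measure_Diff_Un_le(2)[OF A(1,2) _ A(3), of "B \<union> C"] BC by (simp add: A algebra_simps)
  ultimately have "(1 - ((1 - \<eta>)^2 - (1 - 1 / h)^2 + \<xi>^2 / h^2)) * measure lebesgue (tri v) \<le> measure lebesgue (good z)"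
    using z1 by (intro measure_good_ge) auto
  moreover have "1 - \<eta> = z * (h - 1) / (h * (z - 1))" "1 - 1 / h = (h - 1) / h"
    using z1 h by (simp_all add: \<eta>_def field_simps)
  ultimately show ?thesis by (simp add: \<xi>_def)
qed

lemma PB_ge:
  assumes "1 < z" "t * measure lebesgue (tri v) \<le> measure lebesgue (good z)"
  shows "t \<le> PB v z"
  using assms tri_measure_pos[OF tri] PB_eq[OF tri assms(1)] by (simp add: good_def pos_le_divide_eq)

lemma PB_lower:
  assumes z: "1 < z" and w: "w = lattice_width (tri v)"
    and g1: "g1 = (z - w) * (2*w*z - w - z) / (w^2 * (z - 1)^2)"
    and g2: "g2 = ((w - 1)^2 * (z - 1)^2 - 1) / (w^2 * (z - 1)^2)"
  shows "(if z \<le> w then 0 else if z \<le> w / (w - 1) then g1 else g1 + g2) \<le> PB v z"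
proof -
  have nn: "0 \<le> PB v z" by (simp add: PB_def)
  have w0: "0 < w" using h by (simp add: w lattice_width)
  \<comment> \<open>\<open>g1\<close> and \<open>g2\<close> are rewritten as differences of squares,
    the form in which ratios of areas arise.\<close>
  have "(z - w) * (2*w*z - w - z) = w^2 * (z - 1)^2 - (z * (w - 1))^2"
    by (simp add: power2_eq_square algebra_simps)
  then have "g1 = (w^2 * (z - 1)^2) / (w^2 * (z - 1)^2) - (z * (w - 1))^2 / (w * (z - 1))^2"
    unfolding g1 by (simp add: diff_divide_distrib power_mult_distrib)
  also have "(w^2 * (z - 1)^2) / (w^2 * (z - 1)^2) = 1" using w0 z by simp
  finally have g1': "g1 = 1 - (z * (w - 1) / (w * (z - 1)))^2" by (simp add: power_divide)
  have "g2 = ((w - 1)^2 * (z - 1)^2) / (w^2 * (z - 1)^2) - 1 / (w^2 * (z - 1)^2)"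
    unfolding g2 by (rule diff_divide_distrib)
  also have "((w - 1)^2 * (z - 1)^2) / (w^2 * (z - 1)^2) = ((w - 1) / w)^2" using z by (simp add: power_divide)
  finally have g2': "g2 = ((w - 1) / w)^2 - (1 / (z - 1))^2 / w^2" by (simp add: power_divide)
  show ?thesis
  \<comment> \<open>For \<open>h \<le> 2\<close> the width is the height \<open>h\<close>, and
    \<open>g1\<close> comes from the split in \<open>Y\<close> alone. For \<open>h > 2\<close> it is
    the base length \<open>h / (h - 1)\<close>, \<open>g1\<close> comes from the split in
    \<open>X\<close> alone, and \<open>w / (w - 1) = h\<close> is where the split in
    \<open>Y\<close> starts to help.\<close>
  proof (cases "h \<le> 2")
    case True
    have "h \<le> h / (h - 1)" using True h by (simp add: field_simps)
    then have w: "w = h" using w lattice_width by (simp add: min_def)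
    have "g1 = 1 - (z * (h - 1) / (h * (z - 1)))^2" using g1' by (simp only: w)
    then have 1: "g1 \<le> PB v z" if "h < z" using PB_ge[OF z good_bottom[OF that]] by simp
    have "g1 + g2 = 1 - ((z * (h - 1) / (h * (z - 1)))^2 - ((h - 1) / h)^2 + (1 / (z - 1))^2 / h^2)"
      unfolding g1' g2' w by simp
    then have "g1 + g2 \<le> PB v z" if "h < z" using PB_ge[OF z good_bottom_top[OF that]] by simp
    then show ?thesis using 1 nn w by auto
  next
    case False
    have "h / (h - 1) < h" using False h by (simp add: field_simps)
    then have w: "w = h / (h - 1)" using w lattice_width by (simp add: min_def)
    have w1: "w - 1 = 1 / (h - 1)" using h by (simp add: w field_simps)
    have ww: "w / (w - 1) = h" using h unfolding w1 by (simp add: w)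
    have pos: "0 < h * bary v i f" if "f \<in> interior (tri v)" for f
      using that h by (simp add: interior_tri_eq[OF tri])
    have "(1 - ((z / (z - 1))^2 - 1 + 1^2) / h^2) * measure lebesgue (tri v) \<le> measure lebesgue (good z)"
      using z pos by (intro good_side) (auto intro: less_imp_le)
    moreover have g1_eq: "g1 = 1 - ((z / (z - 1))^2 - 1 + 1^2) / h^2"
    proof -
      note g1'
      also have "z * (w - 1) / (w * (z - 1)) = z / (z - 1) / h"
        using h unfolding w1 by (simp add: w)
      finally show ?thesis by (simp add: power_divide power_mult_distrib)
    qed
    ultimately have 1: "g1 \<le> PB v z" using PB_ge[OF z] by simp
    have 2: "g1 + g2 \<le> PB v z" if hz: "h < z"
    proof -
      define \<tau> where "\<tau> = (h - 1) / (z - 1)"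
      have "1 - \<tau> \<le> h * bary v i f" if "f \<in> interior (tri v)" "f \<notin> good z" for f
        using not_good(1)[OF that z] z by (simp add: \<tau>_def field_simps)
      then have "(1 - ((z / (z - 1))^2 - 1 + \<tau>^2) / h^2) * measure lebesgue (tri v) \<le> measure lebesgue (good z)"
        using z h by (intro good_side) (auto simp: \<tau>_def)
      moreover have "g2 = (1 - \<tau>^2) / h^2"
      proof -
        have "(w - 1) / w = 1 / h" using h unfolding w1 by (simp add: w)
        moreover have "(1 / (z - 1))^2 / w^2 = \<tau>^2 / h^2" by (simp add: w \<tau>_def power_divide)
        ultimately show ?thesis unfolding g2' by (simp add: power_divide diff_divide_distrib)
      qed
      then have "g1 + g2 = 1 - ((z / (z - 1))^2 - 1 + \<tau>^2) / h^2"
        unfolding g1_eq by (simp add: diff_divide_distrib add_divide_distrib)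
      ultimately show ?thesis using PB_ge[OF z] by simp
    qed
    show ?thesis unfolding ww using 1 2 nn by auto
  qed
qed

end

theorem theorem1:
  fixes v1 v2 :: "3 \<Rightarrow> real^2"
  assumes T1: "type1_triangle v1" "maximal_lattice_free (convex hull (range v1))"
    and T2: "type2_triangle v2" "rational_triangle v2" "maximal_lattice_free (convex hull (range v2))"
  shows "\<forall>z::real. z > 1 \<longrightarrow>
           PB v1 z = (if z \<le> 3/2 then 0
                      else if z < 2 then 3/4 * ((2*z - 3) / (z - 1))^2
                      else 1)
         \<and> (let w = lattice_width (convex hull (range v2));
                g1 = (z - w) * (2*w*z - w - z) / (w^2 * (z - 1)^2);
                g2 = ((w - 1)^2 * (z - 1)^2 - 1) / (w^2 * (z - 1)^2)
            in PB v2 z \<ge> (if z \<le> w then 0 else if z \<le> w / (w - 1) then g1 else g1 + g2))"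
proof (intro allI impI conjI)
  fix z :: real assume z: "z > 1"
  have free1: "interior (tri v1) \<inter> Zpts = {}" and free2: "interior (tri v2) \<inter> Zpts = {}"
    using T1(2) T2(3) by (auto simp: maximal_lattice_free_def lattice_free_def)
  show "PB v1 z = (if z \<le> 3/2 then 0 else if z < 2 then 3/4 * ((2*z - 3) / (z - 1))^2 else 1)"
    by (rule type1_PB[OF T1(1) free1 z])
  have tri: "is_triangle v2" using T2(1) by (simp add: type2_triangle_def)
  obtain i j k p u g a b c d h where "type2_frame v2 i j k p u g a b c d h"
    by (rule type2_coordinates[OF T2(1) free2]) (blast intro: type2_frame.intro[OF tri])
  then interpret type2_frame v2 i j k p u g a b c d h .
  show "let w = lattice_width (convex hull (range v2));
            g1 = (z - w) * (2*w*z - w - z) / (w^2 * (z - 1)^2);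
            g2 = ((w - 1)^2 * (z - 1)^2 - 1) / (w^2 * (z - 1)^2)
        in PB v2 z \<ge> (if z \<le> w then 0 else if z \<le> w / (w - 1) then g1 else g1 + g2)"
    unfolding Let_def by (rule PB_lower[OF z refl refl refl])
qed

end
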